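(* For any $a\in\mathbb{R}$, \[ \frac{1}{A^+_a} = \gamma^+_a = \lambda^+_a\quad\mbox{and}\quad \frac{1}{A^-_a} = \gamma^-_a = \lambda^-_a \] with \[ B^+_a\leq A^+_a\leq 4B^+_a \quad\mbox{and}\quad B^-_a\leq A^-_a\leq 4B^-_a. \] Furthermore, \[ \sup_{a\in\mathbb{R}}\left(A^+_a\wedge A^-_a\right) \leq c_P\leq \inf_{a\in\mathbb{R}}\left(A^+_a\vee A^-_a\right) \] or, equivalently, \[ \sup_{a\in\mathbb{R}}\left({\lambda^+_a}\wedge{\lambda^-_a}\right) \leq \gamma\leq \inf_{a\in\mathbb{R}}\left({\lambda^+_a}\vee{\lambda^-_a}\right), \] where $\gamma=1/c_P$ is the spectral gap of $X$ on $\mathbb{R}$.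
   Context: $X=(X_t)_{t\ge 0}$ is a regular linear continuous strong Markov process with state space $\mathbb{R}$ (a one-dimensional diffusion in the sense of Revuz–Yor, Chapter VII), conservative (infinite lifetime) and positively recurrent ($\mathbb{E}_x T_y<\infty$ for all $x,y$). $\mathbb{P}_x,\mathbb{E}_x$ denote law and expectation when $X_0=x$, and $T_a=\inf\{t\ge0:X_t=a\}$. $S$ is a scale function of $X$ (continuous, strictly increasing, with $\mathbb{P}_x[T_b<T_a]=\frac{S(x)-S(a)}{S(b)-S(a)}$ for $a<x<b$), and $m$ is the speed measure associated with $S$, i.e. the Borel measure such that for $a<x<b$ and Borel $f\ge 0$, $\mathbb{E}_x\int_0^{T_a\wedge T_b}f(X_t)\,dt=\int_a^b G(a,b,x,y)f(y)\,dm(y)$, where $G(a,b,x,y)=\frac{(S(b)-S(x\vee y))(S(x\wedge y)-S(a))}{S(b)-S(a)}$. The measure $m$ charges every nonempty open set. By positive recurrence $\lim_{x\to\pm\infty}S(x)=\pm\infty$ and $m(\mathbb{R})<\infty$. $dS$ denotes the Stieltjes measure induced by $S$. For a real function $F$ on $\mathbb{R}$ write $dF\ll dS$ if there is a locally $dS$-integrable function $f$ with $\int_u^v f\,dS=F(v)-F(u)$ for all $u<v$; then $f$ is denoted $\frac{dF}{dS}$. Let $\mathcal{F}=\{F\in L^2(m):\ dF\ll dS,\ \frac{dF}{dS}\in L^2(dS)\}$. The process $X$ is $m$-symmetric and its Dirichlet form on $L^2(m)$ is $\mathcal{E}(F,F)=\int_{-\infty}^\infty (\frac{dF}{dS})^2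 dS$ with domain $\mathcal{F}$. Quantities, for $a\in\mathbb{R}$ (all in $[0,\infty]$, with $1/\infty=0$): - $B^+_a=\sup_{x\geq a} m(]x,+\infty[)(S(x)-S(a))$, $B^-_a=\sup_{x\leq a} m(]-\infty,x[)(S(a)-S(x))$. - $\lambda_a^+=\sup\{\lambda\geq 0: \forall x>a,\ \mathbb{E}_x e^{\lambda T_a}<\infty\}$, $\lambda_a^-=\sup\{\lambda\geq 0: \forall x<a,\ \mathbb{E}_x e^{\lambda T_a}<\infty\}$. - $A_a^+$ is the infimum of the $A\in[0,\infty]$ such that $\int_{a}^\infty (F(x)-F(a))^2\,dm(x)\leq A\int_a^{\infty}(\frac{dF}{dS})^2 dS$ for all $F\in\mathcal{F}$; $A_a^-$ is the infimum of the $A\in[0,\infty]$ such that $\int_{-\infty}^a (F(x)-F(a))^2\,dm(x)\leq A\int_{-\infty}^{a}(\frac{dF}{dS})^2 dS$ for all $F\in\mathcal{F}$ ($A=\infty$ is always admissible). - $c_P$ is the infimum of the $c\in[0,\infty]$ such that $\int_{\mathbb{R}}(F-\overline{m}(F))^2 dm\leq c\int_{\mathbb{R}}(\frac {dF}{dS})^2 dS$ for all $F\in\mathcal{F}$, where $\overline{m}(F)=\frac{1}{m(\mathbb{R})}\int F\,dm$ ($c=\infty$ is always admissible). - Spectral gaps: for a Dirichlet form $\mathcal{E}'$ on an $L^2$ space associated with a non-negative self-adjoint operator $-A'$ with spectral family $(E_\xi)_{\xi\ge 0}$ (so $E_0$ is the orthogonal projection on $\ker A'$), the spectral gap is the largest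 $\gamma\ge 0$ with $\gamma\|f-E_0f\|^2\le\mathcal{E}'(f,f)$ for all $f$ in the domain (it is $0$ if there is no gap). $\gamma$ is the spectral gap of $\mathcal{E}$. $\gamma_a^+$ (resp. $\gamma_a^-$) is the spectral gap of the generator of $X$ killed when it exits $]a,\infty[$ (resp. $]-\infty,a[$), whose Dirichlet form is the restriction of $\mathcal{E}$ to $\{f\in\mathcal{F}: f(x)=0\ \forall x\le a\}$ on $L^2(\mathbb{I}_{]a,\infty[}\cdot m)$ (resp. to $\{f\in\mathcal{F}: f(x)=0\ \forall x\ge a\}$ on $L^2(\mathbb{I}_{]-\infty,a[}\cdot m)$). $\wedge$, $\vee$ denote minimum and maximum. *)

theory Defs
  imports "HOL-Probability.Probability"
begin

section \<open>One-dimensional diffusions on the real line\<close>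

text \<open>Time runs through the extended half-line, so that the library notions of stopping time and of
  the sigma-algebra of a stopping time cover stopping times that may be infinite. The filtration at
  time \<open>\<top>\<close> is generated by the whole path.\<close>

definition natural_filtration :: "'w set \<Rightarrow> (real \<Rightarrow> 'w \<Rightarrow> real) \<Rightarrow> ennreal \<Rightarrow> 'w measure" where
  "natural_filtration \<Omega> X t =
     sigma \<Omega> {X s -` B \<inter> \<Omega> | s B. 0 \<le> s \<and> ennreal s \<le> t \<and> B \<in> sets borel}"

text \<open>The right-continuous version \<open>F\<^sub>t\<^sub>+\<close>. The index \<open>\<top>\<close> is always admitted below; it matters only
  for \<open>t = \<top>\<close>, where no strictly later time exists.\<close>

definition right_cont_filtration :: "(ennreal \<Rightarrow> 'w measure) \<Rightarrow> ennreal \<Rightarrow> 'w measure" where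
  "right_cont_filtration F t = sigma (space (F t)) (\<Inter>u\<in>{u. t < u \<or> u = \<top>}. sets (F u))"

definition path_from :: "(real \<Rightarrow> 'w \<Rightarrow> real) \<Rightarrow> real \<Rightarrow> 'w \<Rightarrow> real \<Rightarrow> real" where
  "path_from X t \<omega> = (\<lambda>s\<in>{0..}. X (t + s) \<omega>)"

definition hitting_time :: "(real \<Rightarrow> 'w \<Rightarrow> real) \<Rightarrow> real \<Rightarrow> 'w \<Rightarrow> ennreal" where
  "hitting_time X a \<omega> = (INF t\<in>{t. 0 \<le> t \<and> X t \<omega> = a}. ennreal t)"

text \<open>\<open>P x\<close> is the law under which the process starts at \<open>x\<close>. The strong Markov property reads
  \<open>E\<^sub>x[Z \<circ> \<theta>\<^sub>T | F\<^sub>T] = E\<^sub>X\<^sub>T[Z]\<close> almost surely on \<open>{T < \<infinity>}\<close>, for all nonnegative measurable path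
  functionals \<open>Z\<close>. Where \<open>T = \<infinity>\<close>, \<^term>\<open>enn2real (T \<omega>)\<close> is \<open>0\<close>, but
  such points are excluded by the guard, and \<open>{T < \<infinity>}\<close> belongs to \<open>F\<^sub>T\<close>.
  The lifetime is infinite because \<open>X t\<close> is real-valued for every \<open>t \<ge> 0\<close>.\<close>

locale linear_diffusion =
  fixes P :: "real \<Rightarrow> 'w measure" and X :: "real \<Rightarrow> 'w \<Rightarrow> real"
  assumes prob_space_P: "\<And>x. prob_space (P x)"
    and sets_P: "\<And>x y. sets (P x) = sets (P y)"
    and measurable_X: "\<And>x t. 0 \<le> t \<Longrightarrow> X t \<in> borel_measurable (P x)"
    and measurable_P: "\<And>A. A \<in> sets (natural_filtration (space (P 0)) X \<top>) \<Longrightarrow>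
          (\<lambda>x. emeasure (P x) A) \<in> borel_measurable borel"
    and continuous_paths: "\<And>x \<omega>. \<omega> \<in> space (P x) \<Longrightarrow> continuous_on {0..} (\<lambda>t. X t \<omega>)"
    and start: "\<And>x. AE \<omega> in P x. X 0 \<omega> = x"
    and strong_Markov: "\<And>x T Z.
          stopping_time (right_cont_filtration (natural_filtration (space (P x)) X)) T \<Longrightarrow>
          Z \<in> borel_measurable (PiM {0..} (\<lambda>_. borel)) \<Longrightarrow>
          AE \<omega> in P x. T \<omega> < \<top> \<longrightarrow>
            nn_cond_exp (P x)
              (filtration.pre_sigma (space (P x))
                (right_cont_filtration (natural_filtration (space (P x)) X)) T)
              (\<lambda>\<omega>. Z (path_from X (enn2real (T \<omega>)) \<omega>)) \<omega>
            = (\<integral>\<^sup>+\<omega>'. Z (path_from X 0 \<omega>') \<partial>P (X (enn2real (T \<omega>)) \<omega>))"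
    and regular: "\<And>x y. 0 < emeasure (P x) {\<omega> \<in> space (P x). hitting_time X y \<omega> < \<top>}"

locale positively_recurrent_diffusion = linear_diffusion +
  assumes positively_recurrent: "\<And>x y. (\<integral>\<^sup>+\<omega>. hitting_time X y \<omega> \<partial>P x) < \<top>"


section \<open>Scale function and speed measure\<close>

definition scale_function :: "(real \<Rightarrow> 'w measure) \<Rightarrow> (real \<Rightarrow> 'w \<Rightarrow> real) \<Rightarrow> (real \<Rightarrow> real) \<Rightarrow> bool" where
  "scale_function P X S \<longleftrightarrow>
     continuous_on UNIV S \<and> strict_mono S \<and>
     (\<forall>a x b. a < x \<and> x < b \<longrightarrow>
        measure (P x) {\<omega> \<in> space (P x). hitting_time X b \<omega> < hitting_time X a \<omega>}
          = (S x - S a) / (S b - S a))"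

definition green :: "(real \<Rightarrow> real) \<Rightarrow> real \<Rightarrow> real \<Rightarrow> real \<Rightarrow> real \<Rightarrow> real" where
  "green S a b x y = (S b - S (max x y)) * (S (min x y) - S a) / (S b - S a)"

definition speed_measure ::
  "(real \<Rightarrow> 'w measure) \<Rightarrow> (real \<Rightarrow> 'w \<Rightarrow> real) \<Rightarrow> (real \<Rightarrow> real) \<Rightarrow> real measure \<Rightarrow> bool" where
  "speed_measure P X S m \<longleftrightarrow>
     sets m = sets borel \<and>
     (\<forall>a x b. \<forall>f :: real \<Rightarrow> ennreal. a < x \<and> x < b \<and> f \<in> borel_measurable borel \<longrightarrow>
        (\<integral>\<^sup>+\<omega>. (\<integral>\<^sup>+t\<in>{t. 0 \<le> t \<and> ennreal t < min (hitting_time X a \<omega>) (hitting_time X b \<omega>)}.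
                    f (X t \<omega>) \<partial>lborel) \<partial>P x)
          = (\<integral>\<^sup>+y\<in>{a<..<b}. ennreal (green S a b x y) * f y \<partial>m))"


section \<open>The Dirichlet form\<close>

definition L2 :: "'a measure \<Rightarrow> ('a \<Rightarrow> real) set" where
  "L2 M = {f. f \<in> borel_measurable M \<and> integrable M (\<lambda>x. (f x)\<^sup>2)}"

definition has_dS_density :: "(real \<Rightarrow> real) \<Rightarrow> (real \<Rightarrow> real) \<Rightarrow> (real \<Rightarrow> real) \<Rightarrow> bool" where
  "has_dS_density S F f \<longleftrightarrow>
     (\<forall>u v. u < v \<longrightarrow> set_integrable (interval_measure S) {u..v} f \<and>
        (LINT x:{u..v}|interval_measure S. f x) = F v - F u)"

text \<open>The density is unique up to \<open>dS\<close>-null sets, so the choice below is immaterial.\<close>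

definition dS_deriv :: "(real \<Rightarrow> real) \<Rightarrow> (real \<Rightarrow> real) \<Rightarrow> real \<Rightarrow> real" where
  "dS_deriv S F = (SOME f. has_dS_density S F f)"

definition form_domain :: "(real \<Rightarrow> real) \<Rightarrow> real measure \<Rightarrow> (real \<Rightarrow> real) set" where
  "form_domain S m =
     {F \<in> L2 m. (\<exists>f. has_dS_density S F f) \<and> dS_deriv S F \<in> L2 (interval_measure S)}"

definition dirichlet_form :: "(real \<Rightarrow> real) \<Rightarrow> (real \<Rightarrow> real) \<Rightarrow> (real \<Rightarrow> real) \<Rightarrow> real" where
  "dirichlet_form S F G = (LINT x|interval_measure S. dS_deriv S F x * dS_deriv S G x)"


section \<open>Spectral gap\<close>

text \<open>\<open>form_generator M D \<E> f g\<close>: \<open>f\<close> lies in the domain of the operator \<open>A\<close> on \<open>L\<^sup>2(M)\<close> associated with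
  the form \<open>\<E>\<close> with domain \<open>D\<close>, and \<open>A f = g\<close>. The spectral projection \<open>E\<^sub>0\<close> is the orthogonal
  projection onto the kernel of \<open>A\<close>; its value is unique up to \<open>M\<close>-null sets.\<close>

definition form_generator :: "'a measure \<Rightarrow> ('a \<Rightarrow> real) set \<Rightarrow> (('a \<Rightarrow> real) \<Rightarrow> ('a \<Rightarrow> real) \<Rightarrow> real) \<Rightarrow>
    ('a \<Rightarrow> real) \<Rightarrow> ('a \<Rightarrow> real) \<Rightarrow> bool" where
  "form_generator M D \<E> f g \<longleftrightarrow>
     f \<in> D \<and> g \<in> L2 M \<and> (\<forall>h\<in>D. \<E> f h = - (LINT x|M. g x * h x))"

definition generator_kernel :: "'a measure \<Rightarrow> ('a \<Rightarrow> real) set \<Rightarrow> (('a \<Rightarrow> real) \<Rightarrow> ('a \<Rightarrow> real) \<Rightarrow> real) \<Rightarrow>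
    ('a \<Rightarrow> real) set" where
  "generator_kernel M D \<E> = {f. form_generator M D \<E> f (\<lambda>_. 0)}"

definition kernel_projection :: "'a measure \<Rightarrow> ('a \<Rightarrow> real) set \<Rightarrow> (('a \<Rightarrow> real) \<Rightarrow> ('a \<Rightarrow> real) \<Rightarrow> real) \<Rightarrow>
    ('a \<Rightarrow> real) \<Rightarrow> ('a \<Rightarrow> real)" where
  "kernel_projection M D \<E> f =
     (SOME k. k \<in> generator_kernel M D \<E> \<and>
        (\<forall>h\<in>generator_kernel M D \<E>. (LINT x|M. (f x - k x) * h x) = 0))"

definition spectral_gap :: "'a measure \<Rightarrow> ('a \<Rightarrow> real) set \<Rightarrow> (('a \<Rightarrow> real) \<Rightarrow> ('a \<Rightarrow> real) \<Rightarrow> real) \<Rightarrow>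
    ennreal" where
  "spectral_gap M D \<E> =
     Sup {\<gamma>. \<forall>f\<in>D. \<gamma> * (\<integral>\<^sup>+x. ennreal ((f x - kernel_projection M D \<E> f x)\<^sup>2) \<partial>M) \<le> ennreal (\<E> f f)}"

definition gap :: "(real \<Rightarrow> real) \<Rightarrow> real measure \<Rightarrow> ennreal" where
  "gap S m = spectral_gap m (form_domain S m) (dirichlet_form S)"

definition gap_plus :: "(real \<Rightarrow> real) \<Rightarrow> real measure \<Rightarrow> real \<Rightarrow> ennreal" where
  "gap_plus S m a =
     spectral_gap (density m (indicator {a<..})) {f \<in> form_domain S m. \<forall>x\<le>a. f x = 0} (dirichlet_form S)"

definition gap_minus :: "(real \<Rightarrow> real) \<Rightarrow> real measure \<Rightarrow> real \<Rightarrow> ennreal" where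
  "gap_minus S m a =
     spectral_gap (density m (indicator {..<a})) {f \<in> form_domain S m. \<forall>x\<ge>a. f x = 0} (dirichlet_form S)"


section \<open>Hardy and Poincare constants, exponential moments of hitting times\<close>

definition B_plus :: "(real \<Rightarrow> real) \<Rightarrow> real measure \<Rightarrow> real \<Rightarrow> ennreal" where
  "B_plus S m a = (SUP x\<in>{a..}. emeasure m {x<..} * ennreal (S x - S a))"

definition B_minus :: "(real \<Rightarrow> real) \<Rightarrow> real measure \<Rightarrow> real \<Rightarrow> ennreal" where
  "B_minus S m a = (SUP x\<in>{..a}. emeasure m {..<x} * ennreal (S a - S x))"

definition A_plus :: "(real \<Rightarrow> real) \<Rightarrow> real measure \<Rightarrow> real \<Rightarrow> ennreal" where
  "A_plus S m a =
     Inf {A. \<forall>F\<in>form_domain S m.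
        (\<integral>\<^sup>+x\<in>{a..}. ennreal ((F x - F a)\<^sup>2) \<partial>m)
          \<le> A * (\<integral>\<^sup>+x\<in>{a..}. ennreal ((dS_deriv S F x)\<^sup>2) \<partial>interval_measure S)}"

definition A_minus :: "(real \<Rightarrow> real) \<Rightarrow> real measure \<Rightarrow> real \<Rightarrow> ennreal" where
  "A_minus S m a =
     Inf {A. \<forall>F\<in>form_domain S m.
        (\<integral>\<^sup>+x\<in>{..a}. ennreal ((F x - F a)\<^sup>2) \<partial>m)
          \<le> A * (\<integral>\<^sup>+x\<in>{..a}. ennreal ((dS_deriv S F x)\<^sup>2) \<partial>interval_measure S)}"

definition normalized_mean :: "real measure \<Rightarrow> (real \<Rightarrow> real) \<Rightarrow> real" where
  "normalized_mean m F = (LINT x|m. F x) / measure m UNIV"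

definition poincare_const :: "(real \<Rightarrow> real) \<Rightarrow> real measure \<Rightarrow> ennreal" where
  "poincare_const S m =
     Inf {c. \<forall>F\<in>form_domain S m.
        (\<integral>\<^sup>+x. ennreal ((F x - normalized_mean m F)\<^sup>2) \<partial>m)
          \<le> c * (\<integral>\<^sup>+x. ennreal ((dS_deriv S F x)\<^sup>2) \<partial>interval_measure S)}"

text \<open>\<open>E\<^sub>x exp (l T\<^sub>a)\<close>, with \<open>exp (l \<infinity>) = \<infinity>\<close>. The value at \<open>l = 0\<close>, \<open>T\<^sub>a = \<infinity>\<close> plays no role for
  positively recurrent diffusions, whose hitting times are almost surely finite.\<close>

definition exp_moment :: "(real \<Rightarrow> 'w measure) \<Rightarrow> (real \<Rightarrow> 'w \<Rightarrow> real) \<Rightarrow> real \<Rightarrow> real \<Rightarrow> real \<Rightarrow> ennreal" where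
  "exp_moment P X l a x =
     (\<integral>\<^sup>+\<omega>. (if hitting_time X a \<omega> = \<top> then \<top>
             else ennreal (exp (l * enn2real (hitting_time X a \<omega>)))) \<partial>P x)"

definition lambda_plus :: "(real \<Rightarrow> 'w measure) \<Rightarrow> (real \<Rightarrow> 'w \<Rightarrow> real) \<Rightarrow> real \<Rightarrow> ennreal" where
  "lambda_plus P X a = (SUP l\<in>{l. 0 \<le> l \<and> (\<forall>x>a. exp_moment P X l a x < \<top>)}. ennreal l)"

definition lambda_minus :: "(real \<Rightarrow> 'w measure) \<Rightarrow> (real \<Rightarrow> 'w \<Rightarrow> real) \<Rightarrow> real \<Rightarrow> ennreal" where
  "lambda_minus P X a = (SUP l\<in>{l. 0 \<le> l \<and> (\<forall>x<a. exp_moment P X l a x < \<top>)}. ennreal l)"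

end

theory Submission
  imports Defs
begin

text \<open>The Hardy constant \<open>A\<close> of a half-line is the squared norm of \<open>K f(x) = \<integral>\<^sub>a\<^sup>x f dS\<close> from
  \<open>L\<^sup>2(dS)\<close> to \<open>L\<^sup>2(m)\<close>, and the Green operator of the killed process is \<open>G = K K*\<close>, of norm \<open>A\<close>. By
  Kac's formula, the Markov property gives \<open>E\<^sub>x T\<^sub>a\<^sup>n / n! = G\<^sup>n 1(x)\<close>, so
  \<open>E\<^sub>x exp (l T\<^sub>a) = \<Sum> l\<^sup>n G\<^sup>n 1(x)\<close>, which converges for \<open>l < 1/A\<close>. Conversely, if the sum \<open>u\<close> is finite
  then \<open>u = 1 + l G u\<close>, and a Schur test with weights built from \<open>u\<close> shows \<open>A \<le> 1/l\<close>. The same Schur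
  test with powers of \<open>S - S(a)\<close> as weights gives \<open>A \<le> 4 B\<close>. For the Poincare constant, the upper bound comes
  from replacing the mean of \<open>F\<close> by \<open>F(a)\<close>, and the lower bound from a mean-zero combination of nearly
  extremal functions on the two sides of \<open>a\<close>.\<close>

section \<open>Form domain and densities with respect to the scale\<close>

text \<open>The diffusion is given only through \<open>S\<close> and through \<open>m\<close> on
  bounded intervals. That \<open>S\<close> diverges at both ends is first extracted from recurrence;
  this makes the Green kernel of a half-line the minimum of the two scale distances to
  \<open>a\<close>, and finiteness of \<open>m\<close> is then read off from finite mean hitting
  times. The main obstacle is that exponential moments are pointwise quantities while Hardy
  constants are \<open>L\<^sup>2\<close> quantities. From \<open>L\<^sup>2\<close> to points, one
  application of the kernel, bounded by the scale distance of \<open>x\<close>, and Cauchy-Schwarz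
  on the finite measure \<open>m\<close> suffice. From points to \<open>L\<^sup>2\<close> no
  eigenfunction is at hand, but a Schur test asks only for a positive supersolution, and
  \<open>u - 1 = l G u\<close> is one because \<open>l G (u - 1) \<le> l G u\<close>. The constant 4
  is 2 * 2: one factor is the primitive of \<open>t powr (-1/2)\<close>, the other counts two equal
  contributions in the bound of a tail integral.\<close>

text \<open>Both half-lines are treated at once through a sign \<open>e\<close>: \<open>e = 1\<close> is \<open>]a, \<infinity>[\<close> and \<open>e = -1\<close> is \<open>]-\<infinity>, a[\<close>.
  The set \<open>segm e a x\<close> is the open interval between \<open>a\<close> and \<open>x\<close>, empty unless \<open>x\<close> is in the half-line.\<close>

definition ray :: "real \<Rightarrow> real \<Rightarrow> real set" where
  "ray e a = {x. 0 < e * (x - a)}"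

definition cray :: "real \<Rightarrow> real \<Rightarrow> real set" where
  "cray e a = {x. 0 \<le> e * (x - a)}"

definition segm :: "real \<Rightarrow> real \<Rightarrow> real \<Rightarrow> real set" where
  "segm e a x = {s. 0 < e * (s - a) \<and> 0 < e * (x - s)}"

lemma ray_borel [measurable]: "ray e a \<in> sets borel"
  unfolding ray_def by measurable

lemma cray_borel [measurable]: "cray e a \<in> sets borel"
  unfolding cray_def by measurable

lemma segm_borel [measurable]: "segm e a x \<in> sets borel"
  unfolding segm_def by measurable

lemma segm_pred [measurable (raw)]:
  assumes [measurable]: "f \<in> borel_measurable M" "g \<in> borel_measurable M"
  shows "Measurable.pred M (\<lambda>w. f w \<in> segm e a (g w))"
  unfolding segm_def mem_Collect_eq by measurable

lemma segm_iff: "s \<in> segm e a x \<longleftrightarrow> s \<in> ray e a \<and> x \<in> ray e s"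
  by (auto simp: segm_def ray_def)

lemma segm_ray: "e = 1 \<or> e = -1 \<Longrightarrow> s \<in> segm e a x \<Longrightarrow> x \<in> ray e a"
  by (auto simp: segm_def ray_def)

lemma set_integrable_if_integrable:
  fixes f :: "'a \<Rightarrow> real"
  shows "integrable M f \<Longrightarrow> A \<in> sets M \<Longrightarrow> set_integrable M A f"
  unfolding set_integrable_def by (rule integrable_mult_indicator)

text \<open>Closed intervals form an intersection-stable generator of the Borel sets, so a Dynkin
  argument extends the equality to all Borel sets. The assumption on the total integrals is what
  carries the complement step, since the whole line is not a closed bounded interval.\<close>

lemma AE_eq_if_integral_Icc_eq:
  fixes f g :: "real \<Rightarrow> real"
  assumes sets: "sets M = sets borel" and f: "integrable M f" and g: "integrable M g"
    and eq: "\<And>u v. (LINT x:{u..v}|M. f x) = (LINT x:{u..v}|M. g x)"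
    and tot: "integral\<^sup>L M f = integral\<^sup>L M g"
  shows "AE x in M. f x = g x"
proof -
  note [measurable_cong] = sets
  have sp: "space M = UNIV" using sets by (simp add: sets_eq_imp_space_eq)
  have fA: "set_integrable M A f" "set_integrable M A g" if "A \<in> sets M" for A
    using f g that by (auto intro: set_integrable_if_integrable)
  have Int_stable: "Int_stable (range (\<lambda>(a, b). {a..b::real}))"
    by (auto simp: Int_stable_def)
  have Pow: "range (\<lambda>(a, b). {a..b::real}) \<subseteq> Pow UNIV" by auto
  have set_eq: "(LINT x:A|M. f x) = (LINT x:A|M. g x)" if "A \<in> sigma_sets UNIV (range (\<lambda>(a, b). {a..b::real}))" for A
    using Int_stable Pow that
  proof (induction rule: sigma_sets_induct_disjoint)
    case (basic A) then show ?case using eq by auto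
  next
    case empty then show ?case by (simp add: set_lebesgue_integral_def)
  next
    case (compl A)
    then have A[measurable]: "A \<in> sets M"
      by (simp add: sets borel_eq_atLeastAtMost)
    have *: "(LINT x:UNIV - A|M. h x) = integral\<^sup>L M h - (LINT x:A|M. h x)" if h: "integrable M h" for h :: "real \<Rightarrow> real"
    proof -
      have "(LINT x:(UNIV - A) \<union> A|M. h x) = (LINT x:UNIV - A|M. h x) + (LINT x:A|M. h x)"
        using h A by (intro set_integral_Un) (auto intro!: set_integrable_if_integrable)
      moreover have "(LINT x:(UNIV - A) \<union> A|M. h x) = integral\<^sup>L M h"
        by (simp add: set_lebesgue_integral_def)
      ultimately show ?thesis by simp
    qed
    show ?case using compl tot by (simp add: * f g)
  next
    case (union A)
    then have A[measurable]: "\<And>i. A i \<in> sets M"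
      by (auto simp: sets borel_eq_atLeastAtMost)
    have "(LINT x:(\<Union>i. A i)|M. f x) = (\<Sum>i. (LINT x:(A i)|M. f x))"
      by (intro lebesgue_integral_countable_add A fA sets.countable_UN) (use union in \<open>auto simp: disjoint_family_on_def\<close>)
    also have "\<dots> = (\<Sum>i. (LINT x:(A i)|M. g x))" using union by simp
    also have "\<dots> = (LINT x:(\<Union>i. A i)|M. g x)"
      by (intro lebesgue_integral_countable_add[symmetric] A fA sets.countable_UN) (use union in \<open>auto simp: disjoint_family_on_def\<close>)
    finally show ?case .
  qed
  have eqA: "(LINT x:A|M. f x) = (LINT x:A|M. g x)" if "A \<in> sets M" for A
    using set_eq[of A] that by (simp add: sets borel_eq_atLeastAtMost)
  show ?thesis
    by (rule density_unique_real[OF f g]) (use eqA in auto)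
qed

text \<open>The purely analytic setting. For a positively recurrent diffusion the divergence of
  \<open>S\<close>, the finiteness of \<open>m\<close> and its charging of open intervals are all
  proved later, and the locale is then interpreted.\<close>

locale scale_speed =
  fixes S :: "real \<Rightarrow> real" and m :: "real measure"
  assumes cont_S: "continuous_on UNIV S" and strict_S: "strict_mono S"
    and S_top: "filterlim S at_top at_top" and S_bot: "filterlim S at_bot at_bot"
    and finite_m: "finite_measure m" and sets_m [measurable_cong]: "sets m = sets borel"
    and m_pos: "\<And>u v. u < v \<Longrightarrow> 0 < emeasure m {u<..<v}"
begin

abbreviation nu :: "real measure" ("\<nu>") where "\<nu> \<equiv> interval_measure S"

abbreviation "D \<equiv> dS_deriv S"

sublocale m: finite_measure m by (rule finite_m)

lemma space_m [simp]: "space m = UNIV"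
  using sets_m by (simp add: sets_eq_imp_space_eq)

lemma mono_S: "x \<le> y \<Longrightarrow> S x \<le> S y"
  using strict_S by (simp add: strict_mono_less_eq)

lemma S_less_iff [simp]: "S x < S y \<longleftrightarrow> x < y"
  using strict_S by (simp add: strict_mono_less)

lemma S_borel [measurable]: "S \<in> borel_measurable borel"
  using cont_S by (intro borel_measurable_continuous_onI)

lemma right_cont_S: "continuous (at_right a) S"
  using cont_S continuous_on_eq_continuous_at[of UNIV S] by (auto intro: continuous_at_imp_continuous_at_within)

sublocale nu: sigma_finite_measure \<nu>
  by (intro sigma_finite_interval_measure mono_S right_cont_S)

lemma nu_Icc: "u \<le> v \<Longrightarrow> emeasure \<nu> {u..v} = ennreal (S v - S u)"
  using emeasure_interval_measure_Icc[OF _ mono_S cont_S] by auto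

lemma nu_singleton: "emeasure \<nu> {x} = 0"
  using nu_Icc[of x x] by simp

lemma AE_neq: "AE x in \<nu>. x \<noteq> c"
  by (intro AE_I[of _ _ "{c}"]) (auto simp: nu_singleton)

section \<open>Densities with respect to \<open>dS\<close> and membership in the form domain\<close>

lemma has_dS_densityD:
  assumes "has_dS_density S F f" "u \<le> v"
  shows "set_integrable \<nu> {u..v} f" "(LINT x:{u..v}|\<nu>. f x) = F v - F u"
proof -
  have "set_integrable \<nu> {u..v} f \<and> (LINT x:{u..v}|\<nu>. f x) = F v - F u"
  proof (cases "u = v")
    case True
    have 1: "AE x in \<nu>. indicator {v..v} x *\<^sub>R f x = 0"
      using AE_neq[of v] by eventually_elim (auto simp: indicator_def)
    have "u < u + 1" by simp
    then have "set_integrable \<nu> {u..u+1} f"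
      using assms(1) unfolding has_dS_density_def by blast
    then have 2: "set_integrable \<nu> {v..v} f" by (rule set_integrable_subset) (use True in auto)
    have "(LINT x:{v..v}|\<nu>. f x) = 0"
      unfolding set_lebesgue_integral_def by (rule integral_eq_zero_AE[OF 1])
    with 2 show ?thesis by (simp only: True diff_self simp_thms)
  next
    case False
    then have "u < v" using assms(2) by simp
    then show ?thesis using assms(1) unfolding has_dS_density_def by blast
  qed
  then show "set_integrable \<nu> {u..v} f" "(LINT x:{u..v}|\<nu>. f x) = F v - F u" by auto
qed

text \<open>The defining condition gives only local integrability; measurability follows because the
  density is the pointwise limit of its truncations to \<open>[-n, n]\<close>.\<close>

lemma has_dS_density_measurable:
  assumes "has_dS_density S F f"
  shows "f \<in> borel_measurable borel"
proof (rule borel_measurable_LIMSEQ_real)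
  fix i :: nat
  have "set_integrable \<nu> {-real i..real i} f" by (rule has_dS_densityD[OF assms]) auto
  then show "(\<lambda>x. indicator {-real i..real i} x * f x) \<in> borel_measurable borel"
    using borel_measurable_integrable[of \<nu> "\<lambda>x. indicator {-real i..real i} x *\<^sub>R f x"]
    by (simp add: set_integrable_def)
next
  fix x :: real
  obtain n where n: "\<bar>x\<bar> \<le> real n" using real_arch_simple by blast
  have "\<forall>\<^sub>F i in sequentially. indicator {-real i..real i} x * f x = f x"
    using eventually_ge_at_top[of n] by eventually_elim (use n in \<open>auto simp: indicator_def\<close>)
  then show "(\<lambda>i. indicator {-real i..real i} x * f x) \<longlonglongrightarrow> f x"
    by (rule tendsto_eventually)
qed

text \<open>Densities are only locally integrable, so they are compared after truncation to
  \<open>[-n, n]\<close>, where every interval integral is an increment of \<open>F\<close> over a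
  smaller interval.\<close>

lemma has_dS_density_unique:
  assumes f: "has_dS_density S F f" and g: "has_dS_density S F g"
  shows "AE x in \<nu>. f x = g x"
proof -
  have "AE x in \<nu>. indicator {-real n..real n} x * f x = indicator {-real n..real n} x * g x" for n
  proof (rule AE_eq_if_integral_Icc_eq)
    have *: "set_integrable \<nu> {-real n..real n} f" "set_integrable \<nu> {-real n..real n} g"
      by (rule has_dS_densityD[OF f] has_dS_densityD[OF g], simp)+
    then show "integrable \<nu> (\<lambda>x. indicator {-real n..real n} x * f x)"
      "integrable \<nu> (\<lambda>x. indicator {-real n..real n} x * g x)"
      by (auto simp: set_integrable_def)
    show "integral\<^sup>L \<nu> (\<lambda>x. indicator {-real n..real n} x * f x) = integral\<^sup>L \<nu> (\<lambda>x. indicator {-real n..real n} x * g x)"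
      using has_dS_densityD(2)[OF f, of "-real n" "real n"] has_dS_densityD(2)[OF g, of "-real n" "real n"]
      by (simp add: set_lebesgue_integral_def)
    fix u v :: real
    have eq: "(LINT x:{u..v}|\<nu>. indicator {-real n..real n} x * h x) = (LINT x:{max u (-real n)..min v (real n)}|\<nu>. h x)" for h :: "real \<Rightarrow> real"
      unfolding set_lebesgue_integral_def
      by (intro Bochner_Integration.integral_cong) (auto simp: indicator_def split: if_splits)
    show "(LINT x:{u..v}|\<nu>. indicator {-real n..real n} x * f x) = (LINT x:{u..v}|\<nu>. indicator {-real n..real n} x * g x)"
    proof (cases "max u (-real n) \<le> min v (real n)")
      case True then show ?thesis
        by (simp only: eq has_dS_densityD(2)[OF f] has_dS_densityD(2)[OF g])
    next
      case False
      then have "{max u (-real n)..min v (real n)} = {}" by simp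
      then show ?thesis unfolding eq by (simp only: set_lebesgue_integral_def indicator_simps empty_iff not_False_eq_True scaleR_zero_left)
    qed
  qed simp
  then have "AE x in \<nu>. \<forall>n. indicator {-real n..real n} x * f x = indicator {-real n..real n} x * g x"
    by (subst AE_all_countable) (rule allI)
  then show ?thesis
  proof eventually_elim
    case (elim x)
    obtain n where n: "\<bar>x\<bar> \<le> real n" using real_arch_simple by blast
    show ?case using elim[rule_format, of n] n by (auto simp: indicator_def split: if_splits)
  qed
qed

lemma has_dS_density_D: "has_dS_density S F f \<Longrightarrow> has_dS_density S F (D F)"
  unfolding dS_deriv_def by (rule someI[of "has_dS_density S F"])

text \<open>Since \<open>D F\<close> is a \<open>SOME\<close> choice, it is reached through an
  explicit density \<open>f\<close>: uniqueness up to \<open>dS\<close>-null sets transfers square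
  integrability from \<open>f\<close> to \<open>D F\<close>.\<close>

lemma form_domainI:
  assumes F: "F \<in> L2 m" and f: "has_dS_density S F f" and int: "integrable \<nu> (\<lambda>x. (f x)\<^sup>2)"
  shows "F \<in> form_domain S m" "AE x in \<nu>. D F x = f x"
proof -
  note [measurable] = has_dS_density_measurable[OF f] has_dS_density_measurable[OF has_dS_density_D[OF f]]
  show *: "AE x in \<nu>. D F x = f x"
    by (rule has_dS_density_unique[OF has_dS_density_D[OF f] f])
  then have "AE x in \<nu>. (D F x)\<^sup>2 = (f x)\<^sup>2" by eventually_elim simp
  then have "integrable \<nu> (\<lambda>x. (D F x)\<^sup>2)"
    using int by (subst integrable_cong_AE[of _ _ "\<lambda>x. (f x)\<^sup>2"]) auto
  then have "D F \<in> L2 \<nu>"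
    unfolding L2_def by simp
  then show "F \<in> form_domain S m"
    unfolding form_domain_def using F f by blast
qed

lemma form_domainD:
  assumes "F \<in> form_domain S m"
  shows "has_dS_density S F (D F)" "F \<in> borel_measurable borel" "D F \<in> borel_measurable borel"
    "integrable m (\<lambda>x. (F x)\<^sup>2)" "integrable \<nu> (\<lambda>x. (D F x)\<^sup>2)"
  using assms by (auto simp: form_domain_def L2_def measurable_cong_sets[OF sets_m refl]
      intro: has_dS_density_D)

lemma L2_bounded:
  assumes [measurable]: "F \<in> borel_measurable borel" and "\<And>x. \<bar>F x\<bar> \<le> C"
  shows "F \<in> L2 m"
proof -
  have "(F x)\<^sup>2 \<le> C\<^sup>2" for x using power_mono[OF assms(2)[of x], of 2] by simp
  then have "integrable m (\<lambda>x. (F x)\<^sup>2)"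
    by (intro m.integrable_const_bound[of _ "C\<^sup>2"]) auto
  then show ?thesis by (auto simp: L2_def)
qed

lemma L2_integrable:
  assumes "F \<in> L2 m"
  shows "integrable m F"
proof (rule m.square_integrable_imp_integrable)
  show "F \<in> borel_measurable m" using assms unfolding L2_def by blast
  show "integrable m (\<lambda>x. (F x)\<^sup>2)" using assms unfolding L2_def by blast
qed

lemma has_dS_density_lin:
  assumes "has_dS_density S F f" "has_dS_density S G g"
  shows "has_dS_density S (\<lambda>x. c * F x + d * G x + k) (\<lambda>x. c * f x + d * g x)"
  unfolding has_dS_density_def
proof (intro allI impI)
  fix u v :: real assume "u < v"
  then have *: "set_integrable \<nu> {u..v} f" "(LINT x:{u..v}|\<nu>. f x) = F v - F u"
    "set_integrable \<nu> {u..v} g" "(LINT x:{u..v}|\<nu>. g x) = G v - G u"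
    using assms by (auto simp: has_dS_density_def)
  have i: "set_integrable \<nu> {u..v} (\<lambda>x. c * f x)" "set_integrable \<nu> {u..v} (\<lambda>x. d * g x)"
    using * by auto
  show "set_integrable \<nu> {u..v} (\<lambda>x. c * f x + d * g x) \<and>
       (LINT x:{u..v}|\<nu>. c * f x + d * g x) = c * F v + d * G v + k - (c * F u + d * G u + k)"
  proof
    show "set_integrable \<nu> {u..v} (\<lambda>x. c * f x + d * g x)" by (rule set_integral_add(1)[OF i])
    have "(LINT x:{u..v}|\<nu>. c * f x + d * g x) = c * (F v - F u) + d * (G v - G u)"
      using set_integral_add(2)[OF i] *(2,4) by simp
    then show "(LINT x:{u..v}|\<nu>. c * f x + d * g x) = c * F v + d * G v + k - (c * F u + d * G u + k)"
      by (simp add: algebra_simps)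
  qed
qed

lemma L2_lin:
  assumes "F \<in> L2 M" "G \<in> L2 M"
  shows "(\<lambda>x. c * F x + d * G x) \<in> L2 M"
proof -
  have [measurable]: "F \<in> borel_measurable M" "G \<in> borel_measurable M" using assms by (auto simp: L2_def)
  have i: "integrable M (\<lambda>x. 2 * c\<^sup>2 * (F x)\<^sup>2 + 2 * d\<^sup>2 * (G x)\<^sup>2)"
    using assms by (auto simp: L2_def)
  have "(c * F x + d * G x)\<^sup>2 \<le> 2 * c\<^sup>2 * (F x)\<^sup>2 + 2 * d\<^sup>2 * (G x)\<^sup>2" for x
    using sum_squares_bound[of "c * F x" "d * G x"] by (simp add: power2_sum power_mult_distrib)
  then have "integrable M (\<lambda>x. (c * F x + d * G x)\<^sup>2)"
    by (intro Bochner_Integration.integrable_bound[OF i]) (auto intro!: AE_I2 order_trans[OF _ abs_ge_self])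
  then show ?thesis by (auto simp: L2_def)
qed

lemma const_L2: "(\<lambda>_. k) \<in> L2 m"
  by (rule L2_bounded[of _ "\<bar>k\<bar>"]) auto

lemma form_domain_lin:
  assumes "F \<in> form_domain S m" "G \<in> form_domain S m"
  shows "(\<lambda>x. c * F x + d * G x + k) \<in> form_domain S m"
    "AE x in \<nu>. D (\<lambda>x. c * F x + d * G x + k) x = c * D F x + d * D G x"
proof -
  have L: "(\<lambda>x. c * F x + d * G x + k) \<in> L2 m"
    using L2_lin[OF L2_lin[of F m G c d] const_L2[of k], of 1 1] assms by (auto simp: form_domain_def)
  have "integrable \<nu> (\<lambda>x. (c * D F x + d * D G x)\<^sup>2)"
    using L2_lin[of "D F" \<nu> "D G" c d] assms by (auto simp: form_domain_def L2_def)
  note * = form_domainI[OF L has_dS_density_lin[OF form_domainD(1)[OF assms(1)] form_domainD(1)[OF assms(2)]] this]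
  show "(\<lambda>x. c * F x + d * G x + k) \<in> form_domain S m" by (rule *)
  show "AE x in \<nu>. D (\<lambda>x. c * F x + d * G x + k) x = c * D F x + d * D G x" by (rule *)
qed

lemma const_form_domain:
  shows "(\<lambda>_. k) \<in> form_domain S m" "AE x in \<nu>. D (\<lambda>_. k) x = 0"
proof -
  have *: "has_dS_density S (\<lambda>_. k) (\<lambda>_. 0)"
    by (auto simp: has_dS_density_def set_integrable_def set_lebesgue_integral_def)
  show "(\<lambda>_. k) \<in> form_domain S m" "AE x in \<nu>. D (\<lambda>_. k) x = 0"
    using form_domainI[OF const_L2 *] by auto
qed

lemma has_dS_density_integral:
  assumes g: "integrable \<nu> g"
  shows "has_dS_density S (\<lambda>x. LINT s:{..x}|\<nu>. g s) g"
  unfolding has_dS_density_def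
proof (intro allI impI conjI)
  fix u v :: real assume uv: "u < v"
  have i: "set_integrable \<nu> A g" if "A \<in> sets borel" for A
    using g that by (auto intro!: set_integrable_if_integrable)
  show "set_integrable \<nu> {u..v} g" by (rule i) auto
  have [measurable]: "g \<in> borel_measurable borel" using borel_measurable_integrable[OF g] by simp
  have "(LINT x:{..u} \<union> {u<..v}|\<nu>. g x) = (LINT x:{..u}|\<nu>. g x) + (LINT x:{u<..v}|\<nu>. g x)"
    by (intro set_integral_Un i) auto
  moreover have "{..u} \<union> {u<..v} = {..v}" using uv by auto
  moreover have "(LINT x:{u<..v}|\<nu>. g x) = (LINT x:{u..v}|\<nu>. g x)"
    unfolding set_lebesgue_integral_def
    by (intro integral_cong_AE) (use AE_neq[of u] in \<open>auto elim!: eventually_mono simp: indicator_def\<close>)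
  ultimately show "(LINT x:{u..v}|\<nu>. g x) = (LINT s:{..v}|\<nu>. g s) - (LINT s:{..u}|\<nu>. g s)" by simp
qed

section \<open>Test functions: cutoffs to a half-line and primitives\<close>

definition cutoff :: "real \<Rightarrow> real \<Rightarrow> (real \<Rightarrow> real) \<Rightarrow> real \<Rightarrow> real" where
  "cutoff e a F x = (if x \<in> ray e a then F x - F a else 0)"

text \<open>The cutoff is \<open>F\<close> composed with the monotone projection \<open>p\<close> of
  the line onto the closed half-line, minus \<open>F a\<close>. Its increment over
  \<open>[u, v]\<close> is therefore that of \<open>F\<close> over \<open>[p u, p v]\<close>, which
  identifies the density as the restriction of \<open>D F\<close>. This links arbitrary
  \<open>F\<close>, as in the Hardy constants, to functions in the domain of the killed
  form.\<close>

lemma cutoff_form_domain: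
  assumes e: "e = 1 \<or> e = -1" and F: "F \<in> form_domain S m"
  shows "cutoff e a F \<in> form_domain S m"
    "AE x in \<nu>. D (cutoff e a F) x = indicator (ray e a) x * D F x"
proof -
  note [measurable] = form_domainD(2,3)[OF F]
  define p where "p x = (if e = 1 then max x a else min x a)" for x
  have cut: "cutoff e a F x = F (p x) - F a" for x
    using e by (auto simp: cutoff_def p_def ray_def max_def min_def)
  have "integrable m (\<lambda>x. (F x + (- F a))\<^sup>2)"
    using L2_lin[of F m "\<lambda>_. 1" 1 "- F a"] F const_L2[of 1] by (auto simp: form_domain_def L2_def)
  then have "integrable m (\<lambda>x. (cutoff e a F x)\<^sup>2)"
    by (rule Bochner_Integration.integrable_bound) (auto simp: cutoff_def[abs_def])
  then have L: "cutoff e a F \<in> L2 m" by (auto simp: L2_def cutoff_def[abs_def])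
  have d: "has_dS_density S (cutoff e a F) (\<lambda>x. indicator (ray e a) x * D F x)"
    unfolding has_dS_density_def
  proof (intro allI impI conjI)
    fix u v :: real assume uv: "u < v"
    have "set_integrable \<nu> {u..v} (D F)" using has_dS_densityD(1)[OF form_domainD(1)[OF F]] uv by simp
    then show "set_integrable \<nu> {u..v} (\<lambda>x. indicator (ray e a) x * D F x)"
      unfolding set_integrable_def by (rule Bochner_Integration.integrable_bound) (auto simp: indicator_def)
    have puv: "p u \<le> p v" using uv by (auto simp: p_def)
    have "(LINT x:{u..v}|\<nu>. indicator (ray e a) x * D F x) = (LINT x:{p u..p v}|\<nu>. D F x)"
      unfolding set_lebesgue_integral_def
    proof (intro integral_cong_AE)
      show "AE x in \<nu>. indicator {u..v} x *\<^sub>R (indicator (ray e a) x * D F x) = indicator {p u..p v} x *\<^sub>R D F x"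
        using AE_neq[of a] by eventually_elim (use uv e in \<open>auto simp: indicator_def ray_def p_def\<close>)
    qed auto
    also have "\<dots> = cutoff e a F v - cutoff e a F u"
      using has_dS_densityD(2)[OF form_domainD(1)[OF F] puv] by (simp add: cut)
    finally show "(LINT x:{u..v}|\<nu>. indicator (ray e a) x * D F x) = cutoff e a F v - cutoff e a F u" .
  qed
  have "integrable \<nu> (\<lambda>x. (indicator (ray e a) x * D F x)\<^sup>2)"
    using form_domainD(5)[OF F] by (rule Bochner_Integration.integrable_bound) (auto simp: indicator_def)
  from form_domainI[OF L d this]
  show "cutoff e a F \<in> form_domain S m" "AE x in \<nu>. D (cutoff e a F) x = indicator (ray e a) x * D F x"
    by auto
qed

text \<open>Source of explicit test functions. Integrability of \<open>g\<close> keeps the primitive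
  bounded, hence in \<open>L\<^sup>2\<close> of the finite measure \<open>m\<close>; square
  integrability controls the energy. The factor \<open>e\<close> in the density compensates for
  integrating away from \<open>a\<close> towards the left when \<open>e = -1\<close>.\<close>

lemma form_domain_primitive:
  assumes e: "e = 1 \<or> e = -1" and [measurable]: "g \<in> borel_measurable borel" and g0: "\<And>s. 0 \<le> g s"
    and g1: "(\<integral>\<^sup>+s. g s \<partial>\<nu>) < \<top>" and g2: "(\<integral>\<^sup>+s. ennreal ((g s)\<^sup>2) \<partial>\<nu>) < \<top>"
  obtains F where "F \<in> form_domain S m" "AE x in \<nu>. D F x = e * (indicator (ray e a) x * g x)"
    "\<And>x. x \<notin> ray e a \<Longrightarrow> F x = 0"
    "\<And>x. x \<in> ray e a \<Longrightarrow> 0 \<le> F x"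
    "\<And>x. x \<in> ray e a \<Longrightarrow> ennreal (F x) = (\<integral>\<^sup>+s\<in>segm e a x. g s \<partial>\<nu>)"
proof -
  define h where "h s = indicator (ray e a) s * g s" for s
  have h0: "0 \<le> h s" for s by (simp add: h_def g0)
  have [measurable]: "h \<in> borel_measurable borel" unfolding h_def by measurable
  have ig: "integrable \<nu> g" using g1 g0 by (intro integrableI_bounded) auto
  have ih: "integrable \<nu> h" using ig by (rule Bochner_Integration.integrable_bound) (auto simp: h_def indicator_def)
  define Phi where "Phi x = (LINT s:{..x}|\<nu>. e * h s)" for x
  have ieh: "integrable \<nu> (\<lambda>s. e * h s)" using ih by simp
  have dPhi: "has_dS_density S Phi (\<lambda>s. e * h s)"
    unfolding Phi_def by (rule has_dS_density_integral[OF ieh])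
  define F where "F x = Phi x - Phi a" for x
  have dF: "has_dS_density S F (\<lambda>s. e * h s)"
    using dPhi by (simp add: has_dS_density_def F_def)
  have Fx: "F x = (LINT s:segm e a x|\<nu>. g s)" if "x \<in> ray e a" for x
  proof (cases "e = 1")
    case True
    then have "a \<le> x" using that by (simp add: ray_def)
    then have "F x = (LINT s:{a..x}|\<nu>. e * h s)" using has_dS_densityD(2)[OF dPhi] by (simp add: F_def)
    also have "\<dots> = (LINT s:segm e a x|\<nu>. g s)" unfolding set_lebesgue_integral_def
    proof (intro integral_cong_AE)
      show "AE s in \<nu>. indicator {a..x} s *\<^sub>R (e * h s) = indicator (segm e a x) s *\<^sub>R g s"
        using AE_neq[of a] AE_neq[of x]
        by eventually_elim (use True in \<open>auto simp: indicator_def h_def segm_def ray_def\<close>)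
    qed auto
    finally show ?thesis .
  next
    case False
    with e have e1: "e = -1" by simp
    then have "x \<le> a" using that by (simp add: ray_def)
    then have "F x = - (LINT s:{x..a}|\<nu>. e * h s)" using has_dS_densityD(2)[OF dPhi, of x a] by (simp add: F_def)
    also have "\<dots> = (LINT s:{x..a}|\<nu>. h s)" by (subst set_integral_mult_right) (simp add: e1)
    also have "\<dots> = (LINT s:segm e a x|\<nu>. g s)" unfolding set_lebesgue_integral_def
    proof (intro integral_cong_AE)
      show "AE s in \<nu>. indicator {x..a} s *\<^sub>R h s = indicator (segm e a x) s *\<^sub>R g s"
        using AE_neq[of a] AE_neq[of x]
        by eventually_elim (use e1 in \<open>auto simp: indicator_def h_def segm_def ray_def\<close>)
    qed auto
    finally show ?thesis .
  qed
  have F0: "F x = 0" if "x \<notin> ray e a" for x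
  proof -
    define u v where "u = min x a" and "v = max x a"
    have "(LINT s:{u..v}|\<nu>. e * h s) = 0"
      unfolding set_lebesgue_integral_def
    proof (intro integral_eq_zero_AE)
      show "AE s in \<nu>. indicator {u..v} s *\<^sub>R (e * h s) = 0"
        using AE_neq[of a] AE_neq[of x]
        by eventually_elim (use e that in \<open>auto simp: indicator_def h_def ray_def u_def v_def\<close>)
    qed
    moreover have "u \<le> v" by (simp add: u_def v_def)
    ultimately have "Phi v = Phi u" using has_dS_densityD(2)[OF dPhi, of u v] by (simp only: eq_iff_diff_eq_0[symmetric])
    then show ?thesis by (auto simp: F_def u_def v_def min_def max_def split: if_splits)
  qed
  have Fn: "0 \<le> F x" if "x \<in> ray e a" for x
    unfolding Fx[OF that] set_lebesgue_integral_def by (intro integral_nonneg_AE) (auto simp: g0)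
  have Fe: "ennreal (F x) = (\<integral>\<^sup>+s\<in>segm e a x. g s \<partial>\<nu>)" if "x \<in> ray e a" for x
  proof -
    have "set_integrable \<nu> (segm e a x) g"
      using ig by (auto intro!: set_integrable_if_integrable)
    then have "(\<integral>\<^sup>+s. ennreal (indicator (segm e a x) s * g s) \<partial>\<nu>) = ennreal (LINT s:segm e a x|\<nu>. g s)"
      unfolding set_lebesgue_integral_def set_integrable_def
      by (subst nn_integral_eq_integral) (auto simp: g0)
    also have "(\<integral>\<^sup>+s. ennreal (indicator (segm e a x) s * g s) \<partial>\<nu>) = (\<integral>\<^sup>+s\<in>segm e a x. g s \<partial>\<nu>)"
      by (intro nn_integral_cong) (auto simp: indicator_def)
    finally show ?thesis by (simp add: Fx[OF that])
  qed
  have i2: "integrable \<nu> (\<lambda>s. (e * h s)\<^sup>2)"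
  proof -
    have "integrable \<nu> (\<lambda>s. (g s)\<^sup>2)" using g2 by (intro integrableI_bounded) auto
    then show ?thesis by (rule Bochner_Integration.integrable_bound) (use e in \<open>auto simp: h_def indicator_def\<close>)
  qed
  \<comment> \<open>As \<open>h\<close> is nonnegative, \<open>e * F\<close> is nondecreasing and
    hence Borel.\<close>
  have [measurable]: "F \<in> borel_measurable borel"
  proof -
    have "(\<lambda>x. e * F x) \<in> borel_measurable borel"
    proof (rule borel_measurable_mono, rule monoI)
      fix x y :: real assume xy: "x \<le> y"
      have "e * F y - e * F x = e * (Phi y - Phi x)" by (simp add: F_def algebra_simps)
      also have "\<dots> = e * (LINT s:{x..y}|\<nu>. e * h s)" using has_dS_densityD(2)[OF dPhi xy] by simp
      also have "\<dots> = (LINT s:{x..y}|\<nu>. h s)" by (subst set_integral_mult_right) (use e in auto)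
      also have "\<dots> \<ge> 0" unfolding set_lebesgue_integral_def by (intro integral_nonneg_AE) (auto simp: h0)
      finally show "e * F x \<le> e * F y" by simp
    qed
    then have "(\<lambda>x. e * (e * F x)) \<in> borel_measurable borel" by measurable
    then show ?thesis using e by auto
  qed
  have "\<bar>F x\<bar> \<le> enn2real (\<integral>\<^sup>+s. g s \<partial>\<nu>)" for x
  proof (cases "x \<in> ray e a")
    case True
    have "ennreal (F x) \<le> (\<integral>\<^sup>+s. g s \<partial>\<nu>)"
      unfolding Fe[OF True] by (intro nn_integral_mono) (auto simp: indicator_def)
    also have "\<dots> = ennreal (enn2real (\<integral>\<^sup>+s. g s \<partial>\<nu>))" using g1 by (simp add: less_top)
    finally show ?thesis using Fn[OF True] by simp
  qed (simp add: F0)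
  then have L: "F \<in> L2 m" by (intro L2_bounded) auto
  show ?thesis
    using form_domainI[OF L dF i2] F0 Fn Fe by (intro that[of F]) (auto simp: h_def)
qed

end

section \<open>Weighted Hardy inequalities\<close>

lemma nn_integral_powr_minus_half_from_0:
  assumes "0 \<le> c"
  shows "(\<integral>\<^sup>+t\<in>{0<..<c}. ennreal (t powr (-1/2)) \<partial>lborel) = ennreal (2 * c powr (1/2))"
proof -
  have "((\<lambda>x. x powr (-1/2)) has_integral (c powr (-1/2 + 1) / (-1/2 + 1))) {0..c}"
    by (rule has_integral_powr_from_0) (use assms in auto)
  then have "(\<integral>\<^sup>+t. ennreal (t powr (-1/2)) * indicator {0..c} t \<partial>lborel) = ennreal (c powr (-1/2 + 1) / (-1/2 + 1))"
    by (intro nn_integral_has_integral_lebesgue') auto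
  \<comment> \<open>At \<open>t = 0\<close> both integrands vanish because
    \<open>0 powr (-1/2) = 0\<close>, so only the endpoint \<open>c\<close> is removed as a null
    set.\<close>
  moreover have "(\<integral>\<^sup>+t\<in>{0<..<c}. ennreal (t powr (-1/2)) \<partial>lborel) = (\<integral>\<^sup>+t. ennreal (t powr (-1/2)) * indicator {0..c} t \<partial>lborel)"
    by (intro nn_integral_cong_AE)
      (use AE_lborel_singleton[of c] in \<open>auto elim!: eventually_mono simp: indicator_def\<close>)
  ultimately show ?thesis by simp
qed

lemma nn_integral_powr_minus_half:
  assumes "0 < c" "c \<le> d"
  shows "(\<integral>\<^sup>+t\<in>{c<..<d}. ennreal (t powr (-1/2) / 2) \<partial>lborel) = ennreal (d powr (1/2) - c powr (1/2))"
proof -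
  have "(\<integral>\<^sup>+t\<in>{c<..<d}. ennreal (t powr (-1/2) / 2) \<partial>lborel) = (\<integral>\<^sup>+t. ennreal (t powr (-1/2) / 2) * indicator {c..d} t \<partial>lborel)"
    by (intro nn_integral_cong_AE)
      (use AE_lborel_singleton[of c] AE_lborel_singleton[of d] in \<open>auto elim!: eventually_elim2 simp: indicator_def\<close>)
  also have "\<dots> = ennreal (d powr (1/2) - c powr (1/2))"
    by (rule nn_integral_FTC_Icc) (use assms in \<open>auto intro!: derivative_eq_intros\<close>)
  finally show ?thesis .
qed

lemma nn_integral_powr_minus_three_halves:
  assumes "0 < c"
  shows "(\<integral>\<^sup>+t\<in>{c<..}. ennreal (t powr (-3/2) / 2) \<partial>lborel) = ennreal (c powr (-1/2))"
proof -
  have "(\<integral>\<^sup>+t\<in>{c<..}. ennreal (t powr (-3/2) / 2) \<partial>lborel) = (\<integral>\<^sup>+t. ennreal (t powr (-3/2) / 2) * indicator {c..} t \<partial>lborel)"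
    by (intro nn_integral_cong_AE)
      (use AE_lborel_singleton[of c] in \<open>auto elim!: eventually_mono simp: indicator_def\<close>)
  also have "\<dots> = ennreal (0 - (- (c powr (-1/2))))"
  proof (rule nn_integral_FTC_atLeast)
    show "((\<lambda>x::real. - (x powr (-1/2))) \<longlongrightarrow> 0) at_top"
      using tendsto_minus[OF tendsto_neg_powr[of "-1/2::real", OF _ filterlim_ident]] by simp
    show "((\<lambda>x. - (x powr (-1/2))) has_real_derivative x powr (-3/2) / 2) (at x)" if "c \<le> x" for x
      using assms that by (auto intro!: derivative_eq_intros)
  qed auto
  finally show ?thesis by simp
qed

section \<open>Half-line constants, the scale coordinate and the Schur test\<close>

context scale_speed
begin

definition A_const :: "real \<Rightarrow> real \<Rightarrow> ennreal" where
  "A_const e a = Inf {A. \<forall>F\<in>form_domain S m.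
        (\<integral>\<^sup>+x\<in>cray e a. ennreal ((F x - F a)\<^sup>2) \<partial>m)
          \<le> A * (\<integral>\<^sup>+x\<in>cray e a. ennreal ((D F x)\<^sup>2) \<partial>\<nu>)}"

definition B_const :: "real \<Rightarrow> real \<Rightarrow> ennreal" where
  "B_const e a = (SUP x\<in>cray e a. emeasure m (ray e x) * ennreal (e * (S x - S a)))"

text \<open>The scale distance from \<open>a\<close> in the direction \<open>e\<close>: it is
  positive exactly on the open half-line, and it is the coordinate in which \<open>dS\<close>
  becomes Lebesgue measure.\<close>

definition sig :: "real \<Rightarrow> real \<Rightarrow> real \<Rightarrow> real" where
  "sig e a x = e * (S x - S a)"

lemma sig_borel [measurable]: "sig e a \<in> borel_measurable borel"
  unfolding sig_def by measurable

lemma sig_less_iff: "e = 1 \<or> e = -1 \<Longrightarrow> sig e a x < sig e a y \<longleftrightarrow> y \<in> ray e x"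
  by (auto simp: sig_def ray_def)

lemma sig_pos_iff: "e = 1 \<or> e = -1 \<Longrightarrow> 0 < sig e a x \<longleftrightarrow> x \<in> ray e a"
  using sig_less_iff[of e a a x] by (simp add: sig_def)

lemma S_surj: "\<exists>x. S x = y"
proof -
  obtain u where "S u \<le> y" using S_bot by (auto simp: filterlim_at_bot eventually_at_bot_linorder)
  moreover obtain v where "y \<le> S v" using S_top by (auto simp: filterlim_at_top eventually_at_top_linorder)
  ultimately have "S u \<le> y \<and> y \<le> S v" by simp
  then have "u \<le> v" by (meson S_less_iff leI le_less_trans order.strict_trans1 order_less_irrefl)
  then show ?thesis
    using IVT'[of S u y v] \<open>S u \<le> y\<close> \<open>y \<le> S v\<close> continuous_on_subset[OF cont_S] by auto
qed

lemma nu_Ioo: "u \<le> v \<Longrightarrow> emeasure \<nu> {u<..<v} = ennreal (S v - S u)"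
proof -
  assume uv: "u \<le> v"
  have "emeasure \<nu> {u<..<v} = emeasure \<nu> {u..v}"
    using AE_neq[of u] AE_neq[of v] uv by (intro emeasure_eq_AE) (auto elim!: eventually_elim2)
  then show ?thesis by (simp add: nu_Icc[OF uv])
qed

text \<open>Strict monotonicity and surjectivity of \<open>S\<close> make the preimage of a bounded
  interval a bounded interval with \<open>dS\<close>-mass equal to the length; such intervals
  determine Lebesgue measure. For \<open>e = -1\<close> the endpoints change order.\<close>

lemma distr_sig:
  assumes e: "e = 1 \<or> e = -1"
  shows "distr \<nu> borel (sig e a) = lborel"
proof (rule lborel_eqI[symmetric])
  fix l u :: real assume "\<And>b. b \<in> Basis \<Longrightarrow> l \<bullet> b \<le> u \<bullet> b"
  then have lu: "l \<le> u" by simp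
  have ex: "\<exists>x. sig e a x = y" for y
  proof -
    obtain x where "S x = S a + e * y" using S_surj by blast
    then show ?thesis using e by (intro exI[of _ x]) (auto simp: sig_def)
  qed
  obtain x where x: "sig e a x = l" using ex by blast
  obtain y where y: "sig e a y = u" using ex by blast
  have v: "sig e a -` {l<..<u} = (if e = 1 then {x<..<y} else {y<..<x})"
    using e unfolding x[symmetric] y[symmetric] by (auto simp: sig_def)
  have "emeasure \<nu> (sig e a -` {l<..<u}) = ennreal (u - l)"
    unfolding v using e lu unfolding x[symmetric] y[symmetric]
    by (auto simp: sig_def nu_Ioo strict_mono_less_eq[OF strict_S] algebra_simps)
  then show "emeasure (distr \<nu> borel (sig e a)) (box l u) = (\<Prod>b\<in>Basis. (u - l) \<bullet> b)"
    by (simp add: emeasure_distr box_real)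
qed simp

lemma nn_integral_sig:
  assumes e: "e = 1 \<or> e = -1" and [measurable]: "h \<in> borel_measurable borel"
  shows "(\<integral>\<^sup>+s. h (sig e a s) \<partial>\<nu>) = (\<integral>\<^sup>+t. h t \<partial>lborel)"
  unfolding distr_sig[OF e, of a, symmetric] by (subst nn_integral_distr) auto

text \<open>Tonelli on the triangle of pairs for which \<open>s\<close> lies strictly between
  \<open>a\<close> and \<open>x\<close>.\<close>

lemma nn_integral_ray_segm:
  assumes [measurable]: "(\<lambda>(s, x). h s x) \<in> borel_measurable (borel \<Otimes>\<^sub>M borel)"
    and e: "e = 1 \<or> e = -1"
  shows "(\<integral>\<^sup>+x\<in>ray e a. (\<integral>\<^sup>+s\<in>segm e a x. h s x \<partial>\<nu>) \<partial>m) = (\<integral>\<^sup>+s\<in>ray e a. (\<integral>\<^sup>+x\<in>ray e s. h s x \<partial>m) \<partial>\<nu>)"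
proof -
  interpret pair_sigma_finite \<nu> m ..
  have [measurable]: "Measurable.pred (borel \<Otimes>\<^sub>M borel) (\<lambda>w. fst w \<in> segm e a (snd w))" by measurable
  have "(\<integral>\<^sup>+x\<in>ray e a. (\<integral>\<^sup>+s\<in>segm e a x. h s x \<partial>\<nu>) \<partial>m) = (\<integral>\<^sup>+x. (\<integral>\<^sup>+s. (if s \<in> segm e a x then h s x else 0) \<partial>\<nu>) \<partial>m)"
    by (intro nn_integral_cong) (use segm_ray[OF e] in \<open>auto intro!: nn_integral_cong simp: indicator_def nn_integral_0_iff_AE\<close>)
  also have "\<dots> = (\<integral>\<^sup>+s. (\<integral>\<^sup>+x. (if s \<in> segm e a x then h s x else 0) \<partial>m) \<partial>\<nu>)"
    by (rule Fubini') measurable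
  also have "\<dots> = (\<integral>\<^sup>+s\<in>ray e a. (\<integral>\<^sup>+x\<in>ray e s. h s x \<partial>m) \<partial>\<nu>)"
    by (intro nn_integral_cong) (auto intro!: nn_integral_cong simp: indicator_def segm_iff)
  finally show ?thesis .
qed

text \<open>Write \<open>\<bar>f\<bar>\<close> as \<open>\<bar>f\<bar> / sqrt p\<close> times
  \<open>sqrt p\<close> and apply Cauchy-Schwarz on the segment from \<open>a\<close> to
  \<open>x\<close>; the second factor is at most \<open>q x\<close>. After Tonelli, the weight
  \<open>1 / p s\<close> is cancelled by the bound \<open>C * p s\<close> on the tail integral of
  \<open>q\<close>.\<close>

lemma Schur_test:
  fixes f p :: "real \<Rightarrow> real" and q :: "real \<Rightarrow> ennreal"
  assumes e: "e = 1 \<or> e = -1"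
    and [measurable]: "f \<in> borel_measurable borel" "p \<in> borel_measurable borel" "q \<in> borel_measurable borel"
    and p: "\<And>s. s \<in> ray e a \<Longrightarrow> 0 < p s"
    and q: "\<And>x. x \<in> ray e a \<Longrightarrow> (\<integral>\<^sup>+s\<in>segm e a x. p s \<partial>\<nu>) \<le> q x"
    and C: "\<And>s. s \<in> ray e a \<Longrightarrow> (\<integral>\<^sup>+x\<in>ray e s. q x \<partial>m) \<le> C * ennreal (p s)"
  shows "(\<integral>\<^sup>+x\<in>ray e a. (\<integral>\<^sup>+s\<in>segm e a x. \<bar>f s\<bar> \<partial>\<nu>)\<^sup>2 \<partial>m) \<le> C * (\<integral>\<^sup>+s\<in>ray e a. ennreal ((f s)\<^sup>2) \<partial>\<nu>)"
proof -
  have CS: "(\<integral>\<^sup>+s\<in>segm e a x. \<bar>f s\<bar> \<partial>\<nu>)\<^sup>2 \<le> (\<integral>\<^sup>+s\<in>segm e a x. ennreal ((f s)\<^sup>2 / p s) * q x \<partial>\<nu>)" if x: "x \<in> ray e a" for x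
  proof -
    have pp: "0 < p s" if "s \<in> segm e a x" for s using that p by (auto simp: segm_iff)
    have eq: "(\<integral>\<^sup>+s\<in>segm e a x. \<bar>f s\<bar> \<partial>\<nu>)
        = (\<integral>\<^sup>+s. ennreal (\<bar>f s\<bar> / sqrt (p s) * indicator (segm e a x) s) * ennreal (sqrt (p s) * indicator (segm e a x) s) \<partial>\<nu>)"
      by (intro nn_integral_cong) (auto simp: indicator_def ennreal_mult'[symmetric] dest!: pp)
    have "(\<integral>\<^sup>+s\<in>segm e a x. \<bar>f s\<bar> \<partial>\<nu>)\<^sup>2 \<le> (\<integral>\<^sup>+s. (ennreal (\<bar>f s\<bar> / sqrt (p s) * indicator (segm e a x) s))\<^sup>2 \<partial>\<nu>) * (\<integral>\<^sup>+s. (ennreal (sqrt (p s) * indicator (segm e a x) s))\<^sup>2 \<partial>\<nu>)"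
      unfolding eq by (rule Cauchy_Schwarz_nn_integral) auto
    also have "(\<integral>\<^sup>+s. (ennreal (\<bar>f s\<bar> / sqrt (p s) * indicator (segm e a x) s))\<^sup>2 \<partial>\<nu>) = (\<integral>\<^sup>+s\<in>segm e a x. ennreal ((f s)\<^sup>2 / p s) \<partial>\<nu>)"
      by (intro nn_integral_cong) (auto simp: indicator_def ennreal_power power_divide dest!: pp)
    also have "(\<integral>\<^sup>+s. (ennreal (sqrt (p s) * indicator (segm e a x) s))\<^sup>2 \<partial>\<nu>) = (\<integral>\<^sup>+s\<in>segm e a x. p s \<partial>\<nu>)"
      by (intro nn_integral_cong) (auto simp: indicator_def ennreal_power dest!: pp)
    also have "(\<integral>\<^sup>+s\<in>segm e a x. ennreal ((f s)\<^sup>2 / p s) \<partial>\<nu>) * (\<integral>\<^sup>+s\<in>segm e a x. p s \<partial>\<nu>) \<le> (\<integral>\<^sup>+s\<in>segm e a x. ennreal ((f s)\<^sup>2 / p s) \<partial>\<nu>) * q x"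
      by (intro mult_left_mono q x) auto
    also have "\<dots> = (\<integral>\<^sup>+s\<in>segm e a x. ennreal ((f s)\<^sup>2 / p s) * q x \<partial>\<nu>)"
      by (subst nn_integral_multc[symmetric]) (auto intro!: nn_integral_cong simp: mult_ac)
    finally show ?thesis .
  qed
  have "(\<integral>\<^sup>+x\<in>ray e a. (\<integral>\<^sup>+s\<in>segm e a x. \<bar>f s\<bar> \<partial>\<nu>)\<^sup>2 \<partial>m) \<le> (\<integral>\<^sup>+x\<in>ray e a. (\<integral>\<^sup>+s\<in>segm e a x. ennreal ((f s)\<^sup>2 / p s) * q x \<partial>\<nu>) \<partial>m)"
    by (intro nn_integral_mono) (auto split: split_indicator intro!: CS)
  also have "\<dots> = (\<integral>\<^sup>+s\<in>ray e a. (\<integral>\<^sup>+x\<in>ray e s. ennreal ((f s)\<^sup>2 / p s) * q x \<partial>m) \<partial>\<nu>)"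
    by (rule nn_integral_ray_segm[OF _ e]) measurable
  also have "\<dots> \<le> (\<integral>\<^sup>+s\<in>ray e a. C * ennreal ((f s)\<^sup>2) \<partial>\<nu>)"
  proof (intro nn_integral_mono)
    fix s
    show "(\<integral>\<^sup>+x\<in>ray e s. ennreal ((f s)\<^sup>2 / p s) * q x \<partial>m) * indicator (ray e a) s \<le> C * ennreal ((f s)\<^sup>2) * indicator (ray e a) s"
    proof (cases "s \<in> ray e a")
      case True
      have "(\<integral>\<^sup>+x\<in>ray e s. ennreal ((f s)\<^sup>2 / p s) * q x \<partial>m) = ennreal ((f s)\<^sup>2 / p s) * (\<integral>\<^sup>+x\<in>ray e s. q x \<partial>m)"
        by (subst nn_integral_cmult[symmetric]) (auto intro!: nn_integral_cong simp: mult_ac)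
      also have "\<dots> \<le> ennreal ((f s)\<^sup>2 / p s) * (C * ennreal (p s))"
        by (intro mult_left_mono C True) auto
      also have "\<dots> = C * (ennreal ((f s)\<^sup>2 / p s) * ennreal (p s))" by (simp add: mult_ac)
      also have "ennreal ((f s)\<^sup>2 / p s) * ennreal (p s) = ennreal ((f s)\<^sup>2)"
        using p[OF True] by (subst ennreal_mult[symmetric]) auto
      finally show ?thesis using True by simp
    qed simp
  qed
  also have "\<dots> = C * (\<integral>\<^sup>+s\<in>ray e a. ennreal ((f s)\<^sup>2) \<partial>\<nu>)"
    by (subst nn_integral_cmult[symmetric]) (auto simp: mult_ac)
  finally show ?thesis .
qed

lemma increment_le:
  assumes e: "e = 1 \<or> e = -1" and F: "F \<in> form_domain S m" and x: "x \<in> ray e a"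
  shows "ennreal ((F x - F a)\<^sup>2) \<le> (\<integral>\<^sup>+s\<in>segm e a x. \<bar>D F s\<bar> \<partial>\<nu>)\<^sup>2"
proof -
  note d = has_dS_densityD[OF form_domainD(1)[OF F]]
  have [measurable]: "D F \<in> borel_measurable borel" by (rule form_domainD(3)[OF F])
  define u v where "u = min a x" and "v = max a x"
  have uv: "u \<le> v" by (simp add: u_def v_def)
  have "ennreal \<bar>F x - F a\<bar> = ennreal (norm (LINT s:{u..v}|\<nu>. D F s))"
    unfolding d(2)[OF uv] by (simp add: u_def v_def min_def max_def abs_minus_commute)
  also have "\<dots> \<le> (\<integral>\<^sup>+s. norm (indicator {u..v} s *\<^sub>R D F s) \<partial>\<nu>)"
    unfolding set_lebesgue_integral_def
    by (rule integral_norm_bound_ennreal) (use d(1)[OF uv] in \<open>simp add: set_integrable_def\<close>)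
  also have "\<dots> = (\<integral>\<^sup>+s\<in>segm e a x. \<bar>D F s\<bar> \<partial>\<nu>)"
  proof (rule nn_integral_cong_AE)
    show "AE s in \<nu>. ennreal (norm (indicator {u..v} s *\<^sub>R D F s)) = ennreal \<bar>D F s\<bar> * indicator (segm e a x) s"
      using AE_neq[of a] AE_neq[of x]
      by eventually_elim (use e x in \<open>auto simp: u_def v_def indicator_def segm_def ray_def\<close>)
  qed
  finally have "(ennreal \<bar>F x - F a\<bar>)\<^sup>2 \<le> (\<integral>\<^sup>+s\<in>segm e a x. \<bar>D F s\<bar> \<partial>\<nu>)\<^sup>2"
    by (intro power_mono) auto
  then show ?thesis by (simp add: ennreal_power)
qed

lemma cray_m_eq:
  assumes "e = 1 \<or> e = -1"
  shows "(\<integral>\<^sup>+x\<in>cray e a. ennreal ((F x - F a)\<^sup>2) \<partial>m) = (\<integral>\<^sup>+x\<in>ray e a. ennreal ((F x - F a)\<^sup>2) \<partial>m)"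
  by (intro nn_integral_cong) (use assms in \<open>auto simp: cray_def ray_def indicator_def\<close>)

lemma cray_nu_eq:
  assumes "e = 1 \<or> e = -1"
  shows "(\<integral>\<^sup>+x\<in>cray e a. f x \<partial>\<nu>) = (\<integral>\<^sup>+x\<in>ray e a. f x \<partial>\<nu>)"
  by (intro nn_integral_cong_AE) (use AE_neq[of a] assms in \<open>auto elim!: eventually_mono simp: cray_def ray_def indicator_def\<close>)

lemma A_const_le_Schur:
  fixes p :: "real \<Rightarrow> real" and q :: "real \<Rightarrow> ennreal"
  assumes e: "e = 1 \<or> e = -1"
    and pq: "p \<in> borel_measurable borel" "q \<in> borel_measurable borel"
      "\<And>s. s \<in> ray e a \<Longrightarrow> 0 < p s"
      "\<And>x. x \<in> ray e a \<Longrightarrow> (\<integral>\<^sup>+s\<in>segm e a x. p s \<partial>\<nu>) \<le> q x"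
      "\<And>s. s \<in> ray e a \<Longrightarrow> (\<integral>\<^sup>+x\<in>ray e s. q x \<partial>m) \<le> C * ennreal (p s)"
  shows "A_const e a \<le> C"
  unfolding A_const_def
proof (intro Inf_lower CollectI ballI)
  fix F assume F: "F \<in> form_domain S m"
  have "(\<integral>\<^sup>+x\<in>ray e a. ennreal ((F x - F a)\<^sup>2) \<partial>m) \<le> (\<integral>\<^sup>+x\<in>ray e a. (\<integral>\<^sup>+s\<in>segm e a x. \<bar>D F s\<bar> \<partial>\<nu>)\<^sup>2 \<partial>m)"
    by (intro nn_integral_mono) (auto split: split_indicator intro!: increment_le[OF e F])
  also have "\<dots> \<le> C * (\<integral>\<^sup>+s\<in>ray e a. ennreal ((D F s)\<^sup>2) \<partial>\<nu>)"
    by (rule Schur_test[OF e form_domainD(3)[OF F] pq])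
  finally show "(\<integral>\<^sup>+x\<in>cray e a. ennreal ((F x - F a)\<^sup>2) \<partial>m) \<le> C * (\<integral>\<^sup>+x\<in>cray e a. ennreal ((D F x)\<^sup>2) \<partial>\<nu>)"
    by (simp add: cray_m_eq[OF e] cray_nu_eq[OF e])
qed

text \<open>Weights \<open>p = sigma^(-1/2)\<close> and its primitive
  \<open>q = 2 sigma^(1/2)\<close>, where sigma is the scale distance to \<open>a\<close>. The tail
  integral of \<open>sigma^(1/2)\<close> beyond \<open>s\<close> is bounded by two terms, each at
  most \<open>B * sigma(s)^(-1/2)\<close>; together with the 2 in \<open>q\<close> this gives
  4.\<close>

lemma A_const_le_4_B_const:
  assumes e: "e = 1 \<or> e = -1"
  shows "A_const e a \<le> 4 * B_const e a"
proof (cases "B_const e a = \<top>")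
  case True
  then show ?thesis by (simp add: ennreal_mult_top)
next
  case False
  then obtain b where b: "B_const e a = ennreal b" "0 \<le> b" by (cases "B_const e a") auto
  let ?\<sigma> = "sig e a"
  have mb: "measure m (ray e r) * ?\<sigma> r \<le> b" if "r \<in> ray e a" for r
  proof -
    have "emeasure m (ray e r) * ennreal (?\<sigma> r) \<le> ennreal b"
      unfolding b(1)[symmetric] B_const_def sig_def by (rule SUP_upper) (use that e in \<open>auto simp: ray_def cray_def\<close>)
    then show ?thesis
      using b(2) that by (simp add: m.emeasure_eq_measure ennreal_mult'[symmetric] sig_pos_iff[OF e, symmetric])
  qed
  show ?thesis
  proof (rule A_const_le_Schur[OF e, where p = "\<lambda>s. ?\<sigma> s powr (-1/2)" and q = "\<lambda>x. ennreal (2 * ?\<sigma> x powr (1/2))"])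
    fix s assume s: "s \<in> ray e a"
    then show p: "0 < ?\<sigma> s powr (-1/2)" using sig_pos_iff[OF e, of a s] by simp
    have s0: "0 < ?\<sigma> s" using s sig_pos_iff[OF e, of a s] by simp
    \<comment> \<open>Writing the square root as an integral of its derivative from \<open>s\<close>
      on lets Tonelli replace the integral against \<open>m\<close> by tail masses of
      \<open>m\<close>, the only information contained in \<open>B_const\<close>.\<close>
    have q: "ennreal (?\<sigma> x powr (1/2)) = ennreal (?\<sigma> s powr (1/2)) + (\<integral>\<^sup>+r\<in>segm e s x. ennreal (?\<sigma> r powr (-1/2) / 2) \<partial>\<nu>)"
      if x: "x \<in> ray e s" for x
    proof -
      have "(\<integral>\<^sup>+r\<in>segm e s x. ennreal (?\<sigma> r powr (-1/2) / 2) \<partial>\<nu>) = (\<integral>\<^sup>+r. ennreal (?\<sigma> r powr (-1/2) / 2) * indicator {?\<sigma> s<..<?\<sigma> x} (?\<sigma> r) \<partial>\<nu>)"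
        by (intro nn_integral_cong) (use sig_less_iff[OF e, of a] in \<open>auto simp: indicator_def segm_iff\<close>)
      also have "\<dots> = ennreal (?\<sigma> x powr (1/2) - ?\<sigma> s powr (1/2))"
        using sig_less_iff[OF e, of a s x] x
        by (subst nn_integral_sig[OF e, of "\<lambda>t. ennreal (t powr (-1/2) / 2) * indicator {?\<sigma> s<..<?\<sigma> x} t"])
          (auto intro!: nn_integral_powr_minus_half[OF s0, simplified])
      finally show ?thesis
        using s0 sig_less_iff[OF e, of a s x] x by (simp add: ennreal_plus[symmetric] powr_mono2 del: ennreal_plus)
    qed
    have "(\<integral>\<^sup>+x\<in>ray e s. ennreal (?\<sigma> x powr (1/2)) \<partial>m) = (\<integral>\<^sup>+x\<in>ray e s. (ennreal (?\<sigma> s powr (1/2)) + (\<integral>\<^sup>+r\<in>segm e s x. ennreal (?\<sigma> r powr (-1/2) / 2) \<partial>\<nu>)) \<partial>m)"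
      by (intro nn_integral_cong) (auto simp: indicator_def q)
    also have "\<dots> = (\<integral>\<^sup>+x\<in>ray e s. ennreal (?\<sigma> s powr (1/2)) \<partial>m) + (\<integral>\<^sup>+x\<in>ray e s. (\<integral>\<^sup>+r\<in>segm e s x. ennreal (?\<sigma> r powr (-1/2) / 2) \<partial>\<nu>) \<partial>m)"
      by (simp add: distrib_right, intro nn_integral_add) auto
    finally have split: "(\<integral>\<^sup>+x\<in>ray e s. ennreal (?\<sigma> x powr (1/2)) \<partial>m) = \<dots>" .
    have "(\<integral>\<^sup>+x\<in>ray e s. (\<integral>\<^sup>+r\<in>segm e s x. ennreal (?\<sigma> r powr (-1/2) / 2) \<partial>\<nu>) \<partial>m) = (\<integral>\<^sup>+r\<in>ray e s. (\<integral>\<^sup>+x\<in>ray e r. ennreal (?\<sigma> r powr (-1/2) / 2) \<partial>m) \<partial>\<nu>)"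
      by (rule nn_integral_ray_segm[OF _ e]) measurable
    also have "\<dots> \<le> (\<integral>\<^sup>+r\<in>ray e s. ennreal b * ennreal (?\<sigma> r powr (-3/2) / 2) \<partial>\<nu>)"
    proof (intro nn_integral_mono)
      fix r
      show "(\<integral>\<^sup>+x\<in>ray e r. ennreal (?\<sigma> r powr (-1/2) / 2) \<partial>m) * indicator (ray e s) r \<le> ennreal b * ennreal (?\<sigma> r powr (-3/2) / 2) * indicator (ray e s) r"
      proof (cases "r \<in> ray e s")
        case True
        then have ra: "r \<in> ray e a" using s e by (auto simp: ray_def)
        then have r0: "0 < ?\<sigma> r" using sig_pos_iff[OF e, of a r] by simp
        \<comment> \<open>The bound on mass times scale distance costs one power of sigma and turns
          the exponent -1/2 into -3/2, which is integrable at infinity.\<close>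
        have "?\<sigma> r powr (-1/2) / 2 * measure m (ray e r) = ?\<sigma> r powr (-3/2) / 2 * (measure m (ray e r) * ?\<sigma> r)"
          using r0 powr_mult_base[of "?\<sigma> r" "-3/2"] by (simp add: mult_ac)
        also have "\<dots> \<le> ?\<sigma> r powr (-3/2) / 2 * b" by (intro mult_left_mono mb ra) auto
        finally have "ennreal (?\<sigma> r powr (-1/2) / 2 * measure m (ray e r)) \<le> ennreal (?\<sigma> r powr (-3/2) / 2 * b)"
          by (rule ennreal_leI)
        moreover have "(\<integral>\<^sup>+x\<in>ray e r. ennreal (?\<sigma> r powr (-1/2) / 2) \<partial>m) = ennreal (?\<sigma> r powr (-1/2) / 2 * measure m (ray e r))"
          by (subst nn_integral_cmult_indicator) (auto simp: m.emeasure_eq_measure ennreal_mult'[symmetric])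
        moreover have "ennreal (?\<sigma> r powr (-3/2) / 2 * b) = ennreal b * ennreal (?\<sigma> r powr (-3/2) / 2)"
          using b(2) by (subst ennreal_mult'[symmetric]) (auto simp: mult.commute)
        ultimately show ?thesis using True by simp
      qed simp
    qed
    also have "\<dots> = ennreal b * (\<integral>\<^sup>+r. ennreal (?\<sigma> r powr (-3/2) / 2) * indicator {?\<sigma> s<..} (?\<sigma> r) \<partial>\<nu>)"
      by (subst nn_integral_cmult[symmetric])
        (use sig_less_iff[OF e, of a] in \<open>auto intro!: nn_integral_cong simp: indicator_def\<close>)
    also have "\<dots> = ennreal b * ennreal (?\<sigma> s powr (-1/2))"
      by (subst nn_integral_sig[OF e, of "\<lambda>t. ennreal (t powr (-3/2) / 2) * indicator {?\<sigma> s<..} t"])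
          (auto simp: nn_integral_powr_minus_three_halves[OF s0, simplified])
    finally have 1: "(\<integral>\<^sup>+x\<in>ray e s. ennreal (?\<sigma> x powr (1/2)) \<partial>m) \<le> (\<integral>\<^sup>+x\<in>ray e s. ennreal (?\<sigma> s powr (1/2)) \<partial>m) + ennreal b * ennreal (?\<sigma> s powr (-1/2))"
      unfolding split by (rule add_left_mono)
    have "?\<sigma> s powr (1/2) * measure m (ray e s) = ?\<sigma> s powr (-1/2) * (measure m (ray e s) * ?\<sigma> s)"
      using s0 powr_mult_base[of "?\<sigma> s" "-1/2"] by (simp add: mult_ac)
    also have "\<dots> \<le> ?\<sigma> s powr (-1/2) * b" by (intro mult_left_mono mb s) auto
    finally have "ennreal (?\<sigma> s powr (1/2) * measure m (ray e s)) \<le> ennreal (?\<sigma> s powr (-1/2) * b)"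
      by (rule ennreal_leI)
    moreover have "(\<integral>\<^sup>+x\<in>ray e s. ennreal (?\<sigma> s powr (1/2)) \<partial>m) = ennreal (?\<sigma> s powr (1/2) * measure m (ray e s))"
      by (subst nn_integral_cmult_indicator) (auto simp: m.emeasure_eq_measure ennreal_mult'[symmetric])
    moreover have "ennreal (?\<sigma> s powr (-1/2) * b) = ennreal b * ennreal (?\<sigma> s powr (-1/2))"
      using b(2) by (subst ennreal_mult'[symmetric]) (auto simp: mult.commute)
    ultimately have 2: "(\<integral>\<^sup>+x\<in>ray e s. ennreal (?\<sigma> s powr (1/2)) \<partial>m) \<le> ennreal b * ennreal (?\<sigma> s powr (-1/2))"
      by simp
    have "(\<integral>\<^sup>+x\<in>ray e s. ennreal (2 * ?\<sigma> x powr (1/2)) \<partial>m) = 2 * (\<integral>\<^sup>+x\<in>ray e s. ennreal (?\<sigma> x powr (1/2)) \<partial>m)"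
      by (subst nn_integral_cmult[symmetric]) (auto intro!: nn_integral_cong simp: ennreal_mult' mult.assoc)
    also have "\<dots> \<le> 2 * (ennreal b * ennreal (?\<sigma> s powr (-1/2)) + ennreal b * ennreal (?\<sigma> s powr (-1/2)))"
      using order_trans[OF 1 add_right_mono[OF 2]] by (rule mult_left_mono) auto
    also have "\<dots> = 4 * (ennreal b * ennreal (?\<sigma> s powr (-1/2)))"
      by (simp flip: mult_2 add: mult.assoc[symmetric])
    finally show "(\<integral>\<^sup>+x\<in>ray e s. ennreal (2 * ?\<sigma> x powr (1/2)) \<partial>m) \<le> 4 * B_const e a * ennreal (?\<sigma> s powr (-1/2))"
      by (simp add: b(1) mult.assoc)
  next
    fix x assume x: "x \<in> ray e a"
    then have x0: "0 < ?\<sigma> x" using sig_pos_iff[OF e, of a x] by simp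
    have "(\<integral>\<^sup>+s\<in>segm e a x. ennreal (?\<sigma> s powr (-1/2)) \<partial>\<nu>) = (\<integral>\<^sup>+s. ennreal (?\<sigma> s powr (-1/2)) * indicator {0<..<?\<sigma> x} (?\<sigma> s) \<partial>\<nu>)"
      by (intro nn_integral_cong) (use sig_less_iff[OF e, of a] sig_pos_iff[OF e, of a] in \<open>auto simp: indicator_def segm_iff\<close>)
    also have "\<dots> = ennreal (2 * ?\<sigma> x powr (1/2))"
      using x0 by (subst nn_integral_sig[OF e, of "\<lambda>t. ennreal (t powr (-1/2)) * indicator {0<..<?\<sigma> x} t"])
        (auto simp: nn_integral_powr_minus_half_from_0[simplified])
    finally show "(\<integral>\<^sup>+s\<in>segm e a x. ennreal (?\<sigma> s powr (-1/2)) \<partial>\<nu>) \<le> ennreal (2 * ?\<sigma> x powr (1/2))" by simp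
  qed measurable
qed

end

section \<open>Spectral gaps and the Poincare constant\<close>

lemma ennreal_le_Inf_mult:
  fixes i d :: ennreal
  assumes "d < \<top>" "Inf R < \<top>" and "\<And>A. A \<in> R \<Longrightarrow> i \<le> A * d"
  shows "i \<le> Inf R * d"
proof (cases "d = 0")
  case True
  obtain A where "A \<in> R" using assms(2) by (auto simp: Inf_less_iff)
  then show ?thesis using assms(3) True by auto
next
  case False
  then have "i / d \<le> A" if "A \<in> R" for A
    using assms(3)[OF that] by (intro divide_le_posI_ennreal) (auto simp: mult.commute zero_less_iff_neq_zero)
  then have "i / d \<le> Inf R" by (rule Inf_greatest)
  then have "i / d * d \<le> Inf R * d" by (rule mult_right_mono) simp
  then show ?thesis using False assms(1) by (simp add: ennreal_divide_times)
qed

lemma one_divide_antimono_ennreal: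
  fixes x y :: ennreal
  assumes "x \<le> y"
  shows "1 / y \<le> 1 / x"
proof -
  consider "x = 0" | "y = \<top>" | a b where "x = ennreal a" "y = ennreal b" "0 < a" "0 < b"
    using assms by (cases x; cases y) (auto simp: top_unique le_less)
  then show ?thesis
  proof cases
    case 3
    then have "a \<le> b" using assms by simp
    then show ?thesis using 3 divide_ennreal[of 1 a] divide_ennreal[of 1 b] by (simp add: frac_le)
  qed auto
qed

text \<open>Turns a spectral gap, a largest \<open>\<gamma>\<close>, into the reciprocal of a best
  constant, a smallest \<open>A\<close>, with \<open>1 / 0 = \<infinity>\<close> and
  \<open>1 / \<infinity> = 0\<close>. Finiteness of \<open>d\<close> settles the extreme case:
  \<open>\<gamma> = \<infinity>\<close> then forces all \<open>i F\<close> to vanish, so that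
  \<open>A = 0\<close> is admissible.\<close>

lemma Sup_eq_inverse_Inf:
  fixes i d :: "'b \<Rightarrow> ennreal"
  assumes fin: "\<And>F. F \<in> V \<Longrightarrow> d F < \<top>"
  shows "Sup {\<gamma>. \<forall>F\<in>V. \<gamma> * i F \<le> d F} = 1 / Inf {A. \<forall>F\<in>V. i F \<le> A * d F}" (is "Sup ?\<Gamma> = 1 / Inf ?R")
proof (rule antisym)
  show "Sup ?\<Gamma> \<le> 1 / Inf ?R"
  proof (rule Sup_least)
    fix \<gamma> assume g: "\<gamma> \<in> ?\<Gamma>"
    consider "\<gamma> = 0" | "\<gamma> = \<top>" | r where "\<gamma> = ennreal r" "0 < r"
      by (cases \<gamma>) (auto simp: le_less)
    then show "\<gamma> \<le> 1 / Inf ?R"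
    proof cases
      case 2
      have "i F = 0" if "F \<in> V" for F
        using g fin[OF that] that 2 by (auto simp: ennreal_top_mult split: if_splits)
      then have "0 \<in> ?R" by simp
      then have "Inf ?R \<le> 0" by (rule Inf_lower)
      then show ?thesis by simp
    next
      case 3
      have "i F \<le> ennreal (1 / r) * d F" if "F \<in> V" for F
      proof -
        have "ennreal (1 / r) * (ennreal r * i F) \<le> ennreal (1 / r) * d F"
          using g that 3 by (intro mult_left_mono) auto
        then show ?thesis using 3 by (simp add: mult.assoc[symmetric] ennreal_mult[symmetric])
      qed
      then have "Inf ?R \<le> ennreal (1 / r)" by (intro Inf_lower) auto
      then have "1 / ennreal (1 / r) \<le> 1 / Inf ?R"
        by (rule one_divide_antimono_ennreal)
      then show ?thesis using 3 divide_ennreal[of 1 "1 / r"] by simp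
    qed auto
  qed
  show "1 / Inf ?R \<le> Sup ?\<Gamma>"
  proof (cases "Inf ?R = \<top>")
    case False
    then have J: "Inf ?R < \<top>" unfolding less_top .
    have "1 / Inf ?R \<in> ?\<Gamma>"
    proof (intro CollectI ballI)
      fix F assume F: "F \<in> V"
      have le: "i F \<le> Inf ?R * d F" by (rule ennreal_le_Inf_mult[OF fin[OF F] J]) (use F in auto)
      show "1 / Inf ?R * i F \<le> d F"
      proof (cases "Inf ?R = 0")
        case True then show ?thesis using le by simp
      next
        case False
        have "1 / Inf ?R * i F \<le> 1 / Inf ?R * (Inf ?R * d F)" by (intro mult_left_mono le) simp
        also have "\<dots> = d F"
          using False J by (simp add: mult.assoc[symmetric] ennreal_divide_times)
        finally show ?thesis .
      qed
    qed
    then show ?thesis by (rule Sup_upper)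
  next
    case True
    show ?thesis unfolding True by simp
  qed
qed

context scale_speed
begin

definition osc :: "real \<Rightarrow> real \<Rightarrow> (real \<Rightarrow> real) \<Rightarrow> ennreal" where
  "osc e a F = (\<integral>\<^sup>+x\<in>cray e a. ennreal ((F x - F a)\<^sup>2) \<partial>m)"

definition energy :: "real \<Rightarrow> real \<Rightarrow> (real \<Rightarrow> real) \<Rightarrow> ennreal" where
  "energy e a F = (\<integral>\<^sup>+x\<in>cray e a. ennreal ((D F x)\<^sup>2) \<partial>\<nu>)"

definition total_energy :: "(real \<Rightarrow> real) \<Rightarrow> ennreal" where
  "total_energy F = (\<integral>\<^sup>+x. ennreal ((D F x)\<^sup>2) \<partial>\<nu>)"

lemma A_const_eq: "A_const e a = Inf {A. \<forall>F\<in>form_domain S m. osc e a F \<le> A * energy e a F}"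
  by (simp add: A_const_def osc_def energy_def)

lemma dirichlet_form_eq_total_energy:
  assumes F: "F \<in> form_domain S m"
  shows "ennreal (dirichlet_form S F F) = total_energy F"
  unfolding dirichlet_form_def total_energy_def power2_eq_square
  by (rule nn_integral_eq_integral[symmetric]) (use form_domainD(5)[OF F] in \<open>auto simp: power2_eq_square\<close>)

lemma total_energy_finite: "F \<in> form_domain S m \<Longrightarrow> total_energy F < \<top>"
  by (simp flip: dirichlet_form_eq_total_energy)

lemma energy_le_total: "energy e a F \<le> total_energy F"
  unfolding energy_def total_energy_def by (intro nn_integral_mono) (auto split: split_indicator)

lemma energy_finite: "F \<in> form_domain S m \<Longrightarrow> energy e a F < \<top>"
  using energy_le_total total_energy_finite by (rule le_less_trans)

lemma osc_le_A_const:
  assumes "F \<in> form_domain S m" "A_const e a < \<top>"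
  shows "osc e a F \<le> A_const e a * energy e a F"
  unfolding A_const_eq by (rule ennreal_le_Inf_mult) (use assms energy_finite in \<open>auto simp: A_const_eq\<close>)

lemma cutoff_energy:
  assumes e: "e = 1 \<or> e = -1" and F: "F \<in> form_domain S m"
  shows "total_energy (cutoff e a F) = energy e a F"
proof -
  have "total_energy (cutoff e a F) = (\<integral>\<^sup>+x\<in>ray e a. ennreal ((D F x)\<^sup>2) \<partial>\<nu>)"
    unfolding total_energy_def
    by (intro nn_integral_cong_AE) (use cutoff_form_domain(2)[OF e F, of a] in \<open>auto elim!: eventually_mono split: split_indicator\<close>)
  then show ?thesis by (simp add: energy_def cray_nu_eq[OF e])
qed

lemma cutoff_osc:
  assumes e: "e = 1 \<or> e = -1"
  shows "(\<integral>\<^sup>+x. ennreal ((cutoff e a F x)\<^sup>2) \<partial>m) = osc e a F"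
  unfolding osc_def cray_m_eq[OF e]
  by (intro nn_integral_cong) (auto simp: cutoff_def split: split_indicator)

text \<open>A function is recovered at every point, not merely almost everywhere, from its density
  and one value. This makes the generator kernels literal sets of functions.\<close>

lemma const_if_form_zero:
  assumes F: "F \<in> form_domain S m" and z: "dirichlet_form S F F = 0"
  shows "F x = F y"
proof -
  have [measurable]: "D F \<in> borel_measurable borel" by (rule form_domainD(3)[OF F])
  have "total_energy F = 0" using z dirichlet_form_eq_total_energy[OF F] by simp
  then have AE: "AE x in \<nu>. D F x = 0"
    unfolding total_energy_def by (subst (asm) nn_integral_0_iff_AE) auto
  have "F v = F u" if "u \<le> v" for u v
  proof -
    have "(LINT x:{u..v}|\<nu>. D F x) = 0"
      unfolding set_lebesgue_integral_def
      by (rule integral_eq_zero_AE) (use AE in \<open>auto elim!: eventually_mono\<close>)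
    then show ?thesis using has_dS_densityD(2)[OF form_domainD(1)[OF F] that] by simp
  qed
  then show ?thesis by (metis linear)
qed

lemma dirichlet_form_zero_left:
  assumes "AE x in \<nu>. D F x = 0"
  shows "dirichlet_form S F G = 0"
  unfolding dirichlet_form_def by (rule integral_eq_zero_AE) (use assms in \<open>auto elim!: eventually_mono\<close>)

section \<open>The killed form and its spectral gap\<close>

definition killed_domain :: "real \<Rightarrow> real \<Rightarrow> (real \<Rightarrow> real) set" where
  "killed_domain e a = {f \<in> form_domain S m. \<forall>x. x \<notin> ray e a \<longrightarrow> f x = 0}"

definition killed_gap :: "real \<Rightarrow> real \<Rightarrow> ennreal" where
  "killed_gap e a = spectral_gap (density m (indicator (ray e a))) (killed_domain e a) (dirichlet_form S)"

lemma zero_L2: "(\<lambda>_. 0) \<in> L2 M"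
  unfolding L2_def by simp

text \<open>Testing the equation against \<open>f\<close> itself gives zero energy, so
  \<open>f\<close> is constant; it vanishes at \<open>a\<close>, which lies outside the open
  half-line. The kernel is a singleton, hence the choice in \<open>kernel_projection\<close> has one
  candidate only.\<close>

lemma killed_generator_kernel:
  "generator_kernel M (killed_domain e a) (dirichlet_form S) = {\<lambda>_. 0}"
proof (intro equalityI subsetI)
  fix f assume "f \<in> generator_kernel M (killed_domain e a) (dirichlet_form S)"
  then have f: "f \<in> killed_domain e a" and "\<forall>h\<in>killed_domain e a. dirichlet_form S f h = 0"
    unfolding generator_kernel_def form_generator_def mem_Collect_eq by simp_all
  then have "dirichlet_form S f f = 0" by blast
  moreover have "f \<in> form_domain S m" using f unfolding killed_domain_def by blast
  ultimately have "f x = f a" for x by (rule const_if_form_zero[rotated])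
  moreover have "a \<notin> ray e a" by (simp add: ray_def)
  then have "f a = 0" using f by (simp add: killed_domain_def)
  ultimately show "f \<in> {\<lambda>_. 0}" by auto
next
  fix f :: "real \<Rightarrow> real" assume "f \<in> {\<lambda>_. 0}"
  then have f: "f = (\<lambda>_. 0)" by simp
  have "dirichlet_form S f h = 0" for h
    unfolding f by (rule dirichlet_form_zero_left) (rule const_form_domain)
  moreover have "f \<in> killed_domain e a"
    unfolding killed_domain_def mem_Collect_eq f using const_form_domain(1) by blast
  ultimately show "f \<in> generator_kernel M (killed_domain e a) (dirichlet_form S)"
    unfolding generator_kernel_def form_generator_def mem_Collect_eq using zero_L2 by simp
qed

lemma killed_kernel_projection:
  "kernel_projection M (killed_domain e a) (dirichlet_form S) f = (\<lambda>_. 0)"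
  unfolding kernel_projection_def killed_generator_kernel by (rule some_equality) auto

text \<open>Both sides optimise over the same inequalities: the cutoff of any \<open>F\<close> is in
  the killed domain with total energy and \<open>L\<^sup>2\<close> norm equal to those of
  \<open>F - F a\<close> on the half-line, and conversely a killed \<open>f\<close> has
  \<open>f a = 0\<close> and its half-line energy is at most its total energy.\<close>

lemma killed_gap_eq:
  assumes e: "e = 1 \<or> e = -1"
  shows "killed_gap e a = 1 / A_const e a"
proof -
  have sq: "(\<integral>\<^sup>+x. ennreal ((f x - 0)\<^sup>2) \<partial>density m (indicator (ray e a))) = (\<integral>\<^sup>+x\<in>ray e a. ennreal ((f x)\<^sup>2) \<partial>m)"
    if "f \<in> killed_domain e a" for f
    using that form_domainD(2)[of f]
    by (subst nn_integral_density) (auto simp: killed_domain_def mult.commute)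
  have "killed_gap e a = Sup {\<gamma>. \<forall>f\<in>killed_domain e a. \<gamma> * (\<integral>\<^sup>+x\<in>ray e a. ennreal ((f x)\<^sup>2) \<partial>m) \<le> total_energy f}"
    unfolding killed_gap_def spectral_gap_def killed_kernel_projection
    by (intro arg_cong[of _ _ Sup] Collect_cong ball_cong refl)
      (simp only: sq, simp add: dirichlet_form_eq_total_energy killed_domain_def)
  also have "{\<gamma>. \<forall>f\<in>killed_domain e a. \<gamma> * (\<integral>\<^sup>+x\<in>ray e a. ennreal ((f x)\<^sup>2) \<partial>m) \<le> total_energy f}
      = {\<gamma>. \<forall>F\<in>form_domain S m. \<gamma> * osc e a F \<le> energy e a F}"
  proof (intro Collect_cong iffI ballI)
    fix \<gamma> F assume *: "\<forall>f\<in>killed_domain e a. \<gamma> * (\<integral>\<^sup>+x\<in>ray e a. ennreal ((f x)\<^sup>2) \<partial>m) \<le> total_energy f"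
      and F: "F \<in> form_domain S m"
    have "cutoff e a F \<in> killed_domain e a"
      using cutoff_form_domain(1)[OF e F] by (auto simp: killed_domain_def cutoff_def)
    moreover have "(\<integral>\<^sup>+x\<in>ray e a. ennreal ((cutoff e a F x)\<^sup>2) \<partial>m) = osc e a F"
      unfolding cutoff_osc[OF e, symmetric] by (intro nn_integral_cong) (auto simp: cutoff_def split: split_indicator)
    ultimately show "\<gamma> * osc e a F \<le> energy e a F"
      using bspec[OF *, of "cutoff e a F"] cutoff_energy[OF e F, of a] by simp
  next
    fix \<gamma> f assume *: "\<forall>F\<in>form_domain S m. \<gamma> * osc e a F \<le> energy e a F" and f: "f \<in> killed_domain e a"
    have "a \<notin> ray e a" by (simp add: ray_def)
    then have "f a = 0" using f by (simp add: killed_domain_def)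
    then have "osc e a f = (\<integral>\<^sup>+x\<in>ray e a. ennreal ((f x)\<^sup>2) \<partial>m)"
      by (simp add: osc_def cray_m_eq[OF e, of f a, unfolded \<open>f a = 0\<close> diff_zero])
    then show "\<gamma> * (\<integral>\<^sup>+x\<in>ray e a. ennreal ((f x)\<^sup>2) \<partial>m) \<le> total_energy f"
      using * f energy_le_total[of e a f] by (auto simp: killed_domain_def intro: order_trans)
  qed
  also have "Sup \<dots> = 1 / A_const e a"
    unfolding A_const_eq by (rule Sup_eq_inverse_Inf) (rule energy_finite)
  finally show ?thesis .
qed

lemma B_const_le_A_const:
  assumes e: "e = 1 \<or> e = -1"
  shows "B_const e a \<le> A_const e a"
  unfolding B_const_def A_const_eq
proof (intro SUP_least Inf_greatest)
  fix \<xi> A assume \<xi>: "\<xi> \<in> cray e a" and A: "A \<in> {A. \<forall>F\<in>form_domain S m. osc e a F \<le> A * energy e a F}"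
  show "emeasure m (ray e \<xi>) * ennreal (e * (S \<xi> - S a)) \<le> A"
  proof (cases "\<xi> \<in> ray e a")
    case False
    then have "\<xi> = a" using \<xi> e by (auto simp: ray_def cray_def)
    then show ?thesis by simp
  next
    case True
    then have pos: "0 < sig e a \<xi>" using sig_pos_iff[OF e] by simp
    \<comment> \<open>The test function is the scale distance stopped at \<open>\<xi>\<close>. Its
      energy is at most \<open>sig e a \<xi>\<close>, and it equals \<open>sig e a \<xi>\<close> on
      all of \<open>ray e \<xi>\<close>; comparing the two sides leaves one factor
      \<open>sig e a \<xi>\<close> to divide out.\<close>
    define g :: "real \<Rightarrow> real" where "g = indicator (segm e a \<xi>)"
    have [measurable]: "g \<in> borel_measurable borel" unfolding g_def by measurable
    have int: "(\<integral>\<^sup>+s. g s \<partial>\<nu>) = ennreal (sig e a \<xi>)"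
    proof -
      have "(\<integral>\<^sup>+s. g s \<partial>\<nu>) = (\<integral>\<^sup>+s. indicator {0<..<sig e a \<xi>} (sig e a s) \<partial>\<nu>)"
        by (intro nn_integral_cong)
          (auto simp: g_def indicator_def segm_iff sig_less_iff[OF e] sig_pos_iff[OF e])
      also have "\<dots> = ennreal (sig e a \<xi>)"
        using pos by (subst nn_integral_sig[OF e]) auto
      finally show ?thesis .
    qed
    have "(\<integral>\<^sup>+s. ennreal ((g s)\<^sup>2) \<partial>\<nu>) = (\<integral>\<^sup>+s. g s \<partial>\<nu>)"
      by (intro nn_integral_cong) (auto simp: g_def split: split_indicator)
    then have int2: "(\<integral>\<^sup>+s. ennreal ((g s)\<^sup>2) \<partial>\<nu>) = ennreal (sig e a \<xi>)" by (simp add: int)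
    obtain F where F: "F \<in> form_domain S m" "AE x in \<nu>. D F x = e * (indicator (ray e a) x * g x)"
      "\<And>x. x \<notin> ray e a \<Longrightarrow> F x = 0"
      "\<And>x. x \<in> ray e a \<Longrightarrow> 0 \<le> F x"
      "\<And>x. x \<in> ray e a \<Longrightarrow> ennreal (F x) = (\<integral>\<^sup>+s\<in>segm e a x. g s \<partial>\<nu>)"
      by (rule form_domain_primitive[OF e, of g a]) (auto simp: int int2, auto simp: g_def)
    have Fx: "F x = sig e a \<xi>" if x: "x \<in> ray e \<xi>" for x
    proof -
      have xa: "x \<in> ray e a" using True x e by (auto simp: ray_def)
      have "ennreal (F x) = (\<integral>\<^sup>+s\<in>segm e a x. g s \<partial>\<nu>)" by (rule F(5)[OF xa])
      also have "\<dots> = (\<integral>\<^sup>+s. g s \<partial>\<nu>)"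
        by (intro nn_integral_cong) (use x e in \<open>auto simp: g_def indicator_def segm_def ray_def\<close>)
      finally show ?thesis using F(4)[OF xa] pos by (simp add: int)
    qed
    have Fa: "F a = 0" by (rule F(3)) (simp add: ray_def)
    have "ennreal (sig e a \<xi>) * (emeasure m (ray e \<xi>) * ennreal (sig e a \<xi>)) = (\<integral>\<^sup>+x\<in>ray e \<xi>. ennreal ((sig e a \<xi>)\<^sup>2) \<partial>m)"
      using pos by (subst nn_integral_cmult_indicator) (auto simp: power2_eq_square ennreal_mult mult_ac)
    also have "\<dots> \<le> osc e a F"
      unfolding osc_def
      by (intro nn_integral_mono) (use True e in \<open>auto simp: Fx Fa cray_def ray_def split: split_indicator\<close>)
    also have "\<dots> \<le> A * energy e a F" using A F(1) by simp
    also have "\<dots> \<le> A * total_energy F" by (intro mult_left_mono energy_le_total) simp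
    also have "\<dots> \<le> A * ennreal (sig e a \<xi>)"
    proof (intro mult_left_mono)
      have "total_energy F \<le> (\<integral>\<^sup>+s. ennreal ((g s)\<^sup>2) \<partial>\<nu>)"
      unfolding total_energy_def
      by (intro nn_integral_mono_AE) (use F(2) e in \<open>auto elim!: eventually_mono simp: indicator_def\<close>)
      then show "total_energy F \<le> ennreal (sig e a \<xi>)" by (simp only: int2)
    qed simp
    finally have "ennreal (sig e a \<xi>) * (emeasure m (ray e \<xi>) * ennreal (sig e a \<xi>)) \<le> ennreal (sig e a \<xi>) * A"
      by (simp only: mult.commute[of A])
    then show ?thesis
      using pos by (subst (asm) ennreal_mult_le_mult_iff) (auto simp: sig_def)
  qed
qed

section \<open>The Poincare constant between the two half-line constants\<close>

lemma total_energy_split: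
  assumes F: "F \<in> form_domain S m"
  shows "total_energy F = energy 1 a F + energy (-1) a F"
proof -
  have [measurable]: "D F \<in> borel_measurable borel" by (rule form_domainD(3)[OF F])
  have "energy 1 a F + energy (-1) a F = (\<integral>\<^sup>+x. (ennreal ((D F x)\<^sup>2) * indicator (cray 1 a) x + ennreal ((D F x)\<^sup>2) * indicator (cray (-1) a) x) \<partial>\<nu>)"
    unfolding energy_def by (rule nn_integral_add[symmetric]) auto
  also have "\<dots> = total_energy F"
    unfolding total_energy_def
    by (intro nn_integral_cong_AE) (use AE_neq[of a] in \<open>auto elim!: eventually_mono simp: cray_def split: split_indicator\<close>)
  finally show ?thesis by simp
qed

text \<open>The point \<open>a\<close> lies in both closed half-lines and may carry mass of
  \<open>m\<close>, but the integrand is zero there.\<close>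

lemma osc_split:
  assumes F: "F \<in> form_domain S m"
  shows "(\<integral>\<^sup>+x. ennreal ((F x - F a)\<^sup>2) \<partial>m) = osc 1 a F + osc (-1) a F"
proof -
  have [measurable]: "F \<in> borel_measurable borel" by (rule form_domainD(2)[OF F])
  have "osc 1 a F + osc (-1) a F = (\<integral>\<^sup>+x. (ennreal ((F x - F a)\<^sup>2) * indicator (cray 1 a) x + ennreal ((F x - F a)\<^sup>2) * indicator (cray (-1) a) x) \<partial>m)"
    unfolding osc_def by (rule nn_integral_add[symmetric]) auto
  also have "\<dots> = (\<integral>\<^sup>+x. ennreal ((F x - F a)\<^sup>2) \<partial>m)"
    by (intro nn_integral_cong) (auto simp: cray_def split: split_indicator)
  finally show ?thesis by simp
qed

lemma m_UNIV_pos: "0 < measure m UNIV"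
proof -
  have "0 < emeasure m {0<..<1::real}" by (rule m_pos) simp
  also have "\<dots> \<le> emeasure m UNIV" by (rule emeasure_mono) auto
  finally show ?thesis by (simp add: m.emeasure_eq_measure)
qed

lemma variance_le:
  assumes "F \<in> L2 m"
  shows "(\<integral>\<^sup>+x. ennreal ((F x - normalized_mean m F)\<^sup>2) \<partial>m) \<le> (\<integral>\<^sup>+x. ennreal ((F x - c)\<^sup>2) \<partial>m)"
proof -
  have i: "integrable m F" "integrable m (\<lambda>x. (F x)\<^sup>2)"
    using L2_integrable[OF assms] assms by (auto simp: L2_def)
  let ?M = "measure m UNIV"
  have ic: "integrable m (\<lambda>x. (F x - c)\<^sup>2)" for c
    using i by (simp add: power2_diff)
  have sq: "(LINT x|m. (F x - c)\<^sup>2) = (LINT x|m. (F x)\<^sup>2) - 2 * c * (LINT x|m. F x) + c\<^sup>2 * ?M" for c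
  proof -
    have "(LINT x|m. (F x - c)\<^sup>2) = (LINT x|m. (F x)\<^sup>2 - 2 * c * F x + c\<^sup>2)"
      by (intro Bochner_Integration.integral_cong) (auto simp: power2_diff)
    then show ?thesis using i by simp
  qed
  have "(LINT x|m. F x) = normalized_mean m F * ?M"
    using m_UNIV_pos by (simp add: normalized_mean_def)
  then have "(LINT x|m. (F x - c)\<^sup>2) - (LINT x|m. (F x - normalized_mean m F)\<^sup>2) = (c - normalized_mean m F)\<^sup>2 * ?M"
    unfolding sq by (simp add: power2_eq_square algebra_simps)
  moreover have "0 \<le> (c - normalized_mean m F)\<^sup>2 * ?M" by simp
  ultimately have "(LINT x|m. (F x - normalized_mean m F)\<^sup>2) \<le> (LINT x|m. (F x - c)\<^sup>2)" by linarith
  then show ?thesis by (simp add: nn_integral_eq_integral[OF ic])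
qed

lemma poincare_const_eq:
  "poincare_const S m = Inf {c. \<forall>F\<in>form_domain S m.
     (\<integral>\<^sup>+x. ennreal ((F x - normalized_mean m F)\<^sup>2) \<partial>m) \<le> c * total_energy F}"
  by (simp add: poincare_const_def total_energy_def)

lemma poincare_const_le_max: "poincare_const S m \<le> max (A_const 1 a) (A_const (-1) a)"
proof (cases "max (A_const 1 a) (A_const (-1) a) = \<top>")
  case False
  then have fin: "A_const 1 a < \<top>" "A_const (-1) a < \<top>" by (auto simp: less_top max_def split: if_splits)
  show ?thesis
    unfolding poincare_const_eq
  proof (intro Inf_lower CollectI ballI)
    fix F assume F: "F \<in> form_domain S m"
    let ?M = "max (A_const 1 a) (A_const (-1) a)"
    have "(\<integral>\<^sup>+x. ennreal ((F x - normalized_mean m F)\<^sup>2) \<partial>m) \<le> osc 1 a F + osc (-1) a F"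
      using variance_le[of F "F a"] F unfolding osc_split[OF F] by (simp add: form_domain_def)
    also have "\<dots> \<le> A_const 1 a * energy 1 a F + A_const (-1) a * energy (-1) a F"
      by (intro add_mono osc_le_A_const F fin)
    also have "\<dots> \<le> ?M * energy 1 a F + ?M * energy (-1) a F"
      by (intro add_mono mult_right_mono) auto
    also have "\<dots> = ?M * total_energy F"
      by (simp add: total_energy_split[OF F, of a] distrib_left)
    finally show "(\<integral>\<^sup>+x. ennreal ((F x - normalized_mean m F)\<^sup>2) \<partial>m) \<le> ?M * total_energy F" .
  qed
qed simp

text \<open>If an admissible \<open>c\<close> were below both constants, each side of
  \<open>a\<close> would carry a function violating the Hardy inequality with constant
  \<open>c\<close>. Their supports are disjoint, so norms and energies of linear combinations add
  without cross terms and every nonzero combination still violates the inequality; in this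
  two-dimensional space one has mean zero.\<close>

lemma min_le_poincare_const: "min (A_const 1 a) (A_const (-1) a) \<le> poincare_const S m"
  unfolding poincare_const_eq
proof (rule Inf_greatest, rule ccontr)
  fix c assume c: "c \<in> {c. \<forall>F\<in>form_domain S m. (\<integral>\<^sup>+x. ennreal ((F x - normalized_mean m F)\<^sup>2) \<partial>m) \<le> c * total_energy F}"
  assume "\<not> min (A_const 1 a) (A_const (-1) a) \<le> c"
  then have lt: "c < A_const 1 a" "c < A_const (-1) a" by (auto simp: not_le)
  have "c < \<top>" using lt(1) top_greatest by (rule less_le_trans)
  then obtain r where r: "c = ennreal r" "0 \<le> r" by (cases c) auto
  have ex: "\<exists>f. f \<in> form_domain S m \<and> (\<forall>x. x \<notin> ray e a \<longrightarrow> f x = 0)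
      \<and> (AE x in \<nu>. x \<notin> ray e a \<longrightarrow> D f x = 0) \<and> r * (LINT x|\<nu>. (D f x)\<^sup>2) < (LINT x|m. (f x)\<^sup>2)"
    if e: "e = 1 \<or> e = -1" and lt: "c < A_const e a" for e
  proof -
    have "c \<notin> {A. \<forall>F\<in>form_domain S m. osc e a F \<le> A * energy e a F}"
      using lt unfolding A_const_eq by (meson Inf_lower leD)
    then obtain F where F: "F \<in> form_domain S m" and Flt: "c * energy e a F < osc e a F" by (auto simp: not_le)
    let ?f = "cutoff e a F"
    note f = cutoff_form_domain[OF e F, of a]
    have "ennreal (LINT x|\<nu>. (D ?f x)\<^sup>2) = energy e a F"
      unfolding cutoff_energy[OF e F, symmetric] total_energy_def
      by (rule nn_integral_eq_integral[symmetric]) (use form_domainD(5)[OF f(1)] in auto)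
    moreover have "ennreal (LINT x|m. (?f x)\<^sup>2) = osc e a F"
      unfolding cutoff_osc[OF e, symmetric]
      by (rule nn_integral_eq_integral[symmetric]) (use form_domainD(4)[OF f(1)] in auto)
    ultimately have "ennreal (r * (LINT x|\<nu>. (D ?f x)\<^sup>2)) < ennreal (LINT x|m. (?f x)\<^sup>2)"
      using Flt r by (simp add: ennreal_mult')
    then have "r * (LINT x|\<nu>. (D ?f x)\<^sup>2) < (LINT x|m. (?f x)\<^sup>2)"
      using r(2) by (subst (asm) ennreal_less_iff) auto
    then show ?thesis using f by (intro exI[of _ ?f]) (auto simp: cutoff_def elim!: eventually_mono)
  qed
  obtain f where f: "f \<in> form_domain S m" "\<And>x. x \<notin> ray 1 a \<Longrightarrow> f x = 0"
      "AE x in \<nu>. x \<notin> ray 1 a \<longrightarrow> D f x = 0" "r * (LINT x|\<nu>. (D f x)\<^sup>2) < (LINT x|m. (f x)\<^sup>2)"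
    using ex[OF _ lt(1)] by auto
  obtain g where g: "g \<in> form_domain S m" "\<And>x. x \<notin> ray (-1) a \<Longrightarrow> g x = 0"
      "AE x in \<nu>. x \<notin> ray (-1) a \<longrightarrow> D g x = 0" "r * (LINT x|\<nu>. (D g x)\<^sup>2) < (LINT x|m. (g x)\<^sup>2)"
    using ex[OF _ lt(2)] by auto
  \<comment> \<open>One linear condition on two coefficients: the pair
    \<open>(\<integral>g, -\<integral>f)\<close> solves it, unless both integrals vanish, when any
    nonzero pair does.\<close>
  obtain p q :: real where pq: "p * (LINT x|m. f x) + q * (LINT x|m. g x) = 0" "p \<noteq> 0 \<or> q \<noteq> 0"
  proof (cases "(LINT x|m. f x) = 0 \<and> (LINT x|m. g x) = 0")
    case True then show ?thesis using that[of 1 1] by simp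
  next
    case False then show ?thesis using that[of "LINT x|m. g x" "- (LINT x|m. f x)"] by auto
  qed
  define h where "h = (\<lambda>x. p * f x + q * g x + 0)"
  note h = form_domain_lin[OF f(1) g(1), of p q 0, folded h_def]
  have fg: "integrable m f" "integrable m g"
    using f(1) g(1) by (auto intro!: L2_integrable simp: form_domain_def)
  have "normalized_mean m h = 0"
    using pq(1) fg by (simp add: normalized_mean_def h_def)
  moreover have "(\<integral>\<^sup>+x. ennreal ((h x)\<^sup>2) \<partial>m) = ennreal (p\<^sup>2 * (LINT x|m. (f x)\<^sup>2) + q\<^sup>2 * (LINT x|m. (g x)\<^sup>2))"
  proof -
    have "(h x)\<^sup>2 = p\<^sup>2 * (f x)\<^sup>2 + q\<^sup>2 * (g x)\<^sup>2" for x
      using f(2)[of x] g(2)[of x] by (cases "x \<in> ray 1 a") (auto simp: h_def power_mult_distrib ray_def)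
    then have "(\<integral>\<^sup>+x. ennreal ((h x)\<^sup>2) \<partial>m) = (\<integral>\<^sup>+x. ennreal (p\<^sup>2 * (f x)\<^sup>2 + q\<^sup>2 * (g x)\<^sup>2) \<partial>m)" by simp
    also have "\<dots> = ennreal (LINT x|m. p\<^sup>2 * (f x)\<^sup>2 + q\<^sup>2 * (g x)\<^sup>2)"
      by (rule nn_integral_eq_integral) (use form_domainD(4)[OF f(1)] form_domainD(4)[OF g(1)] in auto)
    finally show ?thesis using form_domainD(4)[OF f(1)] form_domainD(4)[OF g(1)] by simp
  qed
  moreover have "total_energy h = ennreal (p\<^sup>2 * (LINT x|\<nu>. (D f x)\<^sup>2) + q\<^sup>2 * (LINT x|\<nu>. (D g x)\<^sup>2))"
  proof -
    have "AE x in \<nu>. (D h x)\<^sup>2 = p\<^sup>2 * (D f x)\<^sup>2 + q\<^sup>2 * (D g x)\<^sup>2"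
      using h(2) f(3) g(3)
    proof eventually_elim
      case (elim x)
      have "x \<notin> ray 1 a \<or> x \<notin> ray (-1) a" by (auto simp: ray_def)
      then show ?case using elim by (auto simp: power_mult_distrib)
    qed
    then have "total_energy h = (\<integral>\<^sup>+x. ennreal (p\<^sup>2 * (D f x)\<^sup>2 + q\<^sup>2 * (D g x)\<^sup>2) \<partial>\<nu>)"
      unfolding total_energy_def by (intro nn_integral_cong_AE) (auto elim!: eventually_mono)
    also have "\<dots> = ennreal (LINT x|\<nu>. p\<^sup>2 * (D f x)\<^sup>2 + q\<^sup>2 * (D g x)\<^sup>2)"
      by (rule nn_integral_eq_integral) (use form_domainD(5)[OF f(1)] form_domainD(5)[OF g(1)] in auto)
    finally show ?thesis using form_domainD(5)[OF f(1)] form_domainD(5)[OF g(1)] by simp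
  qed
  moreover have "(\<integral>\<^sup>+x. ennreal ((h x - normalized_mean m h)\<^sup>2) \<partial>m) \<le> c * total_energy h"
    using c h(1) by blast
  ultimately have "ennreal (p\<^sup>2 * (LINT x|m. (f x)\<^sup>2) + q\<^sup>2 * (LINT x|m. (g x)\<^sup>2)) \<le> ennreal (r * (p\<^sup>2 * (LINT x|\<nu>. (D f x)\<^sup>2) + q\<^sup>2 * (LINT x|\<nu>. (D g x)\<^sup>2)))"
    using r by (simp add: ennreal_mult')
  then have le: "p\<^sup>2 * (LINT x|m. (f x)\<^sup>2) + q\<^sup>2 * (LINT x|m. (g x)\<^sup>2) \<le> r * (p\<^sup>2 * (LINT x|\<nu>. (D f x)\<^sup>2) + q\<^sup>2 * (LINT x|\<nu>. (D g x)\<^sup>2))"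
    by (subst (asm) ennreal_le_iff) (use r(2) in auto)
  have "0 < p\<^sup>2 * ((LINT x|m. (f x)\<^sup>2) - r * (LINT x|\<nu>. (D f x)\<^sup>2)) + q\<^sup>2 * ((LINT x|m. (g x)\<^sup>2) - r * (LINT x|\<nu>. (D g x)\<^sup>2))"
  proof -
    have "0 \<le> p\<^sup>2 * ((LINT x|m. (f x)\<^sup>2) - r * (LINT x|\<nu>. (D f x)\<^sup>2))"
      "0 \<le> q\<^sup>2 * ((LINT x|m. (g x)\<^sup>2) - r * (LINT x|\<nu>. (D g x)\<^sup>2))"
      using f(4) g(4) by auto
    moreover have "0 < p\<^sup>2 * ((LINT x|m. (f x)\<^sup>2) - r * (LINT x|\<nu>. (D f x)\<^sup>2))" if "p \<noteq> 0"
      using f(4) that by simp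
    moreover have "0 < q\<^sup>2 * ((LINT x|m. (g x)\<^sup>2) - r * (LINT x|\<nu>. (D g x)\<^sup>2))" if "q \<noteq> 0"
      using g(4) that by simp
    ultimately show ?thesis using pq(2) by linarith
  qed
  then show False using le by (simp add: algebra_simps)
qed

section \<open>Kernel and spectral gap of the form on the whole line\<close>

lemma generator_kernel_eq:
  "generator_kernel m (form_domain S m) (dirichlet_form S) = range (\<lambda>c _. c)"
proof (intro equalityI subsetI)
  fix f assume "f \<in> generator_kernel m (form_domain S m) (dirichlet_form S)"
  then have f: "f \<in> form_domain S m" and "\<forall>h\<in>form_domain S m. dirichlet_form S f h = 0"
    unfolding generator_kernel_def form_generator_def mem_Collect_eq by simp_all
  then have "dirichlet_form S f f = 0" by blast
  then have "f = (\<lambda>_. f 0)" using const_if_form_zero[OF f] by auto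
  then show "f \<in> range (\<lambda>c _. c)" by blast
next
  fix f :: "real \<Rightarrow> real" assume "f \<in> range (\<lambda>c _. c)"
  then obtain c where f: "f = (\<lambda>_. c)" by blast
  have "dirichlet_form S f h = 0" for h
    unfolding f by (rule dirichlet_form_zero_left) (rule const_form_domain)
  moreover have "f \<in> form_domain S m"
    unfolding f by (rule const_form_domain)
  ultimately show "f \<in> generator_kernel m (form_domain S m) (dirichlet_form S)"
    unfolding generator_kernel_def form_generator_def mem_Collect_eq using zero_L2 by simp
qed

text \<open>Every candidate is a constant function, since the kernel consists of constants, and
  orthogonality to the constant 1 forces that constant to be the mean because \<open>m\<close> has
  positive total mass.\<close>

lemma kernel_projection_eq:
  assumes "f \<in> form_domain S m"
  shows "kernel_projection m (form_domain S m) (dirichlet_form S) f = (\<lambda>_. normalized_mean m f)"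
  unfolding kernel_projection_def generator_kernel_eq
proof (rule some_equality)
  have i: "integrable m f" using assms by (auto intro!: L2_integrable simp: form_domain_def)
  have eq: "(LINT x|m. (f x - k) * c) = c * (normalized_mean m f - k) * measure m UNIV" for k c
    using i m_UNIV_pos by (simp add: normalized_mean_def field_simps)
  show "(\<lambda>_. normalized_mean m f) \<in> range (\<lambda>c _. c) \<and>
      (\<forall>h\<in>range (\<lambda>c _. c). (LINT x|m. (f x - normalized_mean m f) * h x) = 0)"
    using eq[of "normalized_mean m f" 1] by auto
  fix k assume k: "k \<in> range (\<lambda>c _. c) \<and> (\<forall>h\<in>range (\<lambda>c _. c). (LINT x|m. (f x - k x) * h x) = 0)"
  then obtain c where c: "k = (\<lambda>_. c)" by blast
  have "(LINT x|m. (f x - c) * 1) = 0" using k unfolding c by (auto dest!: bspec[of _ _ "\<lambda>_. 1"])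
  then show "k = (\<lambda>_. normalized_mean m f)" unfolding c eq using m_UNIV_pos by auto
qed

lemma gap_eq: "gap S m = 1 / poincare_const S m"
proof -
  have "gap S m = Sup {\<gamma>. \<forall>f\<in>form_domain S m. \<gamma> * (\<integral>\<^sup>+x. ennreal ((f x - normalized_mean m f)\<^sup>2) \<partial>m) \<le> total_energy f}"
    unfolding gap_def spectral_gap_def
    by (intro arg_cong[of _ _ Sup] Collect_cong ball_cong refl)
      (simp add: dirichlet_form_eq_total_energy kernel_projection_eq)
  also have "\<dots> = 1 / poincare_const S m"
    unfolding poincare_const_eq by (rule Sup_eq_inverse_Inf) (rule total_energy_finite)
  finally show ?thesis .
qed

end

section \<open>The Green operator of a half-line\<close>

lemma ennreal_le_if_power2_le:
  fixes x :: ennreal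
  assumes "x\<^sup>2 \<le> (ennreal r)\<^sup>2" "0 \<le> r"
  shows "x \<le> ennreal r"
proof (cases x)
  case (real y)
  then have "ennreal (y\<^sup>2) \<le> ennreal (r\<^sup>2)" using assms by (simp add: ennreal_power)
  then have "y\<^sup>2 \<le> r\<^sup>2" by (subst (asm) ennreal_le_iff) auto
  then have "y \<le> r" using assms(2) by (rule power2_le_imp_le)
  then show ?thesis using real by (simp add: ennreal_leI)
next
  case top
  then show ?thesis using assms by (simp add: ennreal_power top_unique)
qed

context scale_speed
begin

text \<open>The kernel \<open>min (sig e a x) (sig e a y)\<close> is the limit of the Green
  functions of bounded intervals with one end at \<open>a\<close> when the other end goes to
  infinity.\<close>

definition green_op :: "real \<Rightarrow> real \<Rightarrow> (real \<Rightarrow> ennreal) \<Rightarrow> real \<Rightarrow> ennreal" where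
  "green_op e a h x = (\<integral>\<^sup>+y\<in>ray e a. ennreal (min (sig e a x) (sig e a y)) * h y \<partial>m)"

primrec green_iter :: "real \<Rightarrow> real \<Rightarrow> nat \<Rightarrow> real \<Rightarrow> ennreal" where
  "green_iter e a 0 = (\<lambda>_. 1)"
| "green_iter e a (Suc n) = green_op e a (green_iter e a n)"

lemma green_op_borel [measurable]:
  "h \<in> borel_measurable borel \<Longrightarrow> green_op e a h \<in> borel_measurable borel"
proof -
  assume [measurable]: "h \<in> borel_measurable borel"
  have "(\<lambda>x. \<integral>\<^sup>+y. ennreal (min (sig e a x) (sig e a y)) * (h y * indicator (ray e a) y) \<partial>m) \<in> borel_measurable borel"
    by measurable
  then show ?thesis by (simp add: green_op_def[abs_def] mult.assoc)
qed

lemma green_iter_borel [measurable]: "green_iter e a n \<in> borel_measurable borel"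
  by (induction n) auto

lemma tail_borel [measurable]:
  assumes [measurable]: "h \<in> borel_measurable borel"
  shows "(\<lambda>s. \<integral>\<^sup>+y\<in>ray e s. h y \<partial>m) \<in> borel_measurable borel"
proof -
  have "(\<lambda>s. \<integral>\<^sup>+y. (if 0 < e * (y - s) then h y else 0) \<partial>m) \<in> borel_measurable borel"
    by measurable
  also have "(\<lambda>s. \<integral>\<^sup>+y. (if 0 < e * (y - s) then h y else 0) \<partial>m) = (\<lambda>s. \<integral>\<^sup>+y\<in>ray e s. h y \<partial>m)"
    by (intro ext nn_integral_cong) (auto simp: ray_def)
  finally show ?thesis .
qed

lemma segm_integral_borel [measurable]:
  assumes [measurable]: "h \<in> borel_measurable borel"
  shows "(\<lambda>x. \<integral>\<^sup>+s\<in>segm e a x. h s \<partial>\<nu>) \<in> borel_measurable borel"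
proof -
  have "(\<lambda>x. \<integral>\<^sup>+s. (if 0 < e * (s - a) \<and> 0 < e * (x - s) then h s else 0) \<partial>\<nu>) \<in> borel_measurable borel"
    by measurable
  also have "(\<lambda>x. \<integral>\<^sup>+s. (if 0 < e * (s - a) \<and> 0 < e * (x - s) then h s else 0) \<partial>\<nu>) = (\<lambda>x. \<integral>\<^sup>+s\<in>segm e a x. h s \<partial>\<nu>)"
    by (intro ext nn_integral_cong) (auto simp: segm_def)
  finally show ?thesis .
qed

text \<open>The kernel is the \<open>dS\<close>-mass of the intersection of the two segments from
  \<open>a\<close> to \<open>x\<close> and from \<open>a\<close> to \<open>y\<close>; Tonelli then
  factors the operator as a primitive applied to a tail integral, the form used for both Schur
  weights and adjoints.\<close>

lemma green_op_eq:
  assumes e: "e = 1 \<or> e = -1" and [measurable]: "h \<in> borel_measurable borel" and x: "x \<in> ray e a"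
  shows "green_op e a h x = (\<integral>\<^sup>+s\<in>segm e a x. (\<integral>\<^sup>+y\<in>ray e s. h y \<partial>m) \<partial>\<nu>)"
proof -
  interpret pair_sigma_finite \<nu> m ..
  have "(\<integral>\<^sup>+s\<in>segm e a x. (\<integral>\<^sup>+y\<in>ray e s. h y \<partial>m) \<partial>\<nu>)
      = (\<integral>\<^sup>+s. (\<integral>\<^sup>+y. (if s \<in> segm e a x \<and> s \<in> segm e a y then h y else 0) \<partial>m) \<partial>\<nu>)"
    by (intro nn_integral_cong) (auto intro!: nn_integral_cong simp: segm_iff indicator_def)
  also have "\<dots> = (\<integral>\<^sup>+y. (\<integral>\<^sup>+s. (if s \<in> segm e a x \<and> s \<in> segm e a y then h y else 0) \<partial>\<nu>) \<partial>m)"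
    by (rule Fubini'[symmetric]) measurable
  also have "\<dots> = green_op e a h x"
    unfolding green_op_def
  proof (intro nn_integral_cong)
    fix y
    have "(\<integral>\<^sup>+s. (if s \<in> segm e a x \<and> s \<in> segm e a y then h y else 0) \<partial>\<nu>)
        = (\<integral>\<^sup>+s. h y * indicator {0<..<min (sig e a x) (sig e a y)} (sig e a s) \<partial>\<nu>)"
      by (intro nn_integral_cong)
        (auto simp: segm_iff indicator_def sig_less_iff[OF e] sig_pos_iff[OF e])
    also have "\<dots> = (\<integral>\<^sup>+t. h y * indicator {0<..<min (sig e a x) (sig e a y)} t \<partial>lborel)"
      by (rule nn_integral_sig[OF e]) measurable
    also have "\<dots> = h y * emeasure lborel {0<..<min (sig e a x) (sig e a y)}"
      by (rule nn_integral_cmult_indicator) simp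
    also have "\<dots> = ennreal (min (sig e a x) (sig e a y)) * h y * indicator (ray e a) y"
    proof (cases "y \<in> ray e a")
      case True
      then show ?thesis using x sig_pos_iff[OF e, of a x] sig_pos_iff[OF e, of a y] by (simp add: mult.commute)
    next
      case False
      then show ?thesis using sig_pos_iff[OF e, of a y] by simp
    qed
    finally show "(\<integral>\<^sup>+s. (if s \<in> segm e a x \<and> s \<in> segm e a y then h y else 0) \<partial>\<nu>) = ennreal (min (sig e a x) (sig e a y)) * h y * indicator (ray e a) y" .
  qed
  finally show ?thesis by simp
qed

lemma ray_measure_pos:
  assumes e: "e = 1 \<or> e = -1"
  shows "0 < emeasure m (ray e s)"
proof -
  have "0 < emeasure m {min s (s + e)<..<max s (s + e)}" using e by (intro m_pos) auto
  also have "\<dots> \<le> emeasure m (ray e s)"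
    by (rule emeasure_mono) (use e in \<open>auto simp: ray_def\<close>)
  finally show ?thesis .
qed

text \<open>The Neumann series of the inverse of \<open>1 - l G\<close>, applied to the constant
  1.\<close>

definition exp_series :: "real \<Rightarrow> real \<Rightarrow> real \<Rightarrow> real \<Rightarrow> ennreal" where
  "exp_series l e a x = (\<Sum>n. ennreal (l ^ n) * green_iter e a n x)"

lemma exp_series_borel [measurable]: "exp_series l e a \<in> borel_measurable borel"
  unfolding exp_series_def by measurable

lemma exp_series_head:
  "exp_series l e a x = 1 + (\<Sum>n. ennreal (l ^ Suc n) * green_iter e a (Suc n) x)"
  unfolding exp_series_def by (subst suminf_offset[where i = 1]) (auto simp: add.commute)

text \<open>All terms are nonnegative, so summation and integration commute and the identity holds
  in the extended half-line, before any convergence is known.\<close>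

lemma exp_series_eq:
  assumes "0 \<le> l"
  shows "exp_series l e a x = 1 + ennreal l * green_op e a (exp_series l e a) x"
proof -
  have "exp_series l e a x = 1 + (\<Sum>n. ennreal (l ^ Suc n) * green_iter e a (Suc n) x)"
    by (rule exp_series_head)
  also have "(\<Sum>n. ennreal (l ^ Suc n) * green_iter e a (Suc n) x) = ennreal l * (\<Sum>n. ennreal (l ^ n) * green_iter e a (Suc n) x)"
    using assms by (simp add: ennreal_mult mult.assoc)
  also have "(\<Sum>n. ennreal (l ^ n) * green_iter e a (Suc n) x) = green_op e a (exp_series l e a) x"
  proof -
    have "green_op e a (exp_series l e a) x
        = (\<integral>\<^sup>+y. (\<Sum>n. ennreal (l ^ n) * (ennreal (min (sig e a x) (sig e a y)) * green_iter e a n y * indicator (ray e a) y)) \<partial>m)"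
      unfolding green_op_def exp_series_def
      by (intro nn_integral_cong) (simp add: mult_ac flip: ennreal_suminf_cmult)
    also have "\<dots> = (\<Sum>n. \<integral>\<^sup>+y. ennreal (l ^ n) * (ennreal (min (sig e a x) (sig e a y)) * green_iter e a n y * indicator (ray e a) y) \<partial>m)"
      by (rule nn_integral_suminf) measurable
    also have "\<dots> = (\<Sum>n. ennreal (l ^ n) * green_iter e a (Suc n) x)"
      by (simp add: green_op_def nn_integral_cmult)
    finally show ?thesis by simp
  qed
  finally show ?thesis .
qed

text \<open>The finite solution \<open>u\<close> of \<open>u = 1 + l G u\<close> is a positive supersolution: the Schur test with
  weights \<open>u - 1\<close> and its \<open>dS\<close>-derivative gives the Hardy inequality with constant \<open>1/l\<close>.\<close>

lemma A_const_le_if_exp_series_finite: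
  assumes e: "e = 1 \<or> e = -1" and l: "0 < l" and fin: "\<And>x. x \<in> ray e a \<Longrightarrow> exp_series l e a x < \<top>"
  shows "A_const e a \<le> ennreal (1 / l)"
proof -
  let ?u = "exp_series l e a"
  \<comment> \<open>By \<open>green_op_eq\<close>, \<open>v\<close> is the
    \<open>dS\<close>-derivative of \<open>G u\<close> up to the sign \<open>e\<close>, so
    \<open>l * v\<close> is the Schur weight whose primitive is
    \<open>l G u = u - 1\<close>.\<close>
  define v where "v s = (\<integral>\<^sup>+y\<in>ray e s. ?u y \<partial>m)" for s
  have [measurable]: "v \<in> borel_measurable borel" unfolding v_def by measurable
  have u: "?u x = 1 + ennreal l * green_op e a ?u x" for x by (rule exp_series_eq) (use l in simp)
  have u1: "1 \<le> ?u x" for x by (subst u) simp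
  \<comment> \<open>Beyond \<open>s\<close> the kernel at \<open>s\<close> is constant, equal to
    \<open>sig e a s > 0\<close>; a finite value of \<open>G u\<close> at the single point
    \<open>s\<close> therefore bounds the tail integral.\<close>
  have vfin: "v s < \<top>" if s: "s \<in> ray e a" for s
  proof -
    have s0: "0 < sig e a s" using s sig_pos_iff[OF e] by simp
    have "ennreal (sig e a s) * v s = (\<integral>\<^sup>+y\<in>ray e s. ennreal (sig e a s) * ?u y \<partial>m)"
      unfolding v_def by (subst nn_integral_cmult[symmetric]) (auto simp: mult.assoc)
    also have "\<dots> \<le> green_op e a ?u s"
      unfolding green_op_def
    proof (intro nn_integral_mono)
      fix y
      show "ennreal (sig e a s) * ?u y * indicator (ray e s) y \<le> ennreal (min (sig e a s) (sig e a y)) * ?u y * indicator (ray e a) y"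
      proof (cases "y \<in> ray e s")
        case True
        then have "sig e a s < sig e a y" "y \<in> ray e a"
          using sig_less_iff[OF e, of a s y] s e by (auto simp: ray_def)
        then show ?thesis using True by simp
      qed simp
    qed
    finally have le: "ennreal (sig e a s) * v s \<le> green_op e a ?u s" .
    have "ennreal l * green_op e a ?u s < \<top>" using fin[OF s] by (subst (asm) u) simp
    then have "green_op e a ?u s < \<top>" using l by (auto simp: ennreal_mult_less_top)
    with le have "ennreal (sig e a s) * v s < \<top>" by (rule le_less_trans)
    then show ?thesis using s0 by (auto simp: ennreal_mult_less_top)
  qed
  have vpos: "0 < v s" for s
  proof -
    have "0 < emeasure m (ray e s)" by (rule ray_measure_pos[OF e])
    also have "\<dots> = (\<integral>\<^sup>+y\<in>ray e s. 1 \<partial>m)" by simp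
    also have "\<dots> \<le> v s" unfolding v_def by (intro nn_integral_mono mult_right_mono u1) simp
    finally show ?thesis .
  qed
  have ev: "ennreal (enn2real (v s)) = v s" if "s \<in> ray e a" for s using vfin[OF that] by simp
  show ?thesis
  proof (rule A_const_le_Schur[OF e, where p = "\<lambda>s. l * enn2real (v s)" and q = "\<lambda>x. ennreal l * green_op e a ?u x"])
    fix s assume s: "s \<in> ray e a"
    show "0 < l * enn2real (v s)" using l vfin[OF s] vpos[of s] by (simp add: enn2real_positive_iff)
    have "(\<integral>\<^sup>+x\<in>ray e s. ennreal l * green_op e a ?u x \<partial>m) \<le> v s"
      unfolding v_def
    \<comment> \<open>Dropping the 1 in \<open>u = 1 + l G u\<close> is the supersolution property;
      it makes the Schur constant \<open>1 / l\<close>.\<close>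
    proof (intro nn_integral_mono mult_right_mono)
      show "ennreal l * green_op e a ?u x \<le> ?u x" for x by (subst u[of x]) simp
    qed simp
    also have "v s = ennreal (1 / l) * ennreal (l * enn2real (v s))"
      using l ev[OF s] by (simp add: ennreal_mult[symmetric])
    finally show "(\<integral>\<^sup>+x\<in>ray e s. ennreal l * green_op e a ?u x \<partial>m) \<le> ennreal (1 / l) * ennreal (l * enn2real (v s))" .
  next
    fix x assume x: "x \<in> ray e a"
    have "(\<integral>\<^sup>+s\<in>segm e a x. ennreal (l * enn2real (v s)) \<partial>\<nu>) = (\<integral>\<^sup>+s. ennreal l * (v s * indicator (segm e a x) s) \<partial>\<nu>)"
      by (intro nn_integral_cong) (use ev l in \<open>auto simp: ennreal_mult segm_iff indicator_def\<close>)
    also have "\<dots> = ennreal l * (\<integral>\<^sup>+s\<in>segm e a x. v s \<partial>\<nu>)"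
      by (rule nn_integral_cmult) measurable
    also have "\<dots> = ennreal l * green_op e a ?u x"
      unfolding v_def by (subst green_op_eq[OF e _ x]) auto
    finally show "(\<integral>\<^sup>+s\<in>segm e a x. ennreal (l * enn2real (v s)) \<partial>\<nu>) \<le> ennreal l * green_op e a ?u x" by simp
  qed measurable
qed

lemma integral_ray_power2_le:
  assumes [measurable]: "h \<in> borel_measurable borel"
  shows "(\<integral>\<^sup>+y\<in>ray e a. h y \<partial>m)\<^sup>2 \<le> emeasure m (ray e a) * (\<integral>\<^sup>+y\<in>ray e a. (h y)\<^sup>2 \<partial>m)"
proof -
  have "(\<integral>\<^sup>+y\<in>ray e a. h y \<partial>m) = (\<integral>\<^sup>+y. indicator (ray e a) y * (h y * indicator (ray e a) y) \<partial>m)"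
    by (intro nn_integral_cong) (auto split: split_indicator)
  then have "(\<integral>\<^sup>+y\<in>ray e a. h y \<partial>m)\<^sup>2 \<le> (\<integral>\<^sup>+y. (indicator (ray e a) y)\<^sup>2 \<partial>m) * (\<integral>\<^sup>+y. (h y * indicator (ray e a) y)\<^sup>2 \<partial>m)"
    using Cauchy_Schwarz_nn_integral[of "indicator (ray e a)" m "\<lambda>y. h y * indicator (ray e a) y"] by simp
  moreover have "(\<integral>\<^sup>+y. (indicator (ray e a) y :: ennreal)\<^sup>2 \<partial>m) = (\<integral>\<^sup>+y. indicator (ray e a) y \<partial>m)"
    by (intro nn_integral_cong) (auto split: split_indicator)
  moreover have "(\<integral>\<^sup>+y. (h y * indicator (ray e a) y)\<^sup>2 \<partial>m) = (\<integral>\<^sup>+y\<in>ray e a. (h y)\<^sup>2 \<partial>m)"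
    by (intro nn_integral_cong) (auto split: split_indicator)
  ultimately show ?thesis by simp
qed

lemma osc_finite: "e = 1 \<or> e = -1 \<Longrightarrow> F \<in> form_domain S m \<Longrightarrow> osc e a F < \<top>"
proof -
  assume e: "e = 1 \<or> e = -1" and F: "F \<in> form_domain S m"
  have "integrable m (\<lambda>x. (cutoff e a F x)\<^sup>2)"
    by (rule form_domainD(4)[OF cutoff_form_domain(1)[OF e F]])
  then have "(\<integral>\<^sup>+x. ennreal ((cutoff e a F x)\<^sup>2) \<partial>m) < \<top>"
    by (subst nn_integral_eq_integral) auto
  then show ?thesis by (simp add: cutoff_osc[OF e])
qed

text \<open>With \<open>K f(x) = \<integral>\<^sub>a\<^sup>x f dS\<close> the Green operator is \<open>K K*\<close>, and the Hardy constant is the square of the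
  norm of \<open>K\<close>. The truncation of \<open>K* h\<close> keeps the test function inside the form domain.\<close>

lemma green_op_L2_bound:
  assumes e: "e = 1 \<or> e = -1" and [measurable]: "h \<in> borel_measurable borel"
    and H: "(\<integral>\<^sup>+y\<in>ray e a. (h y)\<^sup>2 \<partial>m) < \<top>" and A: "A_const e a < \<top>"
  shows "(\<integral>\<^sup>+x\<in>ray e a. (green_op e a h x)\<^sup>2 \<partial>m) \<le> (A_const e a)\<^sup>2 * (\<integral>\<^sup>+y\<in>ray e a. (h y)\<^sup>2 \<partial>m)"
proof -
  let ?H = "\<integral>\<^sup>+y\<in>ray e a. (h y)\<^sup>2 \<partial>m" and ?A = "A_const e a"
  define v where "v s = (\<integral>\<^sup>+y\<in>ray e s. h y \<partial>m)" for s
  have [measurable]: "v \<in> borel_measurable borel" unfolding v_def by measurable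
  have "(\<integral>\<^sup>+y\<in>ray e a. h y \<partial>m)\<^sup>2 < \<top>"
    by (rule le_less_trans[OF integral_ray_power2_le])
      (use H in \<open>auto simp: ennreal_mult_less_top m.emeasure_eq_measure\<close>)
  then have I: "(\<integral>\<^sup>+y\<in>ray e a. h y \<partial>m) < \<top>" by (auto simp: power2_eq_square ennreal_mult_less_top)
  then obtain i where i: "(\<integral>\<^sup>+y\<in>ray e a. h y \<partial>m) = ennreal i" "0 \<le> i" by (cases "\<integral>\<^sup>+y\<in>ray e a. h y \<partial>m") auto
  have vle: "v s \<le> ennreal i" if "s \<in> ray e a" for s
    unfolding v_def i(1)[symmetric]
    by (intro nn_integral_mono) (use that e in \<open>auto simp: ray_def split: split_indicator\<close>)
  have ev: "ennreal (enn2real (v s)) = v s" if "s \<in> ray e a" for s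
    using vle[OF that] by (simp add: le_less_trans)
  \<comment> \<open>The truncation points go to infinity inside the half-line. Between
    \<open>a\<close> and each of them \<open>v\<close> is bounded and the \<open>dS\<close>-length
    is finite, so the truncated \<open>v\<close> is integrable and square integrable.\<close>
  define \<xi> where "\<xi> n = a + e * real (Suc n)" for n
  have \<xi>: "\<xi> n \<in> ray e a" for n using e by (auto simp: \<xi>_def ray_def)
  define g where "g n s = enn2real (v s) * indicator (segm e a (\<xi> n)) s" for n s
  have [measurable]: "g n \<in> borel_measurable borel" for n unfolding g_def by measurable
  have g0: "0 \<le> g n s" for n s by (simp add: g_def)
  have gv: "ennreal (g n s) = v s * indicator (segm e a (\<xi> n)) s" for n s
    using ev[of s] by (auto simp: g_def segm_iff indicator_def)
  have gle: "g n s \<le> i * indicator (segm e a (\<xi> n)) s" for n s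
    using vle[of s] i(2) by (auto simp: g_def segm_iff indicator_def enn2real_leI)
  have len: "(\<integral>\<^sup>+s. ennreal (c * indicator (segm e a (\<xi> n)) s) \<partial>\<nu>) < \<top>" for c n
  proof -
    have "(\<integral>\<^sup>+s. ennreal (c * indicator (segm e a (\<xi> n)) s) \<partial>\<nu>) = (\<integral>\<^sup>+s. ennreal c * indicator {0<..<sig e a (\<xi> n)} (sig e a s) \<partial>\<nu>)"
      by (intro nn_integral_cong) (auto simp: indicator_def segm_iff sig_less_iff[OF e] sig_pos_iff[OF e])
    also have "\<dots> = (\<integral>\<^sup>+t. ennreal c * indicator {0<..<sig e a (\<xi> n)} t \<partial>lborel)"
      by (rule nn_integral_sig[OF e]) measurable
    also have "\<dots> < \<top>"
      using \<xi>[of n] sig_pos_iff[OF e, of a "\<xi> n"] by (simp add: nn_integral_cmult_indicator ennreal_mult_less_top)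
    finally show ?thesis .
  qed
  have g1: "(\<integral>\<^sup>+s. ennreal (g n s) \<partial>\<nu>) < \<top>" for n
    by (rule le_less_trans[OF nn_integral_mono len[of i n]]) (rule ennreal_leI[OF gle])
  have g2: "(\<integral>\<^sup>+s. ennreal ((g n s)\<^sup>2) \<partial>\<nu>) < \<top>" for n
  proof (rule le_less_trans[OF nn_integral_mono len[of "i\<^sup>2" n]])
    fix s
    have "(g n s)\<^sup>2 \<le> (i * indicator (segm e a (\<xi> n)) s)\<^sup>2" by (rule power_mono[OF gle g0])
    then show "ennreal ((g n s)\<^sup>2) \<le> ennreal (i\<^sup>2 * indicator (segm e a (\<xi> n)) s)"
      by (intro ennreal_leI) (auto simp: indicator_def)
  qed
  define G where "G n x = (\<integral>\<^sup>+s\<in>segm e a x. ennreal (g n s) \<partial>\<nu>)" for n x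
  have [measurable]: "G n \<in> borel_measurable borel" for n unfolding G_def by measurable
  have J: "(\<integral>\<^sup>+x\<in>ray e a. (G n x)\<^sup>2 \<partial>m) \<le> ?A\<^sup>2 * ?H" for n
  proof -
    let ?J = "\<integral>\<^sup>+x\<in>ray e a. (G n x)\<^sup>2 \<partial>m"
    obtain F where F: "F \<in> form_domain S m" "AE x in \<nu>. D F x = e * (indicator (ray e a) x * g n x)"
      "\<And>x. x \<notin> ray e a \<Longrightarrow> F x = 0"
      "\<And>x. x \<in> ray e a \<Longrightarrow> 0 \<le> F x"
      "\<And>x. x \<in> ray e a \<Longrightarrow> ennreal (F x) = G n x"
      unfolding G_def by (rule form_domain_primitive[OF e, of "g n" a]) (auto intro: g0 g1 g2)
    have Fa: "F a = 0" by (rule F(3)) (simp add: ray_def)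
    have J_osc: "?J = osc e a F"
      unfolding osc_def cray_m_eq[OF e]
      by (intro nn_integral_cong) (use F(4) in \<open>auto simp: Fa F(5)[symmetric] ennreal_power split: split_indicator\<close>)
    have "energy e a F \<le> total_energy F" by (rule energy_le_total)
    also have "\<dots> \<le> (\<integral>\<^sup>+s. ennreal ((g n s)\<^sup>2) \<partial>\<nu>)"
      unfolding total_energy_def
      by (intro nn_integral_mono_AE) (use F(2) e in \<open>auto elim!: eventually_mono simp: indicator_def\<close>)
    \<comment> \<open>Since \<open>g n\<close> is either \<open>v\<close> or 0, one of its two
      factors may be replaced by the untruncated \<open>v\<close>; Tonelli then yields the pairing
      of \<open>G n\<close> with \<open>h\<close>.\<close>
    also have "\<dots> = (\<integral>\<^sup>+s\<in>ray e a. ennreal (g n s) * v s \<partial>\<nu>)"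
    proof (intro nn_integral_cong)
      fix s
      have "ennreal ((g n s)\<^sup>2) = ennreal (g n s) * ennreal (g n s)" using g0 by (simp add: power2_eq_square ennreal_mult)
      also have "\<dots> = ennreal (g n s) * v s * indicator (ray e a) s"
        unfolding gv by (auto simp: indicator_def segm_iff)
      finally show "ennreal ((g n s)\<^sup>2) = ennreal (g n s) * v s * indicator (ray e a) s" .
    qed
    also have "\<dots> = (\<integral>\<^sup>+s\<in>ray e a. (\<integral>\<^sup>+y\<in>ray e s. ennreal (g n s) * h y \<partial>m) \<partial>\<nu>)"
    proof (intro nn_integral_cong)
      fix s
      have "ennreal (g n s) * v s = (\<integral>\<^sup>+y\<in>ray e s. ennreal (g n s) * h y \<partial>m)"
        unfolding v_def by (subst nn_integral_cmult[symmetric]) (auto simp: mult.assoc)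
      then show "ennreal (g n s) * v s * indicator (ray e a) s = (\<integral>\<^sup>+y\<in>ray e s. ennreal (g n s) * h y \<partial>m) * indicator (ray e a) s"
        by simp
    qed
    also have "\<dots> = (\<integral>\<^sup>+y\<in>ray e a. (\<integral>\<^sup>+s\<in>segm e a y. ennreal (g n s) * h y \<partial>\<nu>) \<partial>m)"
      by (rule nn_integral_ray_segm[OF _ e, symmetric]) measurable
    also have "\<dots> = (\<integral>\<^sup>+y. (G n y * indicator (ray e a) y) * (h y * indicator (ray e a) y) \<partial>m)"
    proof (intro nn_integral_cong)
      fix y
      have "(\<integral>\<^sup>+s\<in>segm e a y. ennreal (g n s) * h y \<partial>\<nu>) = G n y * h y"
        unfolding G_def by (subst nn_integral_multc[symmetric]) (auto intro!: nn_integral_cong simp: mult_ac)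
      then show "(\<integral>\<^sup>+s\<in>segm e a y. ennreal (g n s) * h y \<partial>\<nu>) * indicator (ray e a) y = (G n y * indicator (ray e a) y) * (h y * indicator (ray e a) y)"
        by (auto split: split_indicator)
    qed
    finally have E: "energy e a F \<le> (\<integral>\<^sup>+y. (G n y * indicator (ray e a) y) * (h y * indicator (ray e a) y) \<partial>m)" (is "_ \<le> ?K") .
    \<comment> \<open>The Hardy inequality bounds \<open>J\<close> by \<open>A * K\<close>, and
      Cauchy-Schwarz bounds the square of \<open>K\<close> by \<open>J * H\<close>. Squaring leaves
      a common factor \<open>J\<close>, which may be cancelled because \<open>osc_finite\<close>
      makes it finite.\<close>
    have "?J \<le> ?A * ?K"
      unfolding J_osc using osc_le_A_const[OF F(1) A] mult_left_mono[OF E, of ?A] by simp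
    then have "?J\<^sup>2 \<le> (?A * ?K)\<^sup>2" by (intro power_mono) auto
    also have "\<dots> = ?A\<^sup>2 * ?K\<^sup>2" by (rule power_mult_distrib)
    also have "\<dots> \<le> ?A\<^sup>2 * ((\<integral>\<^sup>+y. (G n y * indicator (ray e a) y)\<^sup>2 \<partial>m) * (\<integral>\<^sup>+y. (h y * indicator (ray e a) y)\<^sup>2 \<partial>m))"
      by (intro mult_left_mono Cauchy_Schwarz_nn_integral) auto
    also have "(\<integral>\<^sup>+y. (G n y * indicator (ray e a) y)\<^sup>2 \<partial>m) = ?J"
      by (intro nn_integral_cong) (auto split: split_indicator)
    also have "(\<integral>\<^sup>+y. (h y * indicator (ray e a) y)\<^sup>2 \<partial>m) = ?H"
      by (intro nn_integral_cong) (auto split: split_indicator)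
    finally have "?J * ?J \<le> ?J * (?A\<^sup>2 * ?H)" by (simp add: power2_eq_square mult_ac)
    moreover have "?J < \<top>" unfolding J_osc by (rule osc_finite[OF e F(1)])
    ultimately show ?thesis
      by (cases "?J = 0") (auto simp: ennreal_mult_le_mult_iff)
  qed
  have "(\<integral>\<^sup>+x\<in>ray e a. (green_op e a h x)\<^sup>2 \<partial>m) \<le> (\<integral>\<^sup>+x. (SUP n. (G n x)\<^sup>2 * indicator (ray e a) x) \<partial>m)"
  proof (intro nn_integral_mono)
    fix x
    show "(green_op e a h x)\<^sup>2 * indicator (ray e a) x \<le> (SUP n. (G n x)\<^sup>2 * indicator (ray e a) x)"
    proof (cases "x \<in> ray e a")
      case True
      obtain n where n: "e * (x - a) \<le> real n" using real_arch_simple by blast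
      have "segm e a x \<subseteq> segm e a (\<xi> n)"
        using n e by (auto simp: segm_def \<xi>_def)
      then have "G n x = (\<integral>\<^sup>+s\<in>segm e a x. v s \<partial>\<nu>)"
        unfolding G_def gv by (intro nn_integral_cong) (auto simp: indicator_def)
      also have "\<dots> = green_op e a h x" unfolding v_def by (subst green_op_eq[OF e _ True]) auto
      finally have "(green_op e a h x)\<^sup>2 * indicator (ray e a) x = (G n x)\<^sup>2 * indicator (ray e a) x" by simp
      also have "\<dots> \<le> (SUP n. (G n x)\<^sup>2 * indicator (ray e a) x)" by (rule SUP_upper) simp
      finally show ?thesis .
    qed simp
  qed
  also have "\<dots> = (SUP n. \<integral>\<^sup>+x\<in>ray e a. (G n x)\<^sup>2 \<partial>m)"
  proof (rule nn_integral_monotone_convergence_SUP)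
    have "G n x \<le> G k x" if "n \<le> k" for n k x
      unfolding G_def gv
      by (intro nn_integral_mono) (use that e in \<open>auto simp: indicator_def segm_def \<xi>_def\<close>)
    then show "incseq (\<lambda>n x. (G n x)\<^sup>2 * indicator (ray e a) x)"
      by (auto simp: incseq_def le_fun_def intro!: mult_right_mono power_mono)
  qed measurable
  also have "\<dots> \<le> ?A\<^sup>2 * ?H" by (intro SUP_least J)
  finally show ?thesis .
qed

text \<open>The operator bound gives \<open>L\<^sup>2\<close> norms of order \<open>A^n\<close> for
  the iterates, and Cauchy-Schwarz on the finite mass of the half-line gives integrals of order
  \<open>A^n\<close>. Bounding the kernel at \<open>x\<close> by \<open>sig e a x\<close> turns this
  into a pointwise bound on the next iterate, and the series is dominated by a geometric one of
  ratio \<open>l * A < 1\<close>.\<close>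

lemma exp_series_finite:
  assumes e: "e = 1 \<or> e = -1" and l: "0 \<le> l" and lA: "ennreal l < 1 / A_const e a" and x: "x \<in> ray e a"
  shows "exp_series l e a x < \<top>"
proof -
  have "A_const e a < \<top>" using lA by (cases "A_const e a = \<top>") (auto simp: less_top)
  then obtain \<alpha> where \<alpha>: "A_const e a = ennreal \<alpha>" "0 \<le> \<alpha>" by (cases "A_const e a") auto
  have la: "l * \<alpha> < 1"
  proof (cases "\<alpha> = 0")
    case False
    then have "0 < \<alpha>" using \<alpha>(2) by simp
    then have "ennreal l < ennreal (1 / \<alpha>)" using lA \<alpha> divide_ennreal[of 1 \<alpha>] by simp
    then have "l < 1 / \<alpha>" using l by (simp add: ennreal_less_iff)
    then show ?thesis using \<open>0 < \<alpha>\<close> by (simp add: field_simps)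
  qed simp
  let ?\<mu> = "measure m (ray e a)"
  have N: "(\<integral>\<^sup>+y\<in>ray e a. (green_iter e a n y)\<^sup>2 \<partial>m) \<le> ennreal ((\<alpha> ^ n)\<^sup>2 * ?\<mu>)" for n
  proof (induction n)
    case 0
    show ?case by (simp add: m.emeasure_eq_measure)
  next
    case (Suc n)
    have "(\<integral>\<^sup>+y\<in>ray e a. (green_iter e a n y)\<^sup>2 \<partial>m) < \<top>" using Suc by (rule le_less_trans) simp
    then have "(\<integral>\<^sup>+y\<in>ray e a. (green_iter e a (Suc n) y)\<^sup>2 \<partial>m) \<le> (ennreal \<alpha>)\<^sup>2 * (\<integral>\<^sup>+y\<in>ray e a. (green_iter e a n y)\<^sup>2 \<partial>m)"
      using green_op_L2_bound[OF e, of "green_iter e a n" a] by (simp add: \<alpha>(1))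
    also have "\<dots> \<le> (ennreal \<alpha>)\<^sup>2 * ennreal ((\<alpha> ^ n)\<^sup>2 * ?\<mu>)" by (intro mult_left_mono Suc) simp
    also have "\<dots> = ennreal ((\<alpha> ^ Suc n)\<^sup>2 * ?\<mu>)"
      using \<alpha>(2) by (simp add: ennreal_power ennreal_mult[symmetric] power_mult_distrib mult.assoc)
    finally show ?case .
  qed
  have L1: "(\<integral>\<^sup>+y\<in>ray e a. green_iter e a n y \<partial>m) \<le> ennreal (\<alpha> ^ n * ?\<mu>)" for n
  proof (rule ennreal_le_if_power2_le)
    have "(\<integral>\<^sup>+y\<in>ray e a. green_iter e a n y \<partial>m)\<^sup>2 \<le> emeasure m (ray e a) * (\<integral>\<^sup>+y\<in>ray e a. (green_iter e a n y)\<^sup>2 \<partial>m)"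
      by (rule integral_ray_power2_le) measurable
    also have "\<dots> \<le> emeasure m (ray e a) * ennreal ((\<alpha> ^ n)\<^sup>2 * ?\<mu>)" by (intro mult_left_mono N) simp
    also have "\<dots> = (ennreal (\<alpha> ^ n * ?\<mu>))\<^sup>2"
      using \<alpha>(2) by (simp add: m.emeasure_eq_measure ennreal_power ennreal_mult[symmetric] power_mult_distrib power2_eq_square mult_ac)
    finally show "(\<integral>\<^sup>+y\<in>ray e a. green_iter e a n y \<partial>m)\<^sup>2 \<le> (ennreal (\<alpha> ^ n * ?\<mu>))\<^sup>2" .
  qed (use \<alpha>(2) in simp)
  have x0: "0 < sig e a x" using x sig_pos_iff[OF e] by simp
  have le: "ennreal (l ^ Suc n) * green_iter e a (Suc n) x \<le> ennreal (l * sig e a x * ?\<mu> * (l * \<alpha>) ^ n)" for n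
  proof -
    have "green_iter e a (Suc n) x \<le> (\<integral>\<^sup>+y. ennreal (sig e a x) * (green_iter e a n y * indicator (ray e a) y) \<partial>m)"
      unfolding green_iter.simps green_op_def
      by (intro nn_integral_mono) (auto intro!: mult_right_mono ennreal_leI split: split_indicator)
    also have "\<dots> = ennreal (sig e a x) * (\<integral>\<^sup>+y\<in>ray e a. green_iter e a n y \<partial>m)"
      by (rule nn_integral_cmult) measurable
    also have "\<dots> \<le> ennreal (sig e a x) * ennreal (\<alpha> ^ n * ?\<mu>)" by (intro mult_left_mono L1) simp
    finally have "ennreal (l ^ Suc n) * green_iter e a (Suc n) x \<le> ennreal (l ^ Suc n) * (ennreal (sig e a x) * ennreal (\<alpha> ^ n * ?\<mu>))"
      by (rule mult_left_mono) simp
    also have "\<dots> = ennreal (l * sig e a x * ?\<mu> * (l * \<alpha>) ^ n)"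
      using l x0 \<alpha>(2) by (simp add: ennreal_mult[symmetric] power_mult_distrib mult_ac)
    finally show ?thesis .
  qed
  have "exp_series l e a x = 1 + (\<Sum>n. ennreal (l ^ Suc n) * green_iter e a (Suc n) x)"
    by (rule exp_series_head)
  also have "\<dots> \<le> 1 + (\<Sum>n. ennreal (l * sig e a x * ?\<mu> * (l * \<alpha>) ^ n))"
    by (intro add_left_mono suminf_le le) auto
  also have "\<dots> < \<top>"
  proof -
    have "summable (\<lambda>n. l * sig e a x * ?\<mu> * (l * \<alpha>) ^ n)"
      using l \<alpha>(2) la by (intro summable_mult summable_geometric) simp
    then have "(\<Sum>n. ennreal (l * sig e a x * ?\<mu> * (l * \<alpha>) ^ n)) \<noteq> \<top>"
      by (rule ennreal_suminf_neq_top) (use l x0 \<alpha>(2) in auto)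
    then show ?thesis by (simp add: less_top)
  qed
  finally show ?thesis .
qed

end

section \<open>Exit times of continuous paths and the Markov property\<close>

text \<open>Hitting times have to be functionals measurable for the product sigma-algebra on all paths, so
  they are expressed through rational times; on continuous paths the two notions agree.\<close>

definition stays :: "real \<Rightarrow> real \<Rightarrow> (real \<Rightarrow> real) \<Rightarrow> real \<Rightarrow> bool" where
  "stays e a w t \<longleftrightarrow> (\<exists>n. \<forall>q\<in>{q \<in> \<rat>. 0 \<le> q \<and> q \<le> t}. 1 / real (Suc n) \<le> e * (w q - a))"

definition exit_time :: "real \<Rightarrow> real \<Rightarrow> (real \<Rightarrow> real) \<Rightarrow> ennreal" where
  "exit_time e a w = (SUP t\<in>{t \<in> \<rat>. 0 \<le> t}. if stays e a w t then ennreal t else 0)"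

definition hit :: "(real \<Rightarrow> real) \<Rightarrow> real \<Rightarrow> ennreal" where
  "hit w a = (INF t\<in>{t. 0 \<le> t \<and> w t = a}. ennreal t)"

lemma hitting_time_eq_hit: "hitting_time X a \<omega> = hit (\<lambda>t. X t \<omega>) a"
  by (simp add: hitting_time_def hit_def)

text \<open>Strict positivity at rational times would not exclude a zero at an irrational time; the
  uniform margin \<open>1 / (n + 1)\<close> does, by continuity. Conversely compactness of
  \<open>[0, t]\<close> supplies the margin for a path that is positive throughout.\<close>

lemma stays_iff:
  assumes w: "continuous_on {0..} w" and t: "0 \<le> t"
  shows "stays e a w t \<longleftrightarrow> (\<forall>s\<in>{0..t}. 0 < e * (w s - a))"
proof
  have cont: "continuous_on {0..t} (\<lambda>s. e * (w s - a))"
    using w by (intro continuous_intros) (auto elim: continuous_on_subset)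
  {
    assume "stays e a w t"
    then obtain n where n: "\<And>q. q \<in> \<rat> \<Longrightarrow> 0 \<le> q \<Longrightarrow> q \<le> t \<Longrightarrow> 1 / real (Suc n) \<le> e * (w q - a)"
      by (auto simp: stays_def)
    show "\<forall>s\<in>{0..t}. 0 < e * (w s - a)"
    proof (rule ballI, rule ccontr)
      fix s assume s: "s \<in> {0..t}" and neg: "\<not> 0 < e * (w s - a)"
      have "s \<noteq> 0"
      proof
        assume "s = 0"
        then have "1 / real (Suc n) \<le> e * (w s - a)" using n[of 0] t by simp
        then show False using neg by (simp add: order_less_le_trans[of 0 "1 / real (Suc n)"])
      qed
      then have "0 < s" using s by simp
      obtain d where d: "0 < d" "\<And>r. r \<in> {0..t} \<Longrightarrow> dist r s < d \<Longrightarrow> dist (e * (w r - a)) (e * (w s - a)) < 1 / real (Suc n)"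
        using cont s unfolding continuous_on_iff by (metis of_nat_0_less_iff zero_less_Suc zero_less_divide_1_iff)
      obtain q where q: "q \<in> \<rat>" "max 0 (s - d) < q" "q < s"
        using Rats_dense_in_real[of "max 0 (s - d)" s] \<open>0 < s\<close> d(1) by auto
      have "dist (e * (w q - a)) (e * (w s - a)) < 1 / real (Suc n)"
        by (rule d(2)) (use q s in \<open>auto simp: dist_real_def\<close>)
      moreover have "1 / real (Suc n) \<le> e * (w q - a)" by (rule n) (use q s in auto)
      ultimately show False using neg by (auto simp: dist_real_def)
    qed
  next
    assume pos: "\<forall>s\<in>{0..t}. 0 < e * (w s - a)"
    obtain s where s: "s \<in> {0..t}" "\<And>r. r \<in> {0..t} \<Longrightarrow> e * (w s - a) \<le> e * (w r - a)"
      using continuous_attains_inf[OF _ _ cont] t by auto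
    obtain n where "inverse (real (Suc n)) < e * (w s - a)" using reals_Archimedean pos s(1) by blast
    then have "1 / real (Suc n) \<le> e * (w q - a)" if "0 \<le> q" "q \<le> t" for q
      using s(2)[of q] that by (simp add: inverse_eq_divide)
    then show "stays e a w t" unfolding stays_def by blast
  }
qed

text \<open>Leaving the half-line means passing through \<open>a\<close>, by the intermediate value
  theorem. For the converse, continuity at \<open>t\<close> keeps the path away from
  \<open>a\<close> for a further time \<open>d\<close>, which gives the strict inequality.\<close>

lemma less_hit_iff_stays:
  assumes e: "e = 1 \<or> e = -1" and w: "continuous_on {0..} w" and w0: "w 0 \<in> ray e a" and t: "0 \<le> t"
  shows "ennreal t < hit w a \<longleftrightarrow> stays e a w t"
  unfolding stays_iff[OF w t]
proof
  assume lt: "ennreal t < hit w a"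
  show "\<forall>s\<in>{0..t}. 0 < e * (w s - a)"
  proof (rule ballI, rule ccontr)
    fix s assume s: "s \<in> {0..t}" and neg: "\<not> 0 < e * (w s - a)"
    have cont: "continuous_on {0..s} (\<lambda>s. e * (w s - a))"
      using w by (intro continuous_intros) (auto elim: continuous_on_subset)
    obtain r where r: "0 \<le> r" "r \<le> s" "e * (w r - a) = 0"
      using IVT2'[of "\<lambda>s. e * (w s - a)" s 0 0] cont neg w0 s by (auto simp: ray_def)
    then have "hit w a \<le> ennreal r" unfolding hit_def using e by (intro INF_lower) auto
    also have "\<dots> \<le> ennreal t" using r s by (intro ennreal_leI) simp
    finally show False using lt by simp
  qed
next
  assume pos: "\<forall>s\<in>{0..t}. 0 < e * (w s - a)"
  have "continuous_on {0..} (\<lambda>s. e * (w s - a))" using w by (intro continuous_intros)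
  moreover have "0 < e * (w t - a)" using pos t by simp
  ultimately obtain d where d: "0 < d" "\<And>s. s \<in> {0..} \<Longrightarrow> dist s t < d \<Longrightarrow> dist (e * (w s - a)) (e * (w t - a)) < e * (w t - a)"
    using t unfolding continuous_on_iff by (metis atLeast_iff)
  have "ennreal (t + d) \<le> hit w a"
    unfolding hit_def
  proof (intro INF_greatest ennreal_leI)
    fix s assume s: "s \<in> {t. 0 \<le> t \<and> w t = a}"
    then have "\<not> s \<le> t" using pos[rule_format, of s] by auto
    moreover have "\<not> dist s t < d" using d(2)[of s] s by (auto simp: dist_real_def)
    ultimately show "t + d \<le> s" by (auto simp: dist_real_def)
  qed
  then show "ennreal t < hit w a"
    by (rule less_le_trans[rotated]) (use t d(1) in \<open>auto intro: ennreal_lessI\<close>)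
qed

lemma hit_eq_exit_time:
  assumes e: "e = 1 \<or> e = -1" and w: "continuous_on {0..} w" and w0: "w 0 \<in> ray e a"
  shows "hit w a = exit_time e a w"
proof (rule antisym)
  show "exit_time e a w \<le> hit w a"
    unfolding exit_time_def
    by (intro SUP_least) (auto simp: less_hit_iff_stays[OF e w w0, symmetric])
  show "hit w a \<le> exit_time e a w"
  proof (rule dense_le)
    fix c assume c: "c < hit w a"
    obtain t' where t': "c < t'" "t' < hit w a" using dense[OF c] by blast
    then obtain c' where c': "c = ennreal c'" "0 \<le> c'" by (cases c) auto
    from t' obtain t'' where t'': "t' = ennreal t''" "0 \<le> t''" by (cases t') auto
    have "c' < t''" using t'(1) c' t'' by (simp add: ennreal_less_iff)
    then obtain q where q: "q \<in> \<rat>" "c' < q" "q < t''" using Rats_dense_in_real by blast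
    have "ennreal q < hit w a"
      using t'(2) unfolding t'' by (rule le_less_trans[rotated]) (use q in \<open>auto intro: ennreal_leI\<close>)
    then have "stays e a w q" using q c' by (subst (asm) less_hit_iff_stays[OF e w w0]) auto
    then have "ennreal q \<le> exit_time e a w"
      unfolding exit_time_def using q c' by (intro SUP_upper2[of q]) auto
    moreover have "c \<le> ennreal q" using q c' by (auto intro: ennreal_leI)
    ultimately show "c \<le> exit_time e a w" by (rule order_trans[rotated])
  qed
qed

lemma hit_shift:
  assumes t: "0 \<le> t" and ne: "\<And>s. s \<in> {0..<t} \<Longrightarrow> w s \<noteq> a"
  shows "hit w a = ennreal t + hit (\<lambda>s. w (t + s)) a"
proof -
  have "{s. 0 \<le> s \<and> w s = a} = (\<lambda>s. t + s) ` {s. 0 \<le> s \<and> w (t + s) = a}"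
  proof (intro equalityI subsetI)
    fix s assume s: "s \<in> {s. 0 \<le> s \<and> w s = a}"
    then have "\<not> s < t" using ne[of s] by auto
    then show "s \<in> (\<lambda>s. t + s) ` {s. 0 \<le> s \<and> w (t + s) = a}" using s by (intro image_eqI[of _ _ "s - t"]) auto
  qed (use t in auto)
  then have "hit w a = (INF s\<in>{s. 0 \<le> s \<and> w (t + s) = a}. ennreal (t + s))"
    unfolding hit_def by (simp add: image_image)
  also have "\<dots> = (INF s\<in>{s. 0 \<le> s \<and> w (t + s) = a}. ennreal t + ennreal s)"
    using t by (intro INF_cong) auto
  also have "\<dots> = ennreal t + hit (\<lambda>s. w (t + s)) a"
  proof (cases "{s. 0 \<le> s \<and> w (t + s) = a} = {}")
    case True then show ?thesis by (simp only: hit_def True image_empty) simp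
  next
    case False
    let ?I = "{s. 0 \<le> s \<and> w (t + s) = a}"
    have "(INF s\<in>?I. ennreal t + ennreal s) - ennreal t \<le> (INF s\<in>?I. ennreal s)"
    proof (rule INF_greatest)
      fix s assume "s \<in> ?I"
      then have "(INF s\<in>?I. ennreal t + ennreal s) \<le> ennreal t + ennreal s" by (rule INF_lower)
      then show "(INF s\<in>?I. ennreal t + ennreal s) - ennreal t \<le> ennreal s"
        by (simp add: ennreal_minus_le_iff)
    qed
    then have "(INF s\<in>?I. ennreal t + ennreal s) \<le> ennreal t + (INF s\<in>?I. ennreal s)"
      by (simp add: ennreal_minus_le_iff)
    moreover have "ennreal t + (INF s\<in>?I. ennreal s) \<le> (INF s\<in>?I. ennreal t + ennreal s)"
      by (intro INF_greatest add_left_mono INF_lower)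
    ultimately show ?thesis unfolding hit_def by (rule antisym)
  qed
  finally show ?thesis .
qed

lemma exit_time_restrict: "exit_time e a (\<lambda>s\<in>{0..}. w s) = exit_time e a w"
proof -
  have "stays e a (\<lambda>s\<in>{0..}. w s) t = stays e a w t" for t by (auto simp: stays_def)
  then show ?thesis by (simp add: exit_time_def)
qed

text \<open>Measurability is asked only for times up to \<open>t\<close>, so that the lemma also
  places the event in the natural filtration at time \<open>t\<close>.\<close>

lemma stays_measurable:
  assumes "\<And>q. 0 \<le> q \<Longrightarrow> q \<le> t \<Longrightarrow> (\<lambda>\<omega>. Y q \<omega>) \<in> borel_measurable M"
  shows "Measurable.pred M (\<lambda>\<omega>. stays e a (\<lambda>s. Y s \<omega>) t)"
  unfolding stays_def
proof (rule pred_intros_countable)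
  fix n
  have c: "countable {q \<in> \<rat>. 0 \<le> q \<and> q \<le> t}" by (rule countable_subset[OF _ countable_rat]) auto
  show "Measurable.pred M (\<lambda>\<omega>. \<forall>q\<in>{q \<in> \<rat>. 0 \<le> q \<and> q \<le> t}. 1 / real (Suc n) \<le> e * (Y q \<omega> - a))"
    unfolding pred_def
  proof -
    have "(\<Union>q\<in>{q \<in> \<rat>. 0 \<le> q \<and> q \<le> t}. {\<omega> \<in> space M. \<not> 1 / real (Suc n) \<le> e * (Y q \<omega> - a)}) \<in> sets M"
    proof (rule sets.countable_UN'[OF c], safe)
      fix q :: real assume "q \<in> \<rat>" "0 \<le> q" "q \<le> t"
      then have [measurable]: "(\<lambda>\<omega>. Y q \<omega>) \<in> borel_measurable M" using assms by auto
      show "{\<omega> \<in> space M. \<not> 1 / real (Suc n) \<le> e * (Y q \<omega> - a)} \<in> sets M" by measurable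
    qed
    then have "space M - (\<Union>q\<in>{q \<in> \<rat>. 0 \<le> q \<and> q \<le> t}. {\<omega> \<in> space M. \<not> 1 / real (Suc n) \<le> e * (Y q \<omega> - a)}) \<in> sets M"
      by (rule sets.compl_sets)
    also have "space M - (\<Union>q\<in>{q \<in> \<rat>. 0 \<le> q \<and> q \<le> t}. {\<omega> \<in> space M. \<not> 1 / real (Suc n) \<le> e * (Y q \<omega> - a)})
        = {\<omega> \<in> space M. \<forall>q\<in>{q \<in> \<rat>. 0 \<le> q \<and> q \<le> t}. 1 / real (Suc n) \<le> e * (Y q \<omega> - a)}"
      by blast
    finally show "{\<omega> \<in> space M. \<forall>q\<in>{q \<in> \<rat>. 0 \<le> q \<and> q \<le> t}. 1 / real (Suc n) \<le> e * (Y q \<omega> - a)} \<in> sets M" .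
  qed
qed

lemma exit_time_measurable:
  assumes "\<And>q. 0 \<le> q \<Longrightarrow> (\<lambda>\<omega>. Y q \<omega>) \<in> borel_measurable M"
  shows "(\<lambda>\<omega>. exit_time e a (\<lambda>s. Y s \<omega>)) \<in> borel_measurable M"
  unfolding exit_time_def
proof (rule borel_measurable_SUP)
  show "countable {t \<in> \<rat>. 0 \<le> t}" by (rule countable_subset[OF _ countable_rat]) auto
  fix t :: real
  have [measurable]: "Measurable.pred M (\<lambda>\<omega>. stays e a (\<lambda>s. Y s \<omega>) t)"
    by (rule stays_measurable) (rule assms)
  show "(\<lambda>\<omega>. if stays e a (\<lambda>s. Y s \<omega>) t then ennreal t else 0) \<in> borel_measurable M" by measurable
qed

lemma exit_time_PiM: "exit_time e a \<in> borel_measurable (PiM {0..} (\<lambda>_. borel))"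
  using exit_time_measurable[of "\<lambda>q w. w q" "PiM {0..} (\<lambda>_. borel)" e a] by simp

section \<open>Filtrations and the Markov property before the exit from a half-line\<close>

context linear_diffusion
begin

lemma sets_natural_filtration_subset:
  "sets (natural_filtration (space (P x)) X t) \<subseteq> sets (P x)"
proof -
  have "{X s -` B \<inter> space (P x) |s B. 0 \<le> s \<and> ennreal s \<le> t \<and> B \<in> sets borel} \<subseteq> sets (P x)"
    using measurable_X by (auto intro: measurable_sets)
  then have "sigma_sets (space (P x)) {X s -` B \<inter> space (P x) |s B. 0 \<le> s \<and> ennreal s \<le> t \<and> B \<in> sets borel} \<subseteq> sets (P x)"
    by (rule sets.sigma_sets_subset)
  moreover have "{X s -` B \<inter> space (P x) |s B. 0 \<le> s \<and> ennreal s \<le> t \<and> B \<in> sets borel} \<subseteq> Pow (space (P x))" by auto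
  ultimately show ?thesis unfolding natural_filtration_def by (simp add: sets_measure_of)
qed

lemma space_natural_filtration: "space (natural_filtration \<Omega> X t) = \<Omega>"
  unfolding natural_filtration_def by (rule space_measure_of) auto

lemma natural_filtration_mono:
  "s \<le> t \<Longrightarrow> sets (natural_filtration \<Omega> X s) \<subseteq> sets (natural_filtration \<Omega> X t)"
  unfolding natural_filtration_def
proof (subst (1 2) sets_measure_of, goal_cases)
  case 3
  then show ?case
    by (intro sigma_sets_mono' subsetI) (blast intro: order_trans)
qed auto

lemma X_natural_filtration:
  assumes "0 \<le> s" "ennreal s \<le> t"
  shows "X s \<in> borel_measurable (natural_filtration \<Omega> X t)"
proof (rule measurableI)
  fix B :: "real set" assume "B \<in> sets borel"
  then show "X s -` B \<inter> space (natural_filtration \<Omega> X t) \<in> sets (natural_filtration \<Omega> X t)"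
    unfolding space_natural_filtration using assms
    unfolding natural_filtration_def by (subst sets_measure_of) (auto intro!: sigma_sets.Basic)
qed simp

abbreviation "rcf x \<equiv> right_cont_filtration (natural_filtration (space (P x)) X)"

lemma rcf_generator_subset:
  "(\<Inter>u\<in>{u. t < u \<or> u = \<top>}. sets (natural_filtration (space (P x)) X u)) \<subseteq> Pow (space (P x))"
proof
  fix A assume "A \<in> (\<Inter>u\<in>{u. t < u \<or> u = \<top>}. sets (natural_filtration (space (P x)) X u))"
  then have "A \<in> sets (natural_filtration (space (P x)) X \<top>)" by blast
  then show "A \<in> Pow (space (P x))" using sets_natural_filtration_subset sets.sets_into_space by blast
qed

lemma space_rcf: "space (rcf x t) = space (P x)"
  unfolding right_cont_filtration_def space_natural_filtration
  by (rule space_measure_of) (rule rcf_generator_subset)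

lemma sets_rcf:
  "sets (rcf x t) = sigma_sets (space (P x)) (\<Inter>u\<in>{u. t < u \<or> u = \<top>}. sets (natural_filtration (space (P x)) X u))"
  unfolding right_cont_filtration_def space_natural_filtration
  by (rule sets_measure_of) (rule rcf_generator_subset)

lemma sets_rcf_subset: "sets (rcf x t) \<subseteq> sets (P x)"
  unfolding sets_rcf
  by (rule sets.sigma_sets_subset) (use sets_natural_filtration_subset[of x \<top>] in auto)

lemma natural_subset_rcf:
  "A \<in> sets (natural_filtration (space (P x)) X t) \<Longrightarrow> t \<le> u \<Longrightarrow> A \<in> sets (rcf x u)"
  unfolding sets_rcf
proof (rule sigma_sets.Basic, rule INT_I)
  fix v assume A: "A \<in> sets (natural_filtration (space (P x)) X t)" and "t \<le> u" and "v \<in> {v. u < v \<or> v = \<top>}"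
  then have "t \<le> v" by auto
  then show "A \<in> sets (natural_filtration (space (P x)) X v)" using natural_filtration_mono A by blast
qed

lemma filtration_rcf: "filtration (space (P x)) (rcf x)"
proof
  show "space (rcf x i) = space (P x)" for i by (rule space_rcf)
  show "sets (rcf x i) \<subseteq> sets (rcf x j)" if "i \<le> j" for i j
    unfolding sets_rcf using that by (intro sigma_sets_mono') auto
qed

lemma path_from_measurable [measurable]:
  assumes "0 \<le> t"
  shows "path_from X t \<in> measurable (P x) (PiM {0..} (\<lambda>_. borel))"
  unfolding path_from_def[abs_def]
  by (rule measurable_restrict) (use assms in \<open>auto intro: measurable_X\<close>)

lemma stays_event:
  assumes "0 \<le> t"
  shows "{\<omega> \<in> space (P x). stays e a (\<lambda>s. X s \<omega>) t} \<in> sets (natural_filtration (space (P x)) X (ennreal t))"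
proof -
  have "Measurable.pred (natural_filtration (space (P x)) X (ennreal t)) (\<lambda>\<omega>. stays e a (\<lambda>s. X s \<omega>) t)"
    by (rule stays_measurable) (auto intro!: X_natural_filtration ennreal_leI)
  then show ?thesis by (simp add: pred_def space_natural_filtration)
qed

text \<open>The strong Markov property at the constant stopping time \<open>t\<close>, integrated
  over an event that depends on the path up to \<open>t\<close> only and hence belongs to the
  sigma-algebra of that stopping time.\<close>

lemma Markov_stays:
  assumes t: "0 \<le> t" and Z: "Z \<in> borel_measurable (PiM {0..} (\<lambda>_. borel))"
  shows "(\<integral>\<^sup>+\<omega>. indicator {\<omega>. stays e a (\<lambda>s. X s \<omega>) t} \<omega> * Z (path_from X t \<omega>) \<partial>P x)
       = (\<integral>\<^sup>+\<omega>. indicator {\<omega>. stays e a (\<lambda>s. X s \<omega>) t} \<omega> * (\<integral>\<^sup>+\<omega>'. Z (path_from X 0 \<omega>') \<partial>P (X t \<omega>)) \<partial>P x)"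
proof -
  interpret prob_space "P x" by (rule prob_space_P)
  interpret filt: filtration "space (P x)" "rcf x" by (rule filtration_rcf)
  let ?T = "\<lambda>_::'w. ennreal t"
  let ?G = "filt.pre_sigma ?T"
  let ?E = "{\<omega> \<in> space (P x). stays e a (\<lambda>s. X s \<omega>) t}"
  have st: "stopping_time (rcf x) ?T" by (rule stopping_time_const)
  have "sets ?G \<subseteq> sets (P x)"
  proof
    fix A assume "A \<in> sets ?G"
    then have "{\<omega> \<in> A. ennreal t \<le> \<top>} \<in> sets (rcf x \<top>)" by (rule filt.sets_pre_sigmaD[OF st])
    then show "A \<in> sets (P x)" using sets_rcf_subset by auto
  qed
  then have sub: "subalgebra (P x) ?G" by (simp add: subalgebra_def filt.space_pre_sigma)
  interpret finite_measure_subalgebra "P x" ?G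
    by unfold_locales (rule sub)
  have E: "?E \<in> sets ?G"
  proof (rule filt.sets_pre_sigmaI[OF st])
    fix u
    show "{\<omega> \<in> ?E. ennreal t \<le> u} \<in> sets (rcf x u)"
      using natural_subset_rcf[OF stays_event[OF t], of u x e a] by (cases "ennreal t \<le> u") auto
  qed
  have Zm: "(\<lambda>\<omega>. Z (path_from X t \<omega>)) \<in> borel_measurable (P x)"
    using Z path_from_measurable[OF t] by (rule measurable_compose_rev)
  have "(\<integral>\<^sup>+\<omega>. indicator {\<omega>. stays e a (\<lambda>s. X s \<omega>) t} \<omega> * Z (path_from X t \<omega>) \<partial>P x)
      = (\<integral>\<^sup>+\<omega>. indicator ?E \<omega> * Z (path_from X t \<omega>) \<partial>P x)"
    by (intro nn_integral_cong) (auto simp: indicator_def)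
  also have "\<dots> = (\<integral>\<^sup>+\<omega>. indicator ?E \<omega> * nn_cond_exp (P x) ?G (\<lambda>\<omega>. Z (path_from X t \<omega>)) \<omega> \<partial>P x)"
    by (rule nn_cond_exp_intg[symmetric]) (use E Zm in auto)
  also have "\<dots> = (\<integral>\<^sup>+\<omega>. indicator {\<omega>. stays e a (\<lambda>s. X s \<omega>) t} \<omega> * (\<integral>\<^sup>+\<omega>'. Z (path_from X 0 \<omega>') \<partial>P (X t \<omega>)) \<partial>P x)"
  proof (rule nn_integral_cong_AE)
    show "AE \<omega> in P x. indicator ?E \<omega> * nn_cond_exp (P x) ?G (\<lambda>\<omega>. Z (path_from X t \<omega>)) \<omega>
        = indicator {\<omega>. stays e a (\<lambda>s. X s \<omega>) t} \<omega> * (\<integral>\<^sup>+\<omega>'. Z (path_from X 0 \<omega>') \<partial>P (X t \<omega>))"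
      using strong_Markov[OF st Z] AE_space
      by eventually_elim (use t in \<open>auto simp: indicator_def\<close>)
  qed
  finally show ?thesis .
qed

end

section \<open>Occupation times and moments of hitting times\<close>

abbreviation before :: "ennreal \<Rightarrow> real set" where
  "before \<tau> \<equiv> {t. 0 \<le> t \<and> ennreal t < \<tau>}"

lemma emeasure_lborel_before:
  "emeasure lborel (before \<tau>) = \<tau>"
proof (cases \<tau>)
  case (real r)
  then have "before \<tau> = {0..<r}" by (auto simp: ennreal_less_iff)
  then show ?thesis using real by simp
next
  case top
  then have "before \<tau> = {0..}" by auto
  moreover have "emeasure lborel {0::real..} = \<top>"
  proof (rule ccontr)
    assume "emeasure lborel {0::real..} \<noteq> \<top>"
    then obtain r where r: "emeasure lborel {0::real..} = ennreal r" "0 \<le> r" by (cases "emeasure lborel {0::real..}") auto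
    have "emeasure lborel {0..r + 1} \<le> emeasure lborel {0::real..}" by (rule emeasure_mono) auto
    then show False using r by simp
  qed
  ultimately show ?thesis using top by simp
qed

lemma nn_integral_power_remaining_time:
  assumes "\<tau> < \<top>"
  shows "(\<integral>\<^sup>+t. (ennreal (1 / fact n) * (\<tau> - ennreal t) ^ n) * indicator (before \<tau>) t \<partial>lborel)
    = ennreal (1 / fact (Suc n)) * \<tau> ^ Suc n"
proof -
  obtain r where r: "\<tau> = ennreal r" "0 \<le> r" using assms by (cases \<tau>) auto
  have "(\<integral>\<^sup>+t. (ennreal (1 / fact n) * (\<tau> - ennreal t) ^ n) * indicator (before \<tau>) t \<partial>lborel)
      = (\<integral>\<^sup>+t. ennreal ((r - t) ^ n / fact n) * indicator {0..r} t \<partial>lborel)"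
  proof (rule nn_integral_cong_AE)
    \<comment> \<open>The two time sets differ at \<open>t = r\<close>; this matters for
      \<open>n = 0\<close>, where the integrand there is 1 and not 0.\<close>
    show "AE t in lborel. (ennreal (1 / fact n) * (\<tau> - ennreal t) ^ n) * indicator (before \<tau>) t
        = ennreal ((r - t) ^ n / fact n) * indicator {0..r} t"
      using AE_lborel_singleton[of r]
    proof eventually_elim
      case (elim t)
      then show ?case using r
        by (auto simp: indicator_def ennreal_less_iff ennreal_minus ennreal_power ennreal_mult[symmetric])
    qed
  qed
  also have "\<dots> = ennreal (- ((r - r) ^ Suc n) / fact (Suc n) - (- ((r - 0) ^ Suc n) / fact (Suc n)))"
  proof (rule nn_integral_FTC_Icc)
    fix t
    have "((\<lambda>t. - ((r - t) ^ Suc n) / fact (Suc n)) has_real_derivative - (real (Suc n) * (r - t) ^ n * (-1)) / fact (Suc n)) (at t)"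
      by (auto intro!: derivative_eq_intros simp del: power_Suc fact_Suc)
    also have "- (real (Suc n) * (r - t) ^ n * (-1)) / fact (Suc n) = (r - t) ^ n / fact n"
      by (simp add: fact_Suc del: of_nat_Suc)
    finally show "((\<lambda>t. - ((r - t) ^ Suc n) / fact (Suc n)) has_real_derivative (r - t) ^ n / fact n) (at t)" .
  qed (use r in auto)
  also have "\<dots> = ennreal (1 / fact (Suc n)) * \<tau> ^ Suc n"
    using r by (simp add: ennreal_power ennreal_mult[symmetric] del: power_Suc fact_Suc)
  finally show ?thesis .
qed

text \<open>Approximation from the left along the grid of mesh \<open>1 / (n + 1)\<close>: each
  approximation takes countably many times, and continuity gives the limit. Replacing
  \<open>t\<close> by \<open>max 0 t\<close> extends the process to all real times, as Fubini with
  \<open>lborel\<close> requires.\<close>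

lemma joint_measurable_continuous_paths:
  fixes Y :: "real \<Rightarrow> 'a \<Rightarrow> real"
  assumes Y: "\<And>t. 0 \<le> t \<Longrightarrow> Y t \<in> borel_measurable M"
    and cont: "\<And>\<omega>. \<omega> \<in> space M \<Longrightarrow> continuous_on {0..} (\<lambda>t. Y t \<omega>)"
  shows "(\<lambda>(t, \<omega>). Y (max 0 t) \<omega>) \<in> borel_measurable (borel \<Otimes>\<^sub>M M)"
proof (rule borel_measurable_LIMSEQ_real)
  fix n :: nat
  have "(\<lambda>w. Y (real (nat \<lfloor>real (Suc n) * max 0 (fst w)\<rfloor>) / real (Suc n)) (snd w)) \<in> borel_measurable (borel \<Otimes>\<^sub>M M)"
  proof (rule measurable_compose_countable[where f = "\<lambda>k w. Y (real k / real (Suc n)) (snd w)"])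
    show "(\<lambda>w. Y (real k / real (Suc n)) (snd w)) \<in> borel_measurable (borel \<Otimes>\<^sub>M M)" for k
      by (rule measurable_compose[OF measurable_snd Y]) simp
  qed measurable
  then show "(\<lambda>w. Y (real (nat \<lfloor>real (Suc n) * max 0 (fst w)\<rfloor>) / real (Suc n)) (snd w)) \<in> borel_measurable (borel \<Otimes>\<^sub>M M)" .
next
  fix w :: "real \<times> 'a" assume "w \<in> space (borel \<Otimes>\<^sub>M M)"
  then have \<omega>: "snd w \<in> space M" by (auto simp: space_pair_measure)
  let ?t = "max 0 (fst w)"
  define s where "s n = real (nat \<lfloor>real (Suc n) * ?t\<rfloor>) / real (Suc n)" for n
  have s0: "s n \<in> {0..}" for n by (simp add: s_def)
  have "s \<longlonglongrightarrow> ?t"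
  proof (rule tendsto_sandwich)
    have fl: "real (nat \<lfloor>real (Suc n) * ?t\<rfloor>) = of_int \<lfloor>real (Suc n) * ?t\<rfloor>" for n by simp
    have lo: "?t - 1 / real (Suc n) \<le> s n" for n
    proof -
      have "(real (Suc n) * ?t - 1) / real (Suc n) \<le> s n"
        unfolding s_def fl by (intro divide_right_mono) linarith+
      then show ?thesis by (simp add: diff_divide_distrib del: of_nat_Suc)
    qed
    have hi: "s n \<le> ?t" for n
    proof -
      have "s n \<le> (real (Suc n) * ?t) / real (Suc n)"
        unfolding s_def fl by (intro divide_right_mono) linarith+
      then show ?thesis by (simp del: of_nat_Suc)
    qed
    show "\<forall>\<^sub>F n in sequentially. ?t - 1 / real (Suc n) \<le> s n" using lo by simp
    show "\<forall>\<^sub>F n in sequentially. s n \<le> ?t" using hi by simp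
    have "(\<lambda>n. ?t - inverse (real (Suc n))) \<longlonglongrightarrow> ?t - 0"
      by (intro tendsto_diff tendsto_const LIMSEQ_inverse_real_of_nat)
    then show "(\<lambda>n. ?t - 1 / real (Suc n)) \<longlonglongrightarrow> ?t" by (simp add: inverse_eq_divide)
  qed simp
  then have "(\<lambda>n. Y (s n) (snd w)) \<longlonglongrightarrow> Y ?t (snd w)"
    using continuous_on_tendsto_compose[OF cont[OF \<omega>], of s ?t sequentially] s0 by (simp add: always_eventually)
  then show "(\<lambda>n. Y (real (nat \<lfloor>real (Suc n) * max 0 (fst w)\<rfloor>) / real (Suc n)) (snd w)) \<longlonglongrightarrow> (case w of (t, \<omega>) \<Rightarrow> Y (max 0 t) \<omega>)"
    by (simp add: s_def case_prod_beta)
qed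

text \<open>A continuous path is bounded on \<open>[0, t]\<close>, so sufficiently far levels are
  not reached by time \<open>t\<close>. Seen from such a level the start lies in direction
  \<open>-e\<close>.\<close>

lemma eventually_less_hit:
  assumes e: "e = 1 \<or> e = -1" and w: "continuous_on {0..} w" and t: "0 \<le> t"
  shows "\<forall>\<^sub>F n in sequentially. ennreal t < hit w (w 0 + e * real (Suc n))"
proof -
  have "compact (w ` {0..t})"
    using w by (intro compact_continuous_image) (auto elim: continuous_on_subset)
  then have "\<exists>C. \<forall>s\<in>{0..t}. \<bar>w s\<bar> \<le> C"
    by (auto simp: bounded_iff dest!: compact_imp_bounded)
  then obtain C where C: "\<And>s. s \<in> {0..t} \<Longrightarrow> \<bar>w s\<bar> \<le> C" by blast
  obtain N where N: "C + \<bar>w 0\<bar> \<le> real N" using real_arch_simple by blast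
  show ?thesis
    using eventually_ge_at_top[of N]
  proof eventually_elim
    case (elim n)
    let ?b = "w 0 + e * real (Suc n)"
    have e': "-e = 1 \<or> -e = -1" using e by auto
    have w0: "w 0 \<in> ray (-e) ?b" using e by (auto simp: ray_def)
    have "0 < - e * (w s - ?b)" if "s \<in> {0..t}" for s
    proof -
      have "real N \<le> real n" using elim by simp
      then show ?thesis using C[OF that] N e by auto
    qed
    then show ?case
      using less_hit_iff_stays[OF e' w w0 t] stays_iff[OF w t, of "-e" ?b] by blast
  qed
qed

lemma hit_far_mono:
  assumes e: "e = 1 \<or> e = -1" and w: "continuous_on {0..} w" and nk: "n \<le> k"
  shows "hit w (w 0 + e * real (Suc n)) \<le> hit w (w 0 + e * real (Suc k))"
proof (rule dense_le)
  fix c assume c: "c < hit w (w 0 + e * real (Suc n))"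
  then obtain t where t: "c = ennreal t" "0 \<le> t" by (cases c) auto
  have e': "-e = 1 \<or> -e = -1" using e by auto
  have w0: "w 0 \<in> ray (-e) (w 0 + e * real (Suc j))" for j using e by (auto simp: ray_def)
  have "\<forall>s\<in>{0..t}. 0 < - e * (w s - (w 0 + e * real (Suc n)))"
    using c less_hit_iff_stays[OF e' w w0 t(2)] stays_iff[OF w t(2)] t(1) by blast
  moreover have "- e * (w s - (w 0 + e * real (Suc n))) \<le> - e * (w s - (w 0 + e * real (Suc k)))" for s
    using e nk by auto
  ultimately have "\<forall>s\<in>{0..t}. 0 < - e * (w s - (w 0 + e * real (Suc k)))"
    by (meson less_le_trans)
  then have "ennreal t < hit w (w 0 + e * real (Suc k))"
    using less_hit_iff_stays[OF e' w w0 t(2)] stays_iff[OF w t(2)] by blast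
  then show "c \<le> hit w (w 0 + e * real (Suc k))" using t by simp
qed

context linear_diffusion
begin

abbreviation exit :: "real \<Rightarrow> real \<Rightarrow> 'w \<Rightarrow> ennreal" where
  "exit e a \<omega> \<equiv> exit_time e a (\<lambda>t. X t \<omega>)"

lemma exit_measurable [measurable]: "exit e a \<in> borel_measurable (P x)"
  by (rule exit_time_measurable) (rule measurable_X)

lemma X_joint_measurable [measurable]: "(\<lambda>(t, \<omega>). X (max 0 t) \<omega>) \<in> borel_measurable (borel \<Otimes>\<^sub>M P x)"
  by (rule joint_measurable_continuous_paths) (auto intro: measurable_X continuous_paths)

lemma X_joint_measurable' [measurable]: "(\<lambda>(\<omega>, t). X (max 0 t) \<omega>) \<in> borel_measurable (P x \<Otimes>\<^sub>M borel)"
  using measurable_compose[OF measurable_pair_swap' X_joint_measurable, of x] by (simp add: case_prod_beta)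

lemma AE_path: "AE \<omega> in P x. continuous_on {0..} (\<lambda>t. X t \<omega>) \<and> X 0 \<omega> = x"
  using start[of x] AE_space by eventually_elim (auto intro: continuous_paths)

lemma hitting_time_eq_exit:
  assumes "\<omega> \<in> space (P x)"
  shows "hitting_time X a \<omega> = (if X 0 \<omega> = a then 0 else if a < X 0 \<omega> then exit 1 a \<omega> else exit (-1) a \<omega>)"
proof -
  note c = continuous_paths[OF assms]
  consider "X 0 \<omega> = a" | "a < X 0 \<omega>" | "X 0 \<omega> < a" by linarith
  then show ?thesis
  proof cases
    case 1
    then have "hit (\<lambda>t. X t \<omega>) a \<le> ennreal 0" unfolding hit_def by (intro INF_lower) auto
    then show ?thesis using 1 by (simp add: hitting_time_eq_hit)
  next
    case 2
    then show ?thesis using hit_eq_exit_time[of 1 "\<lambda>t. X t \<omega>" a] c by (simp add: hitting_time_eq_hit ray_def)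
  next
    case 3
    then show ?thesis using hit_eq_exit_time[of "-1" "\<lambda>t. X t \<omega>" a] c by (simp add: hitting_time_eq_hit ray_def)
  qed
qed

lemma hitting_time_measurable [measurable]: "hitting_time X a \<in> borel_measurable (P x)"
proof -
  have [measurable]: "X 0 \<in> borel_measurable (P x)" by (rule measurable_X) simp
  have "(\<lambda>\<omega>. if X 0 \<omega> = a then 0 else if a < X 0 \<omega> then exit 1 a \<omega> else exit (-1) a \<omega>) \<in> borel_measurable (P x)"
    by measurable
  then show ?thesis by (rule measurable_cong[THEN iffD2, rotated]) (rule hitting_time_eq_exit)
qed

lemma AE_hitting_time_eq_exit:
  assumes e: "e = 1 \<or> e = -1" and x: "x \<in> ray e a"
  shows "AE \<omega> in P x. hitting_time X a \<omega> = exit e a \<omega>"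
  using AE_path
  by eventually_elim (use hit_eq_exit_time[OF e] x in \<open>auto simp: hitting_time_eq_hit\<close>)

end

section \<open>Divergence of the scale from recurrence\<close>

locale diffusion_scale = positively_recurrent_diffusion P X for P :: "real \<Rightarrow> 'w measure" and X +
  fixes S :: "real \<Rightarrow> real" and m :: "real measure"
  assumes scale: "scale_function P X S" and speed: "speed_measure P X S m"
begin

sublocale PX: prob_space "P x" for x by (rule prob_space_P)

lemma AE_hitting_time_finite: "AE \<omega> in P x. hitting_time X a \<omega> < \<top>"
  using nn_integral_PInf_AE[of "hitting_time X a" "P x"] positively_recurrent[of x a]
  by (auto simp: less_top)

lemma strict_mono_S: "strict_mono S" and continuous_S: "continuous_on UNIV S"
  using scale by (auto simp: scale_function_def)

lemma S_less: "S x < S y \<longleftrightarrow> x < y"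
  using strict_mono_S by (simp add: strict_mono_less)

abbreviation far :: "real \<Rightarrow> real \<Rightarrow> nat \<Rightarrow> real" where
  "far e x n \<equiv> x + e * real (Suc n)"

lemma AE_eventually_hits_first:
  assumes e: "e = 1 \<or> e = -1"
  shows "AE \<omega> in P x. \<forall>\<^sub>F n in sequentially. hitting_time X a \<omega> < hitting_time X (far e x n) \<omega>"
  using AE_path[of x] AE_hitting_time_finite[of a x]
proof eventually_elim
  case (elim \<omega>)
  then obtain t where t: "hitting_time X a \<omega> = ennreal t" "0 \<le> t" by (cases "hitting_time X a \<omega>") auto
  have w: "continuous_on {0..} (\<lambda>t. X t \<omega>)" and w0: "X 0 \<omega> = x" using elim by auto
  show ?case using eventually_less_hit[OF e w t(2)] unfolding w0 t(1) by (simp add: hitting_time_eq_hit)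
qed

lemma measure_tendsto_const:
  assumes [measurable]: "\<And>n. Measurable.pred (P x) (Q n)"
    and lim: "AE \<omega> in P x. \<forall>\<^sub>F n in sequentially. Q n \<omega> \<longleftrightarrow> b"
  shows "(\<lambda>n. measure (P x) {\<omega> \<in> space (P x). Q n \<omega>}) \<longlonglongrightarrow> (if b then 1 else 0)"
proof -
  have "(\<lambda>n. LINT \<omega>|P x. indicator {\<omega> \<in> space (P x). Q n \<omega>} \<omega>) \<longlonglongrightarrow> (LINT \<omega>|P x. (if b then 1 else (0::real)))"
  proof (rule integral_dominated_convergence[where w = "\<lambda>_. 1"])
    show "AE \<omega> in P x. (\<lambda>n. indicator {\<omega> \<in> space (P x). Q n \<omega>} \<omega>) \<longlonglongrightarrow> (if b then 1 else (0::real))"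
      using lim AE_space
    proof eventually_elim
      case (elim \<omega>)
      then show ?case
        by (intro tendsto_eventually) (auto elim!: eventually_mono simp: indicator_def)
    qed
  qed (auto simp: indicator_def)
  then show ?thesis by (simp add: PX.prob_space split: if_splits)
qed

text \<open>The probability of reaching the far level before \<open>a\<close> is the ratio of two
  scale distances with fixed numerator. It tends to 0, because \<open>a\<close> is hit in finite
  time and the path is bounded up to then; the denominator must diverge.\<close>

lemma scale_far_at_top:
  assumes e: "e = 1 \<or> e = -1" and x: "x \<in> ray e a"
  shows "filterlim (\<lambda>n. e * (S (far e x n) - S a)) at_top sequentially"
proof -
  define c where "c = e * (S x - S a)"
  define d where "d n = e * (S (far e x n) - S a)" for n
  have c0: "0 < c" using e x S_less by (auto simp: c_def ray_def)
  have d0: "0 < d n" for n using e x S_less by (auto simp: d_def ray_def)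
  have "(\<lambda>n. c / d n) \<longlonglongrightarrow> 0"
  proof (cases "e = 1")
    case True
    have "c / d n = measure (P x) {\<omega> \<in> space (P x). hitting_time X (far e x n) \<omega> < hitting_time X a \<omega>}" for n
      using scale x True by (simp add: scale_function_def c_def d_def ray_def)
    moreover have "(\<lambda>n. measure (P x) {\<omega> \<in> space (P x). hitting_time X (far e x n) \<omega> < hitting_time X a \<omega>}) \<longlonglongrightarrow> (if False then 1 else 0)"
    proof (rule measure_tendsto_const)
      show "AE \<omega> in P x. \<forall>\<^sub>F n in sequentially. (hitting_time X (far e x n) \<omega> < hitting_time X a \<omega>) \<longleftrightarrow> False"
        using AE_eventually_hits_first[OF e, of a x] by eventually_elim (auto elim!: eventually_mono)
    qed measurable
    ultimately show ?thesis by simp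
  next
    case False
    then have e1: "e = -1" using e by simp
    \<comment> \<open>For \<open>e = -1\<close> the upper endpoint is \<open>a\<close>, so the scale
      formula gives the probability of hitting \<open>a\<close> first and the complement is
      taken.\<close>
    have "c / d n = 1 - measure (P x) {\<omega> \<in> space (P x). hitting_time X a \<omega> < hitting_time X (far e x n) \<omega>}" for n
    proof -
      have "far e x n < x" "x < a" using x e1 by (auto simp: ray_def)
      then have "measure (P x) {\<omega> \<in> space (P x). hitting_time X a \<omega> < hitting_time X (far e x n) \<omega>} = (S x - S (far e x n)) / (S a - S (far e x n))"
        using scale by (simp add: scale_function_def)
      moreover have "S a - S (far e x n) > 0" using d0[of n] e1 by (simp add: d_def)
      ultimately show ?thesis using e1 by (simp add: c_def d_def field_simps)
    qed
    moreover have "(\<lambda>n. measure (P x) {\<omega> \<in> space (P x). hitting_time X a \<omega> < hitting_time X (far e x n) \<omega>}) \<longlonglongrightarrow> (if True then 1 else 0)"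
    proof (rule measure_tendsto_const)
      show "AE \<omega> in P x. \<forall>\<^sub>F n in sequentially. (hitting_time X a \<omega> < hitting_time X (far e x n) \<omega>) \<longleftrightarrow> True"
        using AE_eventually_hits_first[OF e, of a x] by simp
    qed measurable
    ultimately show ?thesis using tendsto_diff[OF tendsto_const[of "1::real"]] by fastforce
  qed
  then have "filterlim (\<lambda>n. inverse (c / d n)) at_top sequentially"
    by (rule filterlim_inverse_at_top) (use c0 d0 in simp)
  then have "filterlim (\<lambda>n. c * inverse (c / d n)) at_top sequentially"
    by (rule filterlim_tendsto_pos_mult_at_top[OF tendsto_const c0])
  moreover have "(\<lambda>n. c * inverse (c / d n)) = d" by (rule ext) (use c0 in simp)
  ultimately have "filterlim d at_top sequentially" by (simp only:)
  then show ?thesis unfolding d_def[abs_def] .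
qed

lemma S_at_top: "filterlim S at_top at_top"
  unfolding filterlim_at_top eventually_at_top_linorder
proof
  fix Z
  have "filterlim (\<lambda>n. 1 * (S (far 1 1 n) - S 0)) at_top sequentially"
    by (rule scale_far_at_top) (auto simp: ray_def)
  then obtain n where "Z - S 0 \<le> 1 * (S (far 1 1 n) - S 0)"
    unfolding filterlim_at_top by (metis (mono_tags, lifting) eventually_happens trivial_limit_sequentially)
  then have "Z \<le> S y" if "far 1 1 n \<le> y" for y
    using monoD[OF strict_mono_mono[OF strict_mono_S] that] by simp
  then show "\<exists>N. \<forall>y\<ge>N. Z \<le> S y" by blast
qed

lemma S_at_bot: "filterlim S at_bot at_bot"
  unfolding filterlim_at_bot eventually_at_bot_linorder
proof
  fix Z
  have "filterlim (\<lambda>n. -1 * (S (far (-1) (-1) n) - S 0)) at_top sequentially"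
    by (rule scale_far_at_top) (auto simp: ray_def)
  then obtain n where "S 0 - Z \<le> -1 * (S (far (-1) (-1) n) - S 0)"
    unfolding filterlim_at_top by (metis (mono_tags, lifting) eventually_happens trivial_limit_sequentially)
  then have "S y \<le> Z" if "y \<le> far (-1) (-1) n" for y
    using monoD[OF strict_mono_mono[OF strict_mono_S] that] by simp
  then show "\<exists>N. \<forall>y\<le>N. S y \<le> Z" by blast
qed

lemma sets_m [measurable_cong]: "sets m = sets borel"
  using speed by (simp add: speed_measure_def)

text \<open>The Green function of the bounded interval is rewritten as the half-line kernel times a
  factor \<open>1 - max / (scale length)\<close>; in this form it serves both orientations and its
  limit is visible.\<close>

lemma speed_far:
  assumes e: "e = 1 \<or> e = -1" and x: "x \<in> ray e a" and f: "f \<in> borel_measurable borel"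
  shows "(\<integral>\<^sup>+\<omega>. (\<integral>\<^sup>+t\<in>(before (min (hitting_time X a \<omega>) (hitting_time X (far e x n) \<omega>))). f (X t \<omega>) \<partial>lborel) \<partial>P x)
    = (\<integral>\<^sup>+y\<in>ray e a \<inter> ray (-e) (far e x n).
         ennreal (min (e * (S x - S a)) (e * (S y - S a))
           * (1 - max (e * (S x - S a)) (e * (S y - S a)) / (e * (S (far e x n) - S a)))) * f y \<partial>m)"
proof (cases "e = 1")
  case True
  let ?b = "far e x n"
  have "a < x" "x < ?b" using x True by (auto simp: ray_def)
  moreover have d: "S ?b - S a \<noteq> 0" using S_less[of a ?b] calculation by auto
  have "green S a ?b x y = min (S x - S a) (S y - S a) * (1 - max (S x - S a) (S y - S a) / (S ?b - S a))" for y
  proof -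
    have eqs: "min (S x - S a) (S y - S a) = S (min x y) - S a" "max (S x - S a) (S y - S a) = S (max x y) - S a"
      using S_less by (auto simp: min_def max_def not_le le_less dest: less_imp_le)
    show ?thesis unfolding green_def eqs using d by (simp add: field_simps)
  qed
  moreover have "ray e a \<inter> ray (-e) ?b = {a<..<?b}" using True by (auto simp: ray_def)
  ultimately show ?thesis using speed f True by (simp add: speed_measure_def)
next
  case False
  then have e1: "e = -1" using e by simp
  let ?b = "far e x n"
  have "x < a" "?b < x" using x e1 by (auto simp: ray_def)
  moreover have d: "S a - S ?b \<noteq> 0" using S_less[of ?b a] calculation by auto
  have "green S ?b a x y = min (S a - S x) (S a - S y) * (1 - max (S a - S x) (S a - S y) / (S a - S ?b))" for y
  proof -
    have eqs: "min (S a - S x) (S a - S y) = S a - S (max x y)" "max (S a - S x) (S a - S y) = S a - S (min x y)"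
      using S_less by (auto simp: min_def max_def not_le le_less dest: less_imp_le)
    show ?thesis unfolding green_def eqs using d by (simp add: field_simps)
  qed
  moreover have "ray e a \<inter> ray (-e) ?b = {?b<..<a}" using e1 by (auto simp: ray_def)
  moreover have "min (hitting_time X a \<omega>) (hitting_time X ?b \<omega>) = min (hitting_time X ?b \<omega>) (hitting_time X a \<omega>)" for \<omega>
    by (rule min.commute)
  ultimately show ?thesis using speed f e1 by (simp add: speed_measure_def)
qed

text \<open>The far boundary is sent to infinity; the Green function of the interval then increases to
  the one of the half-line because \<open>S\<close> is unbounded.\<close>

lemma occupation_formula:
  assumes e: "e = 1 \<or> e = -1" and x: "x \<in> ray e a" and [measurable]: "f \<in> borel_measurable borel"
  shows "(\<integral>\<^sup>+\<omega>. (\<integral>\<^sup>+t. f (X (max 0 t) \<omega>) * indicator (before (exit e a \<omega>)) t \<partial>lborel) \<partial>P x)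
    = (\<integral>\<^sup>+y\<in>ray e a. ennreal (min (e * (S x - S a)) (e * (S y - S a))) * f y \<partial>m)"
proof -
  define b where "b n = far e x n" for n
  let ?\<sigma> = "\<lambda>z. e * (S z - S a)"
  let ?g = "\<lambda>n y. ennreal (min (?\<sigma> x) (?\<sigma> y) * (1 - max (?\<sigma> x) (?\<sigma> y) / ?\<sigma> (b n)))"
  let ?I = "\<lambda>n. ray e a \<inter> ray (-e) (b n)"
  let ?h = "\<lambda>n \<omega>. min (exit e a \<omega>) (exit (-e) (b n) \<omega>)"
  have e': "-e = 1 \<or> -e = -1" using e by auto
  have xb: "x \<in> ray (-e) (b n)" for n using e by (auto simp: b_def ray_def)
  define \<Phi> where "\<Phi> n \<omega> = (\<integral>\<^sup>+t. f (X (max 0 t) \<omega>) * indicator (before (?h n \<omega>)) t \<partial>lborel)" for n \<omega>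
  have [measurable]: "\<Phi> n \<in> borel_measurable (P x)" for n
  proof -
    have "(\<lambda>\<omega>. \<integral>\<^sup>+t. f (X (max 0 t) \<omega>) * (if 0 \<le> t \<and> ennreal t < min (exit e a \<omega>) (exit (-e) (b n) \<omega>) then 1 else 0) \<partial>lborel) \<in> borel_measurable (P x)"
      by measurable
    then show ?thesis by (simp add: \<Phi>_def[abs_def] indicator_def)
  qed
  have hits: "AE \<omega> in P x. \<forall>n. hitting_time X (b n) \<omega> = exit (-e) (b n) \<omega>"
    unfolding AE_all_countable using AE_hitting_time_eq_exit[OF e' xb] by blast
  have \<Phi>_eq: "(\<integral>\<^sup>+\<omega>. \<Phi> n \<omega> \<partial>P x) = (\<integral>\<^sup>+y\<in>?I n. ?g n y * f y \<partial>m)" for n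
  proof -
    have "(\<integral>\<^sup>+\<omega>. \<Phi> n \<omega> \<partial>P x) = (\<integral>\<^sup>+\<omega>. (\<integral>\<^sup>+t\<in>(before (min (hitting_time X a \<omega>) (hitting_time X (b n) \<omega>))). f (X t \<omega>) \<partial>lborel) \<partial>P x)"
    proof (rule nn_integral_cong_AE)
      show "AE \<omega> in P x. \<Phi> n \<omega> = (\<integral>\<^sup>+t\<in>(before (min (hitting_time X a \<omega>) (hitting_time X (b n) \<omega>))). f (X t \<omega>) \<partial>lborel)"
        using AE_hitting_time_eq_exit[OF e x] hits
        by eventually_elim (auto simp: \<Phi>_def indicator_def intro!: nn_integral_cong)
    qed
    also have "\<dots> = (\<integral>\<^sup>+y\<in>?I n. ?g n y * f y \<partial>m)"
      unfolding b_def by (rule speed_far[OF e x]) measurable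
    finally show ?thesis .
  qed
  \<comment> \<open>The exit times through the far levels increase and exceed every finite time, so
    monotone convergence removes the far boundary on the probabilistic side.\<close>
  have paths: "AE \<omega> in P x. (\<forall>n k. n \<le> k \<longrightarrow> exit (-e) (b n) \<omega> \<le> exit (-e) (b k) \<omega>) \<and>
      (\<forall>t\<ge>0. \<exists>n. ennreal t < exit (-e) (b n) \<omega>)"
    using AE_path[of x] hits
  proof eventually_elim
    case (elim \<omega>)
    then have w: "continuous_on {0..} (\<lambda>t. X t \<omega>)" and w0: "X 0 \<omega> = x" by auto
    have h: "exit (-e) (b n) \<omega> = hit (\<lambda>t. X t \<omega>) (far e x n)" for n
      using elim by (simp add: hitting_time_eq_hit b_def)
    have "exit (-e) (b n) \<omega> \<le> exit (-e) (b k) \<omega>" if "n \<le> k" for n k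
      unfolding h using hit_far_mono[OF e w that] by (simp add: w0)
    moreover have "\<exists>n. ennreal t < exit (-e) (b n) \<omega>" if "0 \<le> t" for t
      unfolding h using eventually_happens[OF eventually_less_hit[OF e w that]] by (simp add: w0)
    ultimately show ?case by blast
  qed
  have "(\<integral>\<^sup>+\<omega>. (\<integral>\<^sup>+t. f (X (max 0 t) \<omega>) * indicator (before (exit e a \<omega>)) t \<partial>lborel) \<partial>P x)
      = (\<integral>\<^sup>+\<omega>. (SUP n. \<Phi> n \<omega>) \<partial>P x)"
  proof (rule nn_integral_cong_AE)
    show "AE \<omega> in P x. (\<integral>\<^sup>+t. f (X (max 0 t) \<omega>) * indicator (before (exit e a \<omega>)) t \<partial>lborel) = (SUP n. \<Phi> n \<omega>)"
      using paths AE_space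
    proof eventually_elim
      case (elim \<omega>)
      have [measurable]: "(\<lambda>t. X (max 0 t) \<omega>) \<in> borel_measurable borel"
        using measurable_Pair2[OF X_joint_measurable' elim(2)] by simp
      have "(SUP n. \<Phi> n \<omega>) = (\<integral>\<^sup>+t. (SUP n. f (X (max 0 t) \<omega>) * indicator (before (?h n \<omega>)) t) \<partial>lborel)"
        unfolding \<Phi>_def
      proof (rule nn_integral_monotone_convergence_SUP[symmetric])
        show "incseq (\<lambda>n t. f (X (max 0 t) \<omega>) * indicator (before (?h n \<omega>)) t)"
        proof (intro incseq_SucI le_funI mult_left_mono)
          fix n t
          have "exit (-e) (b n) \<omega> \<le> exit (-e) (b (Suc n)) \<omega>" using elim(1) by simp
          then show "indicator (before (?h n \<omega>)) t
            \<le> (indicator (before (?h (Suc n) \<omega>)) t :: ennreal)"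
            by (auto simp: indicator_def)
        qed simp
      qed measurable
      also have "\<dots> = (\<integral>\<^sup>+t. f (X (max 0 t) \<omega>) * indicator (before (exit e a \<omega>)) t \<partial>lborel)"
      proof (rule nn_integral_cong)
        fix t :: real
        show "(SUP n. f (X (max 0 t) \<omega>) * indicator (before (?h n \<omega>)) t)
            = f (X (max 0 t) \<omega>) * indicator (before (exit e a \<omega>)) t"
        proof (rule antisym)
          show "(SUP n. f (X (max 0 t) \<omega>) * indicator (before (?h n \<omega>)) t)
            \<le> f (X (max 0 t) \<omega>) * indicator (before (exit e a \<omega>)) t"
            by (intro SUP_least) (auto simp: indicator_def)
          show "f (X (max 0 t) \<omega>) * indicator (before (exit e a \<omega>)) t
            \<le> (SUP n. f (X (max 0 t) \<omega>) * indicator (before (?h n \<omega>)) t)"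
          proof (cases "0 \<le> t")
            case True
            then obtain n where "ennreal t < exit (-e) (b n) \<omega>" using elim(1) by blast
            then show ?thesis by (intro SUP_upper2[of n]) (auto simp: indicator_def)
          qed simp
        qed
      qed
      finally show ?case by simp
    qed
  qed
  also have "\<dots> = (SUP n. (\<integral>\<^sup>+\<omega>. \<Phi> n \<omega> \<partial>P x))"
  proof (rule nn_integral_monotone_convergence_SUP_AE)
    fix n
    show "AE \<omega> in P x. \<Phi> n \<omega> \<le> \<Phi> (Suc n) \<omega>"
      using paths
    proof eventually_elim
      case (elim \<omega>)
      then have "exit (-e) (b n) \<omega> \<le> exit (-e) (b (Suc n)) \<omega>" by simp
      then show ?case
        unfolding \<Phi>_def by (intro nn_integral_mono) (auto simp: indicator_def dest: less_le_trans)
    qed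
  qed measurable
  also have "\<dots> = (SUP n. (\<integral>\<^sup>+y\<in>?I n. ?g n y * f y \<partial>m))"
    by (simp only: \<Phi>_eq)
  also have "\<dots> = (\<integral>\<^sup>+y. (SUP n. ?g n y * f y * indicator (?I n) y) \<partial>m)"
  proof (rule nn_integral_monotone_convergence_SUP[symmetric])
    have [measurable]: "S \<in> borel_measurable borel" by (intro borel_measurable_continuous_onI continuous_S)
    show "(\<lambda>y. ?g n y * f y * indicator (?I n) y) \<in> borel_measurable m" for n
      by measurable
    show "incseq (\<lambda>n y. ?g n y * f y * indicator (?I n) y)"
    proof (intro incseq_SucI le_funI)
      fix n y
      show "?g n y * f y * indicator (?I n) y
        \<le> ?g (Suc n) y * f y * indicator (?I (Suc n)) y"
      proof (cases "y \<in> ?I n")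
        case True
        then have y: "y \<in> ray e a" "y \<in> ray (-e) (b (Suc n))" using e by (auto simp: ray_def b_def)
        have pos: "0 < ?\<sigma> x" "0 < ?\<sigma> y" "0 < ?\<sigma> (b n)" "?\<sigma> (b n) \<le> ?\<sigma> (b (Suc n))"
          using x y(1) e S_less strict_mono_less_eq[OF strict_mono_S] by (auto simp: ray_def b_def)
        \<comment> \<open>The killing correction decreases as the boundary recedes, which makes the
          Green functions increasing in \<open>n\<close>.\<close>
        have "max (?\<sigma> x) (?\<sigma> y) / ?\<sigma> (b (Suc n)) \<le> max (?\<sigma> x) (?\<sigma> y) / ?\<sigma> (b n)"
          using pos by (intro divide_left_mono) auto
        then have "min (?\<sigma> x) (?\<sigma> y) * (1 - max (?\<sigma> x) (?\<sigma> y) / ?\<sigma> (b n)) \<le> min (?\<sigma> x) (?\<sigma> y) * (1 - max (?\<sigma> x) (?\<sigma> y) / ?\<sigma> (b (Suc n)))"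
          using pos by (intro mult_left_mono) auto
        then show ?thesis using True y by (auto intro!: mult_right_mono ennreal_leI)
      qed simp
    qed
  qed
  also have "\<dots> = (\<integral>\<^sup>+y\<in>ray e a. ennreal (min (?\<sigma> x) (?\<sigma> y)) * f y \<partial>m)"
  proof (rule nn_integral_cong)
    fix y
    show "(SUP n. ?g n y * f y * indicator (?I n) y)
        = ennreal (min (?\<sigma> x) (?\<sigma> y)) * f y * indicator (ray e a) y"
    proof (cases "y \<in> ray e a")
      case True
      have pos: "0 < ?\<sigma> x" "0 < ?\<sigma> y" "0 < ?\<sigma> (b n)" for n
        using x True e S_less by (auto simp: ray_def b_def)
      \<comment> \<open>From \<open>N\<close> on the point \<open>y\<close> lies inside the
        interval, so the supremum may be computed along this tail, where the indicator is 1.\<close>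
      obtain N where N: "e * (y - x) \<le> real N" using real_arch_simple by blast
      have yb: "y \<in> ray (-e) (b n)" if "N \<le> n" for n
        using N that e by (auto simp: ray_def b_def)
      have bound: "?g n y \<le> ennreal (min (?\<sigma> x) (?\<sigma> y))" for n
      proof (rule ennreal_leI)
        have "0 \<le> max (?\<sigma> x) (?\<sigma> y) / ?\<sigma> (b n)" using pos(1,2) pos(3)[of n] by (intro divide_nonneg_nonneg) auto
        then show "min (?\<sigma> x) (?\<sigma> y) * (1 - max (?\<sigma> x) (?\<sigma> y) / ?\<sigma> (b n)) \<le> min (?\<sigma> x) (?\<sigma> y)"
          using pos(1,2) by (intro mult_left_le) auto
      qed
      have "(\<lambda>n. min (?\<sigma> x) (?\<sigma> y) * (1 - max (?\<sigma> x) (?\<sigma> y) / ?\<sigma> (b n))) \<longlonglongrightarrow> min (?\<sigma> x) (?\<sigma> y) * (1 - 0)"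
        unfolding b_def
        by (intro tendsto_mult tendsto_const tendsto_diff tendsto_divide_0[OF tendsto_const]
            filterlim_at_top_imp_at_infinity scale_far_at_top e x)
      then have lim: "(\<lambda>n. ?g n y) \<longlonglongrightarrow> ennreal (min (?\<sigma> x) (?\<sigma> y))"
        by (intro tendsto_ennrealI) simp
      have sup: "(SUP n\<in>{N..}. ?g n y) = ennreal (min (?\<sigma> x) (?\<sigma> y))"
      proof (rule antisym)
        show "(SUP n\<in>{N..}. ?g n y) \<le> ennreal (min (?\<sigma> x) (?\<sigma> y))"
          by (intro SUP_least bound)
        show "ennreal (min (?\<sigma> x) (?\<sigma> y)) \<le> (SUP n\<in>{N..}. ?g n y)"
          by (rule LIMSEQ_le_const2[OF lim]) (auto intro!: exI[of _ N] SUP_upper)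
      qed
      show ?thesis
      proof (rule antisym)
        show "(SUP n. ?g n y * f y * indicator (?I n) y)
          \<le> ennreal (min (?\<sigma> x) (?\<sigma> y)) * f y * indicator (ray e a) y"
          by (intro SUP_least mult_mono bound) (auto simp: indicator_def)
        have "ennreal (min (?\<sigma> x) (?\<sigma> y)) * f y * indicator (ray e a) y = (SUP n\<in>{N..}. ?g n y * f y)"
          using True by (simp add: sup[symmetric] SUP_mult_right_ennreal)
        also have "\<dots> \<le> (SUP n. ?g n y * f y * indicator (?I n) y)"
        proof (rule SUP_least)
          fix n assume "n \<in> {N..}"
          then have "y \<in> ?I n" using yb[of n] True by simp
          then show "?g n y * f y
              \<le> (SUP n. ?g n y * f y * indicator (?I n) y)"
            by (intro SUP_upper2[of n]) auto
        qed
        finally show "ennreal (min (?\<sigma> x) (?\<sigma> y)) * f y * indicator (ray e a) y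
          \<le> (SUP n. ?g n y * f y * indicator (?I n) y)" .
      qed
    qed simp
  qed
  finally show ?thesis .
qed

section \<open>Finiteness and positivity of the speed measure\<close>

lemma nn_integral_hitting_time:
  assumes e: "e = 1 \<or> e = -1" and x: "x \<in> ray e a"
  shows "(\<integral>\<^sup>+\<omega>. hitting_time X a \<omega> \<partial>P x) = (\<integral>\<^sup>+y\<in>ray e a. ennreal (min (e * (S x - S a)) (e * (S y - S a))) \<partial>m)"
proof -
  have "(\<integral>\<^sup>+\<omega>. hitting_time X a \<omega> \<partial>P x) = (\<integral>\<^sup>+\<omega>. (\<integral>\<^sup>+t. 1 * indicator (before (exit e a \<omega>)) t \<partial>lborel) \<partial>P x)"
    by (intro nn_integral_cong_AE)
      (use AE_hitting_time_eq_exit[OF e x] in \<open>auto elim!: eventually_mono simp: emeasure_lborel_before\<close>)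
  also have "\<dots> = (\<integral>\<^sup>+y\<in>ray e a. ennreal (min (e * (S x - S a)) (e * (S y - S a))) * 1 \<partial>m)"
    by (rule occupation_formula[OF e x, of "\<lambda>_. 1"]) simp
  finally show ?thesis by simp
qed

text \<open>Take \<open>a\<close> one unit behind \<open>c\<close>. On \<open>ray e c\<close> the
  Green kernel at \<open>c\<close> is the positive constant scale distance from \<open>a\<close> to
  \<open>c\<close>, so this constant times the mass is at most the mean of \<open>T_a\<close>
  started at \<open>c\<close>, which is finite.\<close>

lemma emeasure_ray_finite:
  assumes e: "e = 1 \<or> e = -1"
  shows "emeasure m (ray e c) < \<top>"
proof -
  define a where "a = c - e"
  let ?\<sigma> = "\<lambda>z. e * (S z - S a)"
  have c: "c \<in> ray e a" using e by (auto simp: a_def ray_def)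
  then have pos: "0 < ?\<sigma> c" using e S_less by (auto simp: ray_def)
  have "ennreal (?\<sigma> c) * emeasure m (ray e c) = (\<integral>\<^sup>+y\<in>ray e c. ennreal (?\<sigma> c) \<partial>m)"
    by (rule nn_integral_cmult_indicator[symmetric]) (simp add: sets_m)
  also have "\<dots> \<le> (\<integral>\<^sup>+y\<in>ray e a. ennreal (min (?\<sigma> c) (?\<sigma> y)) \<partial>m)"
  proof (rule nn_integral_mono)
    fix y
    show "ennreal (?\<sigma> c) * indicator (ray e c) y \<le> ennreal (min (?\<sigma> c) (?\<sigma> y)) * indicator (ray e a) y"
    proof (cases "y \<in> ray e c")
      case True
      then have "y \<in> ray e a" "?\<sigma> c < ?\<sigma> y" using e S_less by (auto simp: ray_def a_def)
      then show ?thesis using True by simp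
    qed simp
  qed
  also have "\<dots> < \<top>"
    using positively_recurrent[of c a] by (simp add: nn_integral_hitting_time[OF e c])
  finally show ?thesis using pos by (auto simp: ennreal_mult_less_top)
qed

text \<open>Without mass on the interval, the mean exit time from its midpoint would be zero by the
  speed measure formula; a continuous path needs positive time to reach an endpoint.\<close>

lemma m_charges_intervals:
  assumes uv: "u < v"
  shows "0 < emeasure m {u<..<v}"
proof (rule ccontr)
  assume "\<not> 0 < emeasure m {u<..<v}"
  then have null: "{u<..<v} \<in> null_sets m" by (auto simp: null_sets_def sets_m)
  define x where "x = (u + v) / 2"
  have x: "u < x" "x < v" using uv by (auto simp: x_def)
  let ?T = "\<lambda>\<omega>. min (hitting_time X u \<omega>) (hitting_time X v \<omega>)"
  have eq: "(\<integral>\<^sup>+t\<in>(before (?T \<omega>)). 1 \<partial>lborel) = ?T \<omega>" for \<omega>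
    using emeasure_lborel_before[of "?T \<omega>"] by simp
  have "(\<integral>\<^sup>+\<omega>. ?T \<omega> \<partial>P x) = (\<integral>\<^sup>+\<omega>. (\<integral>\<^sup>+t\<in>(before (?T \<omega>)). 1 \<partial>lborel) \<partial>P x)"
    by (simp only: eq)
  also have "\<dots> = (\<integral>\<^sup>+y\<in>{u<..<v}. ennreal (green S u v x y) * 1 \<partial>m)"
    using speed[unfolded speed_measure_def, THEN conjunct2, rule_format, of u x v "\<lambda>_. 1"] x by simp
  also have "\<dots> = 0"
    by (rule nn_integral_null_set[OF null])
  finally have "AE \<omega> in P x. ?T \<omega> = 0"
    by (subst (asm) nn_integral_0_iff_AE) auto
  moreover have "AE \<omega> in P x. ?T \<omega> > 0"
    using AE_path[of x]
  proof eventually_elim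
    case (elim \<omega>)
    then have w: "continuous_on {0..} (\<lambda>t. X t \<omega>)" and w0: "X 0 \<omega> = x" by auto
    have "ennreal 0 < hit (\<lambda>t. X t \<omega>) u"
      by (subst less_hit_iff_stays[of 1, OF _ w], simp_all add: stays_iff[OF w] w0 x ray_def)
    moreover have "ennreal 0 < hit (\<lambda>t. X t \<omega>) v"
      by (subst less_hit_iff_stays[of "-1", OF _ w], simp_all add: stays_iff[OF w] w0 x ray_def)
    ultimately show ?case by (simp add: hitting_time_eq_hit)
  qed
  ultimately have "AE \<omega> in P x. False" by eventually_elim simp
  then show False by (simp add: PX.AE_False)
qed

lemma scale_speed: "scale_speed S m"
proof (rule scale_speed.intro)
  show "continuous_on UNIV S" "strict_mono S" by (rule continuous_S strict_mono_S)+
  show "filterlim S at_top at_top" "filterlim S at_bot at_bot" by (rule S_at_top S_at_bot)+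
  show "sets m = sets borel" by (rule sets_m)
  show "0 < emeasure m {u<..<v}" if "u < v" for u v by (rule m_charges_intervals[OF that])
  have "emeasure m (space m) \<le> emeasure m (ray 1 0 \<union> ray (-1) 1)"
    by (rule emeasure_mono) (auto simp: ray_def sets_m)
  also have "\<dots> \<le> emeasure m (ray 1 0) + emeasure m (ray (-1) 1)"
    by (rule emeasure_subadditive) (auto simp: sets_m)
  also have "\<dots> < \<top>" using emeasure_ray_finite[of 1 0] emeasure_ray_finite[of "-1" 1] by simp
  finally show "finite_measure m" by (intro finite_measureI) simp
qed

sublocale SS: scale_speed S m by (rule scale_speed)

section \<open>Moments, exponential moments and the critical exponent\<close>

lemma moment_path_from:
  "(\<integral>\<^sup>+\<omega>. ennreal (1 / fact n) * exit_time e a (path_from X 0 \<omega>) ^ n \<partial>P x) = (\<integral>\<^sup>+\<omega>. ennreal (1 / fact n) * exit e a \<omega> ^ n \<partial>P x)"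
proof -
  have "exit_time e a (path_from X 0 \<omega>) = exit e a \<omega>" for \<omega>
    unfolding path_from_def by (simp add: exit_time_restrict)
  then show ?thesis by simp
qed

text \<open>Integrating \<open>(T - t)\<^sup>n / n!\<close> over \<open>t < T\<close> gives \<open>T\<^sup>n\<^sup>+\<^sup>1 / (n+1)!\<close>, and on \<open>t < T\<close> the remaining time \<open>T - t\<close> is
  the hitting time of the path shifted by \<open>t\<close>; the Markov property then turns the moments of \<open>T\<close> into
  iterates of the Green operator (Kac).\<close>

lemma moment_eq_green_iter:
  assumes e: "e = 1 \<or> e = -1" and x: "x \<in> ray e a"
  shows "(\<integral>\<^sup>+\<omega>. ennreal (1 / fact n) * exit e a \<omega> ^ n \<partial>P x) = SS.green_iter e a n x"
  using x
proof (induction n arbitrary: x)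
  case 0
  show ?case by (simp add: PX.emeasure_space_1)
next
  case (Suc n)
  interpret pair_sigma_finite lborel "P x" ..
  let ?T = "exit e a"
  \<comment> \<open>The indicator reflects that the induction hypothesis is available only for
    starting points in the half-line; the occupation integral sees no others.\<close>
  let ?f = "\<lambda>y. SS.green_iter e a n y * indicator (ray e a) y"
  let ?Z = "\<lambda>w. ennreal (1 / fact n) * exit_time e a w ^ n"
  have T_AE: "AE \<omega> in P x. continuous_on {0..} (\<lambda>t. X t \<omega>) \<and> X 0 \<omega> = x \<and> hitting_time X a \<omega> = ?T \<omega> \<and> ?T \<omega> < \<top>"
    using AE_path[of x] AE_hitting_time_eq_exit[OF e Suc.prems] AE_hitting_time_finite[of a x]
    by eventually_elim auto
  have stays: "(ennreal t < ?T \<omega>) = stays e a (\<lambda>t. X t \<omega>) t" if "continuous_on {0..} (\<lambda>t. X t \<omega>)" "X 0 \<omega> = x" "hitting_time X a \<omega> = ?T \<omega>" "0 \<le> t" for \<omega> t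
    using less_hit_iff_stays[OF e that(1) _ that(4), of a] that Suc.prems by (simp add: hitting_time_eq_hit)
  \<comment> \<open>The Markov property acts at a fixed time \<open>t\<close>; Tonelli is applied
    before and after to exchange the integrals over time and paths.\<close>
  have step: "(\<integral>\<^sup>+\<omega>. (ennreal (1 / fact n) * (?T \<omega> - ennreal t) ^ n) * indicator (before (?T \<omega>)) t \<partial>P x)
      = (\<integral>\<^sup>+\<omega>. ?f (X (max 0 t) \<omega>) * indicator (before (?T \<omega>)) t \<partial>P x)" for t
  proof (cases "0 \<le> t")
    case True
    have "(\<integral>\<^sup>+\<omega>. (ennreal (1 / fact n) * (?T \<omega> - ennreal t) ^ n) * indicator (before (?T \<omega>)) t \<partial>P x)
        = (\<integral>\<^sup>+\<omega>. indicator {\<omega>. stays e a (\<lambda>s. X s \<omega>) t} \<omega> * ?Z (path_from X t \<omega>) \<partial>P x)"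
    proof (rule nn_integral_cong_AE)
      show "AE \<omega> in P x. (ennreal (1 / fact n) * (?T \<omega> - ennreal t) ^ n) * indicator (before (?T \<omega>)) t
          = indicator {\<omega>. stays e a (\<lambda>s. X s \<omega>) t} \<omega> * ?Z (path_from X t \<omega>)"
        using T_AE
      proof eventually_elim
        case (elim \<omega>)
        then have w: "continuous_on {0..} (\<lambda>t. X t \<omega>)" by simp
        show ?case
        proof (cases "stays e a (\<lambda>s. X s \<omega>) t")
          case st: True
          then have pos: "\<And>s. s \<in> {0..t} \<Longrightarrow> 0 < e * (X s \<omega> - a)" using stays_iff[OF w True] by blast
          have "continuous_on {0..} (\<lambda>s. X (t + s) \<omega>)"
            by (rule continuous_on_compose2[OF w]) (use True in \<open>auto intro!: continuous_intros\<close>)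
          then have "hit (\<lambda>s. X (t + s) \<omega>) a = exit_time e a (\<lambda>s. X (t + s) \<omega>)"
            using pos[of t] True by (intro hit_eq_exit_time[OF e]) (auto simp: ray_def)
          also have "\<dots> = exit_time e a (path_from X t \<omega>)"
            unfolding path_from_def by (rule exit_time_restrict[symmetric])
          finally have shifted: "hit (\<lambda>s. X (t + s) \<omega>) a = exit_time e a (path_from X t \<omega>)" .
          have "hit (\<lambda>s. X s \<omega>) a = ennreal t + hit (\<lambda>s. X (t + s) \<omega>) a"
            by (rule hit_shift[OF True]) (use pos in force)
          then have "?T \<omega> = ennreal t + exit_time e a (path_from X t \<omega>)"
            using elim shifted by (simp add: hitting_time_eq_hit)
          then have "?T \<omega> - ennreal t = exit_time e a (path_from X t \<omega>)" by simp
          then show ?thesis using st stays[of \<omega> t] elim True by (simp add: indicator_def)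
        next
          case False
          then show ?thesis using stays[of \<omega> t] elim True by (simp add: indicator_def)
        qed
      qed
    qed
    also have "\<dots> = (\<integral>\<^sup>+\<omega>. indicator {\<omega>. stays e a (\<lambda>s. X s \<omega>) t} \<omega> * (\<integral>\<^sup>+\<omega>'. ?Z (path_from X 0 \<omega>') \<partial>P (X t \<omega>)) \<partial>P x)"
    proof (rule Markov_stays[OF True])
      note [measurable] = exit_time_PiM
      show "?Z \<in> borel_measurable (PiM {0..} (\<lambda>_. borel))" by measurable
    qed
    also have "\<dots> = (\<integral>\<^sup>+\<omega>. ?f (X (max 0 t) \<omega>) * indicator (before (?T \<omega>)) t \<partial>P x)"
    proof (rule nn_integral_cong_AE)
      show "AE \<omega> in P x. indicator {\<omega>. stays e a (\<lambda>s. X s \<omega>) t} \<omega> * (\<integral>\<^sup>+\<omega>'. ?Z (path_from X 0 \<omega>') \<partial>P (X t \<omega>))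
          = ?f (X (max 0 t) \<omega>) * indicator (before (?T \<omega>)) t"
        using T_AE
      proof eventually_elim
        case (elim \<omega>)
        show ?case
        proof (cases "stays e a (\<lambda>s. X s \<omega>) t")
          case st: True
          \<comment> \<open>Before the exit the current position is an admissible starting point;
            the induction hypothesis, stated for arbitrary \<open>x\<close>, applies to it.\<close>
          then have "X t \<omega> \<in> ray e a" using stays_iff[of "\<lambda>s. X s \<omega>" t e a] elim True by (auto simp: ray_def)
          then have "(\<integral>\<^sup>+\<omega>'. ?Z (path_from X 0 \<omega>') \<partial>P (X t \<omega>)) = ?f (X t \<omega>)"
            unfolding moment_path_from by (simp add: Suc.IH)
          then show ?thesis using st stays[of \<omega> t] elim True by (simp add: indicator_def)
        next
          case False
          then show ?thesis using stays[of \<omega> t] elim True by (simp add: indicator_def)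
        qed
      qed
    qed
    finally show ?thesis .
  qed simp
  have m1: "(\<lambda>(t, \<omega>). (ennreal (1 / fact n) * (?T \<omega> - ennreal t) ^ n) * indicator (before (?T \<omega>)) t) \<in> borel_measurable (lborel \<Otimes>\<^sub>M P x)"
  proof -
    have "(\<lambda>(t, \<omega>). (ennreal (1 / fact n) * (?T \<omega> - ennreal t) ^ n) * (if 0 \<le> t \<and> ennreal t < ?T \<omega> then 1 else 0)) \<in> borel_measurable (lborel \<Otimes>\<^sub>M P x)"
      by measurable
    then show ?thesis by (simp add: indicator_def)
  qed
  have m2: "(\<lambda>(t, \<omega>). ?f (X (max 0 t) \<omega>) * indicator (before (?T \<omega>)) t) \<in> borel_measurable (lborel \<Otimes>\<^sub>M P x)"
  proof -
    have X: "(\<lambda>w. X (max 0 (fst w)) (snd w)) \<in> borel_measurable (lborel \<Otimes>\<^sub>M P x)"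
      using X_joint_measurable[of x] by (simp add: case_prod_beta)
    have f: "?f \<in> borel_measurable borel" by measurable
    have [measurable]: "(\<lambda>w. ?f (X (max 0 (fst w)) (snd w))) \<in> borel_measurable (lborel \<Otimes>\<^sub>M P x)"
      by (rule measurable_compose[OF X f])
    have "(\<lambda>w. ?f (X (max 0 (fst w)) (snd w)) * (if 0 \<le> fst w \<and> ennreal (fst w) < ?T (snd w) then 1 else 0)) \<in> borel_measurable (lborel \<Otimes>\<^sub>M P x)"
      by measurable
    then show ?thesis by (simp add: indicator_def case_prod_beta)
  qed
  have "(\<integral>\<^sup>+\<omega>. ennreal (1 / fact (Suc n)) * ?T \<omega> ^ Suc n \<partial>P x)
      = (\<integral>\<^sup>+\<omega>. (\<integral>\<^sup>+t. (ennreal (1 / fact n) * (?T \<omega> - ennreal t) ^ n) * indicator (before (?T \<omega>)) t \<partial>lborel) \<partial>P x)"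
  proof (rule nn_integral_cong_AE)
    show "AE \<omega> in P x. ennreal (1 / fact (Suc n)) * ?T \<omega> ^ Suc n
      = (\<integral>\<^sup>+t. (ennreal (1 / fact n) * (?T \<omega> - ennreal t) ^ n) * indicator (before (?T \<omega>)) t \<partial>lborel)"
      using T_AE
    proof eventually_elim
      case (elim \<omega>)
      then show ?case by (simp only: nn_integral_power_remaining_time)
    qed
  qed
  also have "\<dots> = (\<integral>\<^sup>+t. (\<integral>\<^sup>+\<omega>. (ennreal (1 / fact n) * (?T \<omega> - ennreal t) ^ n) * indicator (before (?T \<omega>)) t \<partial>P x) \<partial>lborel)"
    by (rule Fubini'[OF m1])
  also have "\<dots> = (\<integral>\<^sup>+t. (\<integral>\<^sup>+\<omega>. ?f (X (max 0 t) \<omega>) * indicator (before (?T \<omega>)) t \<partial>P x) \<partial>lborel)"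
    by (simp only: step)
  also have "\<dots> = (\<integral>\<^sup>+\<omega>. (\<integral>\<^sup>+t. ?f (X (max 0 t) \<omega>) * indicator (before (?T \<omega>)) t \<partial>lborel) \<partial>P x)"
    by (rule Fubini'[OF m2, symmetric])
  also have "\<dots> = (\<integral>\<^sup>+y\<in>ray e a. ennreal (min (e * (S x - S a)) (e * (S y - S a))) * ?f y \<partial>m)"
    by (rule occupation_formula[OF e Suc.prems]) measurable
  also have "\<dots> = SS.green_iter e a (Suc n) x"
    by (simp add: SS.green_op_def SS.sig_def) (auto intro!: nn_integral_cong simp: indicator_def)
  finally show ?case .
qed

text \<open>Expansion of the exponential into nonnegative terms, integrated termwise, so the
  equality includes infinite values. Almost sure finiteness of the hitting time disposes of the
  branch with value \<open>\<top>\<close>.\<close>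

lemma exp_moment_eq:
  assumes e: "e = 1 \<or> e = -1" and x: "x \<in> ray e a" and l: "0 \<le> l"
  shows "exp_moment P X l a x = SS.exp_series l e a x"
proof -
  have series: "ennreal (exp (l * r)) = (\<Sum>n. ennreal (l ^ n) * (ennreal (1 / fact n) * ennreal r ^ n))" if "0 \<le> r" for r
  proof -
    have "(\<lambda>n. (l * r) ^ n /\<^sub>R fact n) sums exp (l * r)" by (rule exp_converges)
    then have "(\<Sum>n. ennreal ((l * r) ^ n /\<^sub>R fact n)) = ennreal (exp (l * r))"
      using l that by (intro suminf_ennreal_eq) auto
    moreover have "ennreal ((l * r) ^ n /\<^sub>R fact n) = ennreal (l ^ n) * (ennreal (1 / fact n) * ennreal r ^ n)" for n
      using l that by (simp add: ennreal_power ennreal_mult[symmetric] power_mult_distrib field_simps)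
    ultimately show ?thesis by simp
  qed
  have "exp_moment P X l a x = (\<integral>\<^sup>+\<omega>. (\<Sum>n. ennreal (l ^ n) * (ennreal (1 / fact n) * exit e a \<omega> ^ n)) \<partial>P x)"
    unfolding exp_moment_def
  proof (rule nn_integral_cong_AE)
    show "AE \<omega> in P x. (if hitting_time X a \<omega> = \<top> then \<top> else ennreal (exp (l * enn2real (hitting_time X a \<omega>))))
        = (\<Sum>n. ennreal (l ^ n) * (ennreal (1 / fact n) * exit e a \<omega> ^ n))"
      using AE_hitting_time_eq_exit[OF e x] AE_hitting_time_finite[of a x]
    proof eventually_elim
      case (elim \<omega>)
      then obtain r where r: "exit e a \<omega> = ennreal r" "0 \<le> r" by (cases "exit e a \<omega>") auto
      then show ?case using series[OF r(2)] elim by simp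
    qed
  qed
  also have "\<dots> = (\<Sum>n. \<integral>\<^sup>+\<omega>. ennreal (l ^ n) * (ennreal (1 / fact n) * exit e a \<omega> ^ n) \<partial>P x)"
    by (rule nn_integral_suminf) measurable
  also have "\<dots> = SS.exp_series l e a x"
    unfolding SS.exp_series_def moment_eq_green_iter[OF e x, symmetric]
    by (intro suminf_cong nn_integral_cmult) measurable
  finally show ?thesis .
qed

definition lambda :: "real \<Rightarrow> real \<Rightarrow> ennreal" where
  "lambda e a = (SUP l\<in>{l. 0 \<le> l \<and> (\<forall>x\<in>ray e a. exp_moment P X l a x < \<top>)}. ennreal l)"

text \<open>A positive admissible \<open>l\<close> yields \<open>A \<le> 1 / l\<close> through the
  supersolution argument, and every \<open>l\<close> strictly below \<open>1 / A\<close> is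
  admissible by convergence of the Neumann series. Admissibility of the endpoint itself stays
  undecided, and density of the order bridges it.\<close>

lemma lambda_eq:
  assumes e: "e = 1 \<or> e = -1"
  shows "lambda e a = 1 / SS.A_const e a"
proof (rule antisym)
  show "lambda e a \<le> 1 / SS.A_const e a"
    unfolding lambda_def
  proof (rule SUP_least)
    fix l assume l: "l \<in> {l. 0 \<le> l \<and> (\<forall>x\<in>ray e a. exp_moment P X l a x < \<top>)}"
    show "ennreal l \<le> 1 / SS.A_const e a"
    proof (cases "l = 0")
      case False
      then have l0: "0 < l" using l by simp
      have "SS.A_const e a \<le> ennreal (1 / l)"
      proof (rule SS.A_const_le_if_exp_series_finite[OF e l0])
        fix x assume x: "x \<in> ray e a"
        then have "exp_moment P X l a x < \<top>" using l by blast
        then show "SS.exp_series l e a x < \<top>" using exp_moment_eq[OF e x, of l] l0 by simp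
      qed
      then have "1 / ennreal (1 / l) \<le> 1 / SS.A_const e a" by (rule one_divide_antimono_ennreal)
      then show ?thesis using l0 divide_ennreal[of 1 "1 / l"] by simp
    qed simp
  qed
  show "1 / SS.A_const e a \<le> lambda e a"
  proof (rule dense_le)
    fix c assume c: "c < 1 / SS.A_const e a"
    then obtain l where l: "c = ennreal l" "0 \<le> l" by (cases c) auto
    have "exp_moment P X l a x < \<top>" if "x \<in> ray e a" for x
      using SS.exp_series_finite[OF e l(2) _ that] c exp_moment_eq[OF e that l(2)] by (simp add: l(1))
    then show "c \<le> lambda e a" unfolding l(1) lambda_def using l(2) by (intro SUP_upper) auto
  qed
qed

end

theorem theorem4p4:
  fixes P :: "real \<Rightarrow> 'w measure" and X :: "real \<Rightarrow> 'w \<Rightarrow> real"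
    and S :: "real \<Rightarrow> real" and m :: "real measure"
  assumes "positively_recurrent_diffusion P X"
    and "scale_function P X S"
    and "speed_measure P X S m"
  shows "(\<forall>a.
            1 / A_plus S m a = gap_plus S m a \<and> gap_plus S m a = lambda_plus P X a \<and>
            1 / A_minus S m a = gap_minus S m a \<and> gap_minus S m a = lambda_minus P X a \<and>
            B_plus S m a \<le> A_plus S m a \<and> A_plus S m a \<le> 4 * B_plus S m a \<and>
            B_minus S m a \<le> A_minus S m a \<and> A_minus S m a \<le> 4 * B_minus S m a) \<and>
         (SUP a. min (A_plus S m a) (A_minus S m a)) \<le> poincare_const S m \<and>
         poincare_const S m \<le> (INF a. max (A_plus S m a) (A_minus S m a)) \<and>
         (SUP a. min (lambda_plus P X a) (lambda_minus P X a)) \<le> gap S m \<and>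
         gap S m \<le> (INF a. max (lambda_plus P X a) (lambda_minus P X a)) \<and>
         gap S m = 1 / poincare_const S m"
proof -
  interpret diffusion_scale P X S m
    using assms by (intro diffusion_scale.intro diffusion_scale_axioms.intro)
  have sets_eq: "cray 1 a = {a..}" "cray (-1) a = {..a}" "ray 1 a = {a<..}" "ray (-1) a = {..<a}" for a
    by (auto simp: cray_def ray_def)
  have A: "A_plus S m a = SS.A_const 1 a" "A_minus S m a = SS.A_const (-1) a" for a
    by (simp_all add: A_plus_def A_minus_def SS.A_const_def sets_eq)
  have B: "B_plus S m a = SS.B_const 1 a" "B_minus S m a = SS.B_const (-1) a" for a
    by (simp_all add: B_plus_def B_minus_def SS.B_const_def sets_eq)
  have G: "gap_plus S m a = 1 / SS.A_const 1 a" "gap_minus S m a = 1 / SS.A_const (-1) a" for a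
    unfolding SS.killed_gap_eq[of 1 a, simplified, symmetric] SS.killed_gap_eq[of "-1" a, simplified, symmetric]
    by (simp_all add: gap_plus_def gap_minus_def SS.killed_gap_def SS.killed_domain_def sets_eq not_less)
  have L: "lambda_plus P X a = 1 / SS.A_const 1 a" "lambda_minus P X a = 1 / SS.A_const (-1) a" for a
    unfolding lambda_eq[of 1 a, simplified, symmetric] lambda_eq[of "-1" a, simplified, symmetric]
    by (simp_all add: lambda_plus_def lambda_minus_def lambda_def sets_eq Ball_def)
  \<comment> \<open>Taking reciprocals reverses the order and exchanges minimum and maximum, so the
    upper Poincare bound becomes the lower gap bound, and vice versa.\<close>
  have lower: "min (1 / SS.A_const 1 a) (1 / SS.A_const (-1) a) \<le> gap S m" for a
    unfolding SS.gap_eq using one_divide_antimono_ennreal[OF SS.poincare_const_le_max[of a]]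
    by (auto simp: max_def min_le_iff_disj split: if_splits)
  have upper: "gap S m \<le> max (1 / SS.A_const 1 a) (1 / SS.A_const (-1) a)" for a
    unfolding SS.gap_eq using one_divide_antimono_ennreal[OF SS.min_le_poincare_const[of a]]
    by (auto simp: min_def le_max_iff_disj split: if_splits)
  show ?thesis
    unfolding A B G L
    using SS.B_const_le_A_const SS.A_const_le_4_B_const SS.min_le_poincare_const
      SS.poincare_const_le_max lower upper SS.gap_eq
    by (auto intro!: SUP_least INF_greatest)
qed

end
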